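(* Let $n,q\ge 2$ be integers, $G\in\mathbb{T}(\mathbb{C}^n,2)$ (an $n\times n$ complex matrix) and $\mathcal{V}\in\mathbb{T}(\mathbb{C}^n,q)$. Then $$\mathrm{Edet}(G\circ\mathcal{V})=\left(\mathrm{Det}(G)\right)^{(q-1)^{n-1}}\mathrm{Edet}(\mathcal{V}).$$
   Context: $\mathbb{T}(\mathbb{C}^n,m)$ is the space of $m$-th order $n$-dimensional complex tensors $\mathcal{T}=(t_{i_1\ldots i_m})$, $1\le i_1,\ldots,i_m\le n$. For $\mathbf{x}\in\mathbb{C}^n$, $\mathcal{T}\mathbf{x}^{m-1}\in\mathbb{C}^n$ is the vector with $i$-th entry $\sum_{i_2,\ldots,i_m=1}^n t_{ii_2\ldots i_m}x_{i_2}\cdots x_{i_m}$. The resultant $\mathrm{Res}$ of $n$ homogeneous polynomials in $n$ variables, each of degree $m-1$, is the irreducible polynomial in their coefficients that vanishes if and only if the polynomials have a common zero in $\mathbb{C}^n\setminus\{\mathbf{0}\}$, normalized by $\mathrm{Res}(x_1^{m-1},\ldots,x_n^{m-1})=1$. The E-determinant $\mathrm{Edet}(\mathcal{T})$ is the resultant of the $n$ components of $\mathcal{T}\mathbf{x}^{m-1}$. $\mathrm{Det}$ is the usual determinant. The composition $G\circ\mathcal{V}\in\mathbb{T}(\mathbb{C}^n,q)$ has entries $(G\circ\mathcal{V})_{ij_2\ldots j_q}=\sum_{l=1}^n g_{il}v_{lj_2\ldots j_q}$, so $(G\circ\mathcal{V})\mathbf{x}^{q-1}=G(\mathcal{V}\mathbf{x}^{q-1})$.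 *)

theory Defs
  imports
    "Jordan_Normal_Form.Determinant"
    "HOL-Library.Poly_Mapping"
    "HOL-Library.FuncSet"
begin

section \<open>Multivariate polynomials\<close>

text \<open>
  A monomial in variables of type \<open>'v\<close> is its exponent vector \<open>'v \<Rightarrow>\<^sub>0 nat\<close>; a polynomial is a
  finitely supported map from monomials to coefficients.  Since exponent vectors form a commutative
  monoid under addition, the ring structure that \<open>Poly_Mapping\<close> puts on this type is the usual one.
\<close>

type_synonym ('v, 'a) mpoly = "('v \<Rightarrow>\<^sub>0 nat) \<Rightarrow>\<^sub>0 'a"

definition mon_eval :: "('v \<Rightarrow> 'a::comm_semiring_1) \<Rightarrow> ('v \<Rightarrow>\<^sub>0 nat) \<Rightarrow> 'a" where
  "mon_eval x \<alpha> = (\<Prod>v\<in>Poly_Mapping.keys \<alpha>. x v ^ Poly_Mapping.lookup \<alpha> v)"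

definition mpoly_eval :: "('v \<Rightarrow> 'a::comm_semiring_1) \<Rightarrow> ('v, 'a) mpoly \<Rightarrow> 'a" where
  "mpoly_eval x p = (\<Sum>\<alpha>\<in>Poly_Mapping.keys p. Poly_Mapping.lookup p \<alpha> * mon_eval x \<alpha>)"

definition mon_degree :: "('v \<Rightarrow>\<^sub>0 nat) \<Rightarrow> nat" where
  "mon_degree \<alpha> = (\<Sum>v\<in>Poly_Mapping.keys \<alpha>. Poly_Mapping.lookup \<alpha> v)"

definition monomials :: "nat \<Rightarrow> nat \<Rightarrow> (nat \<Rightarrow>\<^sub>0 nat) set" where
  "monomials n d = {\<alpha>. Poly_Mapping.keys \<alpha> \<subseteq> {..<n} \<and> mon_degree \<alpha> = d}"

text \<open>Homogeneous polynomials of degree \<open>d\<close> in the variables \<open>x\<^sub>0, \<dots>, x\<^sub>n\<^sub>-\<^sub>1\<close>, including 0.\<close>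

definition forms :: "nat \<Rightarrow> nat \<Rightarrow> (nat, complex) mpoly set" where
  "forms n d = {f. Poly_Mapping.keys f \<subseteq> monomials n d}"


section \<open>The resultant\<close>

text \<open>
  The resultant of \<open>n\<close> forms \<open>F 0, \<dots>, F (n - 1)\<close> of degree \<open>d\<close> in \<open>n\<close> variables is a polynomial in
  their coefficients.  The coefficient of \<open>F i\<close> at the monomial \<open>\<alpha>\<close> is represented by the variable
  \<open>(i, \<alpha>)\<close>, and \<open>coeffs_of F\<close> is the corresponding assignment of values.
\<close>

definition coeffs_of :: "(nat \<Rightarrow> (nat, complex) mpoly) \<Rightarrow> nat \<times> (nat \<Rightarrow>\<^sub>0 nat) \<Rightarrow> complex" where
  "coeffs_of F = (\<lambda>(i, \<alpha>). Poly_Mapping.lookup (F i) \<alpha>)"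

definition has_common_zero :: "nat \<Rightarrow> (nat \<Rightarrow> (nat, complex) mpoly) \<Rightarrow> bool" where
  "has_common_zero n F \<longleftrightarrow>
     (\<exists>x \<in> carrier_vec n. x \<noteq> 0\<^sub>v n \<and> (\<forall>i<n. mpoly_eval (\<lambda>j. x $ j) (F i) = 0))"

text \<open>
  \<open>R\<close> lives in the polynomial ring over all variables \<open>(i, \<alpha>)\<close>, and the first condition confines it
  to those with \<open>i < n\<close> and \<open>\<alpha>\<close> of degree \<open>d\<close>.  Factors and units of such an \<open>R\<close> again only involve
  these variables, so irreducibility in the big ring is irreducibility in the ring of polynomials
  in the coefficients.
\<close>

definition is_resultant :: "nat \<Rightarrow> nat \<Rightarrow> (nat \<times> (nat \<Rightarrow>\<^sub>0 nat), complex) mpoly \<Rightarrow> bool" where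
  "is_resultant n d R \<longleftrightarrow>
     (\<forall>\<mu> \<in> Poly_Mapping.keys R. Poly_Mapping.keys \<mu> \<subseteq> {..<n} \<times> monomials n d) \<and>
     Factorial_Ring.irreducible R \<and>
     (\<forall>F. (\<forall>i<n. F i \<in> forms n d) \<longrightarrow>
        (mpoly_eval (coeffs_of F) R = 0 \<longleftrightarrow> has_common_zero n F)) \<and>
     mpoly_eval (coeffs_of (\<lambda>i. Poly_Mapping.single (Poly_Mapping.single i d) 1)) R = 1"

definition resultant_poly :: "nat \<Rightarrow> nat \<Rightarrow> (nat \<times> (nat \<Rightarrow>\<^sub>0 nat), complex) mpoly" where
  "resultant_poly n d = (THE R. is_resultant n d R)"

definition resultant :: "nat \<Rightarrow> nat \<Rightarrow> (nat \<Rightarrow> (nat, complex) mpoly) \<Rightarrow> complex" where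
  "resultant n d F = mpoly_eval (coeffs_of F) (resultant_poly n d)"


section \<open>Tensors and the E-determinant\<close>

text \<open>Indices run over \<open>0, \<dots>, n - 1\<close>.\<close>

definition index_lists :: "nat \<Rightarrow> nat \<Rightarrow> nat list set" where
  "index_lists n m = {is. length is = m \<and> set is \<subseteq> {..<n}}"

type_synonym tensor = "nat list \<Rightarrow> complex"

definition tensors :: "nat \<Rightarrow> nat \<Rightarrow> tensor set" where
  "tensors n m = index_lists n m \<rightarrow>\<^sub>E UNIV"

text \<open>
  The \<open>i\<close>-th component of \<open>T x\<^sup>m\<^sup>-\<^sup>1\<close> as a polynomial in \<open>x\<close>: the index list \<open>js\<close> contributes its
  coefficient at the monomial \<open>\<Prod>j\<leftarrow>js. x\<^sub>j\<close>, which several index lists may share.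
  See \<open>mpoly_eval_tensor_form\<close> below for its values.
\<close>

definition tensor_form :: "nat \<Rightarrow> nat \<Rightarrow> tensor \<Rightarrow> nat \<Rightarrow> (nat, complex) mpoly" where
  "tensor_form n m T i =
     (\<Sum>js \<in> index_lists n (m - 1).
        Poly_Mapping.single (\<Sum>j\<leftarrow>js. Poly_Mapping.single j 1) (T (i # js)))"

definition Edet :: "nat \<Rightarrow> nat \<Rightarrow> tensor \<Rightarrow> complex" where
  "Edet n m T = resultant n (m - 1) (tensor_form n m T)"

definition tensor_comp :: "nat \<Rightarrow> nat \<Rightarrow> complex mat \<Rightarrow> tensor \<Rightarrow> tensor" where
  "tensor_comp n q G V =
     (\<lambda>is \<in> index_lists n q. \<Sum>l<n. G $$ (hd is, l) * V (l # tl is))"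


section \<open>Adequacy\<close>

lemma mpoly_eval_superset:
  assumes "finite A" "Poly_Mapping.keys p \<subseteq> A"
  shows "mpoly_eval x p = (\<Sum>\<alpha>\<in>A. Poly_Mapping.lookup p \<alpha> * mon_eval x \<alpha>)"
  unfolding mpoly_eval_def
  by (rule sum.mono_neutral_left) (use assms in \<open>auto simp: in_keys_iff\<close>)

lemma mon_eval_superset:
  assumes "finite A" "Poly_Mapping.keys \<alpha> \<subseteq> A"
  shows "mon_eval x \<alpha> = (\<Prod>v\<in>A. x v ^ Poly_Mapping.lookup \<alpha> v)"
  unfolding mon_eval_def
  by (rule prod.mono_neutral_left) (use assms in \<open>auto simp: in_keys_iff\<close>)

lemma mpoly_eval_add: "mpoly_eval x (p + q) = mpoly_eval x p + mpoly_eval x q"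
proof -
  let ?A = "Poly_Mapping.keys p \<union> Poly_Mapping.keys q"
  have "mpoly_eval x (p + q) =
      (\<Sum>\<alpha>\<in>?A. Poly_Mapping.lookup (p + q) \<alpha> * mon_eval x \<alpha>)"
    by (rule mpoly_eval_superset) (simp_all add: Poly_Mapping.keys_add)
  also have "\<dots> = (\<Sum>\<alpha>\<in>?A. Poly_Mapping.lookup p \<alpha> * mon_eval x \<alpha>) +
      (\<Sum>\<alpha>\<in>?A. Poly_Mapping.lookup q \<alpha> * mon_eval x \<alpha>)"
    by (simp add: Poly_Mapping.lookup_add distrib_right sum.distrib)
  also have "\<dots> = mpoly_eval x p + mpoly_eval x q"
    by (simp add: mpoly_eval_superset[of ?A])
  finally show ?thesis .
qed

lemma mpoly_eval_zero: "mpoly_eval x 0 = 0"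
  by (simp add: mpoly_eval_def)

lemma mpoly_eval_sum: "mpoly_eval x (\<Sum>i\<in>A. f i) = (\<Sum>i\<in>A. mpoly_eval x (f i))"
  by (induction A rule: infinite_finite_induct) (auto simp: mpoly_eval_zero mpoly_eval_add)

lemma mpoly_eval_single: "mpoly_eval x (Poly_Mapping.single \<alpha> c) = c * mon_eval x \<alpha>"
  by (cases "c = 0") (simp_all add: mpoly_eval_def)

lemma mon_eval_add: "mon_eval x (\<alpha> + \<beta>) = mon_eval x \<alpha> * mon_eval x \<beta>"
proof -
  let ?A = "Poly_Mapping.keys \<alpha> \<union> Poly_Mapping.keys \<beta>"
  have "mon_eval x (\<alpha> + \<beta>) = (\<Prod>v\<in>?A. x v ^ Poly_Mapping.lookup (\<alpha> + \<beta>) v)"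
    by (rule mon_eval_superset) (simp_all add: Poly_Mapping.keys_add)
  also have "\<dots> = (\<Prod>v\<in>?A. x v ^ Poly_Mapping.lookup \<alpha> v) *
      (\<Prod>v\<in>?A. x v ^ Poly_Mapping.lookup \<beta> v)"
    by (simp add: Poly_Mapping.lookup_add power_add prod.distrib)
  also have "\<dots> = mon_eval x \<alpha> * mon_eval x \<beta>"
    by (simp add: mon_eval_superset[of ?A])
  finally show ?thesis .
qed

lemma mon_eval_index_list:
  "mon_eval x (\<Sum>j\<leftarrow>js. Poly_Mapping.single j 1) = (\<Prod>j\<leftarrow>js. x j)"
  by (induction js) (simp_all add: mon_eval_add, simp_all add: mon_eval_def)

lemma mpoly_eval_tensor_form:
  "mpoly_eval x (tensor_form n m T i) =
     (\<Sum>js \<in> index_lists n (m - 1). T (i # js) * (\<Prod>j\<leftarrow>js. x j))"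
  by (simp add: tensor_form_def mpoly_eval_sum mpoly_eval_single mon_eval_index_list
      del: One_nat_def)

lemma mpoly_eval_tensor_comp:
  assumes "i < n" "q \<ge> 1"
  shows "mpoly_eval x (tensor_form n q (tensor_comp n q G V) i) =
    (\<Sum>l<n. G $$ (i, l) * mpoly_eval x (tensor_form n q V l))"
proof -
  have "i # js \<in> index_lists n q" if "js \<in> index_lists n (q - 1)" for js
    using that assms by (auto simp: index_lists_def)
  then have "mpoly_eval x (tensor_form n q (tensor_comp n q G V) i) =
      (\<Sum>js \<in> index_lists n (q - 1). \<Sum>l<n. G $$ (i, l) * (V (l # js) * (\<Prod>j\<leftarrow>js. x j)))"
    unfolding mpoly_eval_tensor_form
    by (intro sum.cong refl) (simp add: tensor_comp_def sum_distrib_right mult.assoc)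
  also have "\<dots> = (\<Sum>l<n. \<Sum>js \<in> index_lists n (q - 1). G $$ (i, l) * (V (l # js) * (\<Prod>j\<leftarrow>js. x j)))"
    by (rule sum.swap)
  finally show ?thesis
    by (simp add: mpoly_eval_tensor_form sum_distrib_left)
qed

lemma mon_degree_add: "mon_degree (\<alpha> + \<beta>) = mon_degree \<alpha> + mon_degree \<beta>"
proof -
  have superset: "mon_degree \<gamma> = (\<Sum>v\<in>A. Poly_Mapping.lookup \<gamma> v)"
    if "finite A" "Poly_Mapping.keys \<gamma> \<subseteq> A" for \<gamma> :: "'a \<Rightarrow>\<^sub>0 nat" and A
    unfolding mon_degree_def
    by (rule sum.mono_neutral_left) (use that in \<open>auto simp: in_keys_iff\<close>)
  let ?A = "Poly_Mapping.keys \<alpha> \<union> Poly_Mapping.keys \<beta>"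
  have "mon_degree (\<alpha> + \<beta>) = (\<Sum>v\<in>?A. Poly_Mapping.lookup (\<alpha> + \<beta>) v)"
    by (rule superset) (simp_all add: Poly_Mapping.keys_add)
  also have "\<dots> = mon_degree \<alpha> + mon_degree \<beta>"
    by (simp add: Poly_Mapping.lookup_add sum.distrib superset[of ?A])
  finally show ?thesis .
qed

lemma monomial_index_list:
  assumes "js \<in> index_lists n d"
  shows "(\<Sum>j\<leftarrow>js. Poly_Mapping.single j 1) \<in> monomials n d"
proof -
  have "Poly_Mapping.keys (\<Sum>j\<leftarrow>js. Poly_Mapping.single j (1::nat)) \<subseteq> set js"
  proof (induction js)
    case (Cons j js)
    have "Poly_Mapping.keys (\<Sum>j\<leftarrow>j # js. Poly_Mapping.single j (1::nat)) \<subseteq>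
        Poly_Mapping.keys (Poly_Mapping.single j (1::nat)) \<union>
        Poly_Mapping.keys (\<Sum>j\<leftarrow>js. Poly_Mapping.single j (1::nat))"
      by (simp add: Poly_Mapping.keys_add del: keys_single)
    then show ?case
      using Cons.IH by auto
  qed simp
  moreover have "mon_degree (\<Sum>j\<leftarrow>js. Poly_Mapping.single j 1) = length js"
    by (induction js) (simp_all add: mon_degree_add, simp_all add: mon_degree_def)
  ultimately show ?thesis
    using assms by (auto simp: monomials_def index_lists_def)
qed

lemma tensor_form_in_forms: "tensor_form n m T i \<in> forms n (m - 1)"
proof -
  have zero: "0 \<in> forms n d" for d
    by (simp add: forms_def)
  have add: "f + g \<in> forms n d" if "f \<in> forms n d" "g \<in> forms n d" for f g d
    using that Poly_Mapping.keys_add[of f g] by (auto simp: forms_def)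
  have sum: "(\<Sum>a\<in>A. f a) \<in> forms n d" if "\<And>a. a \<in> A \<Longrightarrow> f a \<in> forms n d"
    for A :: "nat list set" and f d
    using that by (induction A rule: infinite_finite_induct) (auto intro: zero add)
  show ?thesis
    unfolding tensor_form_def
  proof (rule sum)
    fix js assume "js \<in> index_lists n (m - 1)"
    from monomial_index_list[OF this]
    show "Poly_Mapping.single (\<Sum>j\<leftarrow>js. Poly_Mapping.single j 1) (T (i # js)) \<in> forms n (m - 1)"
      by (auto simp: forms_def)
  qed
qed

end

theory Submission
  imports
    Defs
    "HOL-Library.Product_Lexorder"
    "HOL-Computational_Algebra.Field_as_Ring"
    "Jordan_Normal_Form.Schur_Decomposition"
    "Subresultants.Subresultant_Gcd"
begin

text \<open>
  Since \<open>resultant_poly\<close> is a definite description, existence and uniqueness of the resultant have to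
  be proved.  This goes by induction on the number of variables.  Let \<open>I\<close> be the prime ideal of the
  polynomials in the coefficients of \<open>n + 1\<close> forms of degree \<open>d\<close> in \<open>n + 1\<close> variables which vanish
  whenever the forms have a common zero.

  Substituting \<open>x\<^sub>n\<^sub>-\<^sub>1 = \<sigma> y\<close>, \<open>x\<^sub>n = \<tau> y\<close> into \<open>n\<close> of the forms and taking the resultant in fewer variables
  gives a binary form in \<open>\<sigma>, \<tau>\<close> of degree \<open>d ^ n\<close>, so \<open>n\<close> generic forms have \<open>d ^ n\<close> common zeros.  Hence
  a nonzero element of \<open>I\<close> has degree at least \<open>d ^ n\<close> in the coefficient of \<open>x\<^sub>n\<^sup>d\<close> in the last form,
  whereas Macaulay's determinants lie in \<open>I\<close> and have degree at most \<open>d ^ n\<close> in a chosen form.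
  Pseudo-division and unique factorization show that an irreducible factor in \<open>I\<close> of such a determinant
  generates \<open>I\<close>; consequently this generator has degree at most \<open>d ^ n\<close> in each form.

  The generator vanishes only at systems with a common zero: if it vanished at another one, the degree
  bounds would allow the forms to be changed one after the other, so that it would vanish on an open
  set.  It is therefore the resultant.  For a matrix \<open>G\<close>, composing it with \<open>F \<mapsto> G F\<close> gives another element
  of \<open>I\<close> of no larger degree, so a multiple \<open>\<chi>(G)\<close> of it, where \<open>\<chi>\<close> is multiplicative and polynomial.
  Triangularizing \<open>G\<close> and using homogeneity of degree \<open>d ^ n\<close> in each form yields \<open>\<chi>(G) = det G ^ (d ^ n)\<close>.
\<close>

text \<open>The systems with a common zero form the image of a projection, so neither closedness nor
  codimension one is visible from the definition. Codimension one is replaced by a count of degrees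
  in the single coefficient of \<open>x_n^d\<close> in the last form: the lower bound for nonzero
  elements of the ideal meets the upper bound from a determinant, and therefore remainders of
  pseudo-division by the generator vanish. One determinant is small in one block only, since its
  rows are distributed unevenly among the forms; the bounds in the other blocks come from other
  determinants, all multiples of the same generator. Closedness comes from compactness over the
  complex numbers.

  The number of zeros is needed for generic forms only, so one explicit system with
  \<open>d ^ n\<close> zeros and a discriminant suffice. The induction also carries the scaling law
  \<open>R_scale\<close> for the last variable: it bounds the degree of the eliminant by
  \<open>d ^ n\<close>.\<close>

hide_const (open) Poly_Mapping.degree

section \<open>Substitution into multivariate polynomials\<close>

abbreviation mcoeff :: "('v, 'a::zero) mpoly \<Rightarrow> ('v \<Rightarrow>\<^sub>0 nat) \<Rightarrow> 'a" where
  "mcoeff \<equiv> Poly_Mapping.lookup"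

abbreviation expo :: "('v \<Rightarrow>\<^sub>0 nat) \<Rightarrow> 'v \<Rightarrow> nat" where
  "expo \<equiv> Poly_Mapping.lookup"

definition mconst :: "'a::zero \<Rightarrow> ('v, 'a) mpoly" where
  "mconst c = Poly_Mapping.single 0 c"

definition mvar :: "'v \<Rightarrow> ('v, 'a::zero_neq_one) mpoly" where
  "mvar v = Poly_Mapping.single (Poly_Mapping.single v 1) 1"

text \<open>With a coefficient map \<open>h\<close> into the target ring, evaluation, substitution
  of polynomials, \<open>grade\<close> and \<open>unipoly\<close> are all instances of one
  homomorphism.\<close>

definition msubst :: "('c::comm_ring_1 \<Rightarrow> 'b::comm_ring_1) \<Rightarrow> ('v \<Rightarrow> 'b) \<Rightarrow> ('v, 'c) mpoly \<Rightarrow> 'b" where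
  "msubst h x p = (\<Sum>\<alpha>\<in>Poly_Mapping.keys p. h (mcoeff p \<alpha>) * mon_eval x \<alpha>)"

lemma mpoly_eval_eq_msubst: "mpoly_eval x p = msubst (\<lambda>c. c) x p"
  by (simp add: mpoly_eval_def msubst_def)

lemma mpoly_decomp: "p = (\<Sum>\<alpha>\<in>Poly_Mapping.keys p. Poly_Mapping.single \<alpha> (mcoeff p \<alpha>))"
proof (rule poly_mapping_eqI)
  fix \<beta>
  have "mcoeff (\<Sum>\<alpha>\<in>Poly_Mapping.keys p. Poly_Mapping.single \<alpha> (mcoeff p \<alpha>)) \<beta> =
      (\<Sum>\<alpha>\<in>Poly_Mapping.keys p. if \<alpha> = \<beta> then mcoeff p \<alpha> else 0)"
    unfolding lookup_sum by (intro sum.cong refl) (simp add: lookup_single when_def)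
  then show "mcoeff p \<beta> = mcoeff (\<Sum>\<alpha>\<in>Poly_Mapping.keys p. Poly_Mapping.single \<alpha> (mcoeff p \<alpha>)) \<beta>"
    by (simp add: sum.delta in_keys_iff)
qed

lemma mon_eval_0 [simp]: "mon_eval x 0 = 1"
  by (simp add: mon_eval_def)

lemma mon_eval_single [simp]: "mon_eval x (Poly_Mapping.single v k) = x v ^ k"
  by (cases "k = 0") (simp_all add: mon_eval_def)

lemma mon_eval_cong: "(\<And>v. v \<in> Poly_Mapping.keys \<alpha> \<Longrightarrow> x v = y v) \<Longrightarrow> mon_eval x \<alpha> = mon_eval y \<alpha>"
  by (simp add: mon_eval_def)

lemma (in comm_ring_hom) hom_mon_eval: "hom (mon_eval x \<alpha>) = mon_eval (\<lambda>v. hom (x v)) \<alpha>"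
  by (simp add: mon_eval_def hom_prod hom_power)

lemma msubst_superset:
  assumes "h 0 = 0" "finite A" "Poly_Mapping.keys p \<subseteq> A"
  shows "msubst h x p = (\<Sum>\<alpha>\<in>A. h (mcoeff p \<alpha>) * mon_eval x \<alpha>)"
  unfolding msubst_def
  by (rule sum.mono_neutral_left) (use assms in \<open>auto simp: in_keys_iff\<close>)

lemma comm_ring_hom_msubst:
  fixes h :: "'c::comm_ring_1 \<Rightarrow> 'b::comm_ring_1" and x :: "'v \<Rightarrow> 'b"
  assumes "comm_ring_hom h"
  shows "comm_ring_hom (msubst h x)"
proof -
  interpret h: comm_ring_hom h by fact
  have add: "msubst h x (p + q) = msubst h x p + msubst h x q" for p q
  proof -
    let ?A = "Poly_Mapping.keys p \<union> Poly_Mapping.keys q"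
    have "msubst h x (p + q) = (\<Sum>\<alpha>\<in>?A. h (mcoeff (p + q) \<alpha>) * mon_eval x \<alpha>)"
      by (rule msubst_superset) (simp_all add: Poly_Mapping.keys_add)
    also have "\<dots> = (\<Sum>\<alpha>\<in>?A. h (mcoeff p \<alpha>) * mon_eval x \<alpha>) + (\<Sum>\<alpha>\<in>?A. h (mcoeff q \<alpha>) * mon_eval x \<alpha>)"
      by (simp add: Poly_Mapping.lookup_add distrib_right sum.distrib h.hom_add)
    also have "\<dots> = msubst h x p + msubst h x q"
      by (simp add: msubst_superset[of h ?A])
    finally show ?thesis .
  qed
  have zero: "msubst h x 0 = 0"
    by (simp add: msubst_def)
  have sum: "msubst h x (\<Sum>i\<in>A. f i) = (\<Sum>i\<in>A. msubst h x (f i))" for A :: "('v \<Rightarrow>\<^sub>0 nat) set" and f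
    by (induction A rule: infinite_finite_induct) (auto simp: zero add)
  have single: "msubst h x (Poly_Mapping.single \<alpha> c) = h c * mon_eval x \<alpha>" for \<alpha> c
    by (cases "c = 0") (simp_all add: msubst_def)
  have mult: "msubst h x (p * q) = msubst h x p * msubst h x q" for p q
  proof -
    have "p * q = (\<Sum>\<alpha>\<in>Poly_Mapping.keys p. \<Sum>\<beta>\<in>Poly_Mapping.keys q.
        Poly_Mapping.single (\<alpha> + \<beta>) (mcoeff p \<alpha> * mcoeff q \<beta>))"
      by (subst mpoly_decomp[of p], subst mpoly_decomp[of q])
        (simp add: sum_product mult_single)
    then have "msubst h x (p * q) = (\<Sum>\<alpha>\<in>Poly_Mapping.keys p. \<Sum>\<beta>\<in>Poly_Mapping.keys q.
        (h (mcoeff p \<alpha>) * mon_eval x \<alpha>) * (h (mcoeff q \<beta>) * mon_eval x \<beta>))"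
      by (simp add: sum single mon_eval_add h.hom_mult mult_ac)
    then show ?thesis
      by (simp add: msubst_def sum_product)
  qed
  have one: "msubst h x 1 = 1"
    using single[of 0 1] by simp
  show ?thesis
    by unfold_locales (simp_all add: add zero mult one)
qed

lemma msubst_single:
  "comm_ring_hom h \<Longrightarrow> msubst h x (Poly_Mapping.single \<alpha> c) = h c * mon_eval x \<alpha>"
proof -
  assume "comm_ring_hom h"
  then interpret comm_ring_hom h .
  show ?thesis by (cases "c = 0") (simp_all add: msubst_def)
qed

lemma msubst_mconst: "comm_ring_hom h \<Longrightarrow> msubst h x (mconst c) = h c"
  by (simp add: mconst_def msubst_single)

lemma msubst_mvar: "comm_ring_hom h \<Longrightarrow> msubst h x (mvar v) = x v"
proof -
  assume h: "comm_ring_hom h"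
  then interpret comm_ring_hom h .
  show ?thesis by (simp add: mvar_def msubst_single[OF h])
qed

lemma msubst_cong:
  assumes "\<And>\<alpha> v. \<alpha> \<in> Poly_Mapping.keys p \<Longrightarrow> v \<in> Poly_Mapping.keys \<alpha> \<Longrightarrow> x v = y v"
  shows "msubst h x p = msubst h y p"
  unfolding msubst_def by (intro sum.cong refl arg_cong2[of _ _ _ _ "(*)"] mon_eval_cong) (use assms in auto)

lemma (in comm_ring_hom) hom_msubst: "hom (msubst h x p) = msubst (\<lambda>c. hom (h c)) (\<lambda>v. hom (x v)) p"
  by (simp add: msubst_def hom_sum hom_mult hom_mon_eval)

lemma comm_ring_hom_id: "comm_ring_hom (\<lambda>c. c)"
  by unfold_locales auto

lemma comm_ring_hom_mconst: "comm_ring_hom (mconst :: 'a::comm_ring_1 \<Rightarrow> ('v, 'a) mpoly)"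
  by unfold_locales (simp_all add: mconst_def single_add mult_single)

lemma comm_ring_hom_pconst: "comm_ring_hom (\<lambda>c. [:c:])"
  by unfold_locales (simp_all add: one_pCons)

lemma comm_ring_hom_comp: "comm_ring_hom f \<Longrightarrow> comm_ring_hom g \<Longrightarrow> comm_ring_hom (\<lambda>c. f (g c))"
proof -
  assume "comm_ring_hom f" "comm_ring_hom g"
  then interpret f: comm_ring_hom f + g: comm_ring_hom g .
  show ?thesis by unfold_locales (simp_all add: hom_distribs)
qed

lemma comm_ring_hom_poly: "comm_ring_hom (\<lambda>p. poly p (a::'a::comm_ring_1))"
  by unfold_locales simp_all

lemmas comm_ring_homs = comm_ring_hom_id comm_ring_hom_mconst comm_ring_hom_pconst
  comm_ring_hom_comp comm_ring_hom_comp[OF comm_ring_hom_pconst comm_ring_hom_mconst]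
  comm_ring_hom_comp[OF comm_ring_hom_pconst comm_ring_hom_pconst]

lemma comm_ring_hom_eval: "comm_ring_hom (mpoly_eval (x :: 'v \<Rightarrow> 'a::comm_ring_1))"
  unfolding mpoly_eval_eq_msubst[abs_def] by (rule comm_ring_hom_msubst[OF comm_ring_hom_id])

interpretation ev: comm_ring_hom "mpoly_eval (x :: 'v \<Rightarrow> 'a::comm_ring_1)" for x
  by (rule comm_ring_hom_eval)

lemma mpoly_eval_mconst [simp]: "mpoly_eval (x :: 'v \<Rightarrow> 'a::comm_ring_1) (mconst c) = c"
  by (simp add: mpoly_eval_eq_msubst msubst_mconst[OF comm_ring_hom_id])

lemma mpoly_eval_mvar [simp]: "mpoly_eval (x :: 'v \<Rightarrow> 'a::comm_ring_1) (mvar v) = x v"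
  by (simp add: mpoly_eval_eq_msubst msubst_mvar[OF comm_ring_hom_id])

lemma single_eq_mon_eval:
  fixes \<alpha> :: "'v \<Rightarrow>\<^sub>0 nat"
  shows "Poly_Mapping.single \<alpha> (c::'a::comm_ring_1) = mconst c * mon_eval mvar \<alpha>"
proof -
  have pow: "mvar v ^ k = (Poly_Mapping.single (Poly_Mapping.single v k) 1 :: ('v,'a) mpoly)" for v :: 'v and k
    by (induction k) (simp_all add: mvar_def mult_single single_add[symmetric])
  have prod: "(\<Prod>v\<in>A. mvar v ^ f v) = (Poly_Mapping.single (\<Sum>v\<in>A. Poly_Mapping.single v (f v)) 1 :: ('v,'a) mpoly)"
    for A :: "'v set" and f
    by (induction A rule: infinite_finite_induct) (simp_all add: pow mult_single)
  have "(\<Sum>v\<in>Poly_Mapping.keys \<alpha>. Poly_Mapping.single v (expo \<alpha> v)) = \<alpha>"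
    by (rule poly_mapping_eqI) (auto simp: lookup_sum lookup_single when_def in_keys_iff sum.delta)
  then show ?thesis
    by (simp add: mon_eval_def prod mconst_def mult_single)
qed

lemma msubst_mvar_id: "msubst mconst mvar p = (p :: ('v, 'a::comm_ring_1) mpoly)"
  by (subst (2) mpoly_decomp) (simp add: msubst_def single_eq_mon_eval)

lemma poly_msubst:
  "poly (msubst (\<lambda>c. [:c:]) x p) t = mpoly_eval (\<lambda>v. poly (x v) t) (p :: ('v, 'a::comm_ring_1) mpoly)"
  by (simp add: comm_ring_hom.hom_msubst[OF comm_ring_hom_poly] mpoly_eval_eq_msubst)

lemma mpoly_eval_msubst:
  "mpoly_eval a (msubst mconst y p) = mpoly_eval (\<lambda>v. mpoly_eval a (y v)) (p :: ('v, 'a::comm_ring_1) mpoly)"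
  by (simp add: comm_ring_hom.hom_msubst[OF comm_ring_hom_eval] mpoly_eval_eq_msubst[of _ p])

lemma mpoly_eval_cong:
  fixes x y :: "'v \<Rightarrow> 'a::comm_ring_1"
  assumes "\<And>\<alpha> v. \<alpha> \<in> Poly_Mapping.keys p \<Longrightarrow> v \<in> Poly_Mapping.keys \<alpha> \<Longrightarrow> x v = y v"
  shows "mpoly_eval x p = mpoly_eval y p"
  unfolding mpoly_eval_eq_msubst by (rule msubst_cong) (use assms in auto)


section \<open>Weighted degrees\<close>

definition wt :: "('v \<Rightarrow> nat) \<Rightarrow> ('v \<Rightarrow>\<^sub>0 nat) \<Rightarrow> nat" where
  "wt w \<alpha> = (\<Sum>v\<in>Poly_Mapping.keys \<alpha>. w v * expo \<alpha> v)"

text \<open>Each variable \<open>v\<close> becomes \<open>v T^(w v)\<close>, so the coefficient of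
  \<open>T^k\<close> is the part of weight \<open>k\<close>. Weighted degrees are thereby degrees of
  univariate polynomials over a domain, which makes them additive in
  \<open>wdeg_mult\<close>.\<close>

definition grade :: "('v \<Rightarrow> nat) \<Rightarrow> ('v, 'a::comm_ring_1) mpoly \<Rightarrow> ('v, 'a) mpoly poly" where
  "grade w = msubst (\<lambda>c. [:mconst c:]) (\<lambda>v. monom (mvar v) (w v))"

definition wdeg :: "('v \<Rightarrow> nat) \<Rightarrow> ('v, 'a::comm_ring_1) mpoly \<Rightarrow> nat" where
  "wdeg w p = degree (grade w p)"

lemma mon_eval_grade:
  "mon_eval (\<lambda>v. monom (mvar v :: ('v,'a::comm_ring_1) mpoly) (w v)) \<alpha> = monom (mon_eval mvar \<alpha>) (wt w \<alpha>)"
proof -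
  have "(\<Prod>v\<in>A. monom (mvar v) (w v) ^ f v) = monom (\<Prod>v\<in>A. mvar v ^ f v :: ('v,'a) mpoly) (\<Sum>v\<in>A. w v * f v)" for A f
    by (induction A rule: infinite_finite_induct) (simp_all add: monom_power mult_monom)
  then show ?thesis by (simp add: mon_eval_def wt_def)
qed

lemma mcoeff_grade: "mcoeff (coeff (grade w p) k) \<alpha> = (if wt w \<alpha> = k then mcoeff p \<alpha> else 0)"
proof -
  have "coeff (grade w p) k = (\<Sum>\<alpha>\<in>Poly_Mapping.keys p. if wt w \<alpha> = k then Poly_Mapping.single \<alpha> (mcoeff p \<alpha>) else 0)"
    unfolding grade_def msubst_def mon_eval_grade coeff_sum
    by (intro sum.cong refl) (simp add: single_eq_mon_eval)
  then have "mcoeff (coeff (grade w p) k) \<alpha> =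
     (\<Sum>\<beta>\<in>Poly_Mapping.keys p. mcoeff (if wt w \<beta> = k then Poly_Mapping.single \<beta> (mcoeff p \<beta>) else 0) \<alpha>)"
    by (simp only: lookup_sum)
  also have "\<dots> = (\<Sum>\<beta>\<in>Poly_Mapping.keys p. if \<beta> = \<alpha> then (if wt w \<alpha> = k then mcoeff p \<alpha> else 0) else 0)"
    by (intro sum.cong refl) (simp add: lookup_single when_def)
  finally have "mcoeff (coeff (grade w p) k) \<alpha> =
     (\<Sum>\<beta>\<in>Poly_Mapping.keys p. if \<beta> = \<alpha> then (if wt w \<alpha> = k then mcoeff p \<alpha> else 0) else 0)" .
  then show ?thesis by (auto simp: in_keys_iff)
qed

lemma comm_ring_hom_grade: "comm_ring_hom (grade w)"
  unfolding grade_def by (rule comm_ring_hom_msubst) (rule comm_ring_homs)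

interpretation grade: comm_ring_hom "grade w" for w
  by (rule comm_ring_hom_grade)

lemma poly_grade_1: "poly (grade w p) 1 = p"
  unfolding grade_def comm_ring_hom.hom_msubst[OF comm_ring_hom_poly]
  by (simp add: poly_monom msubst_mvar_id)

lemma grade_eq_0_iff [simp]: "grade w p = 0 \<longleftrightarrow> p = 0"
  by (metis grade.hom_zero poly_0 poly_grade_1)

lemma wdeg_le_iff: "wdeg w p \<le> m \<longleftrightarrow> (\<forall>\<alpha>\<in>Poly_Mapping.keys p. wt w \<alpha> \<le> m)"
proof
  assume *: "wdeg w p \<le> m"
  show "\<forall>\<alpha>\<in>Poly_Mapping.keys p. wt w \<alpha> \<le> m"
  proof
    fix \<alpha> assume "\<alpha> \<in> Poly_Mapping.keys p"
    then have "mcoeff (coeff (grade w p) (wt w \<alpha>)) \<alpha> \<noteq> 0"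
      by (simp add: mcoeff_grade in_keys_iff)
    then have "coeff (grade w p) (wt w \<alpha>) \<noteq> 0" by auto
    then show "wt w \<alpha> \<le> m" using * le_degree unfolding wdeg_def by (metis le_trans)
  qed
next
  assume *: "\<forall>\<alpha>\<in>Poly_Mapping.keys p. wt w \<alpha> \<le> m"
  have "coeff (grade w p) k = 0" if "k > m" for k
    by (rule poly_mapping_eqI) (use * that in \<open>force simp: mcoeff_grade in_keys_iff\<close>)
  then show "wdeg w p \<le> m" unfolding wdeg_def by (intro degree_le) auto
qed

lemma wdeg_mult:
  fixes p q :: "('v::linorder, 'a::idom) mpoly"
  shows "p \<noteq> 0 \<Longrightarrow> q \<noteq> 0 \<Longrightarrow> wdeg w (p * q) = wdeg w p + wdeg w q"
  by (simp add: wdeg_def grade.hom_mult degree_mult_eq)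

lemma mpoly_eval_grade:
  fixes a :: "'v \<Rightarrow> 'a::comm_ring_1"
  shows "mpoly_eval (\<lambda>v. t ^ w v * a v) p = (\<Sum>k\<le>wdeg w p. t ^ k * mpoly_eval a (coeff (grade w p) k))"
proof -
  have "mpoly_eval a (poly (grade w p) (mconst t)) = mpoly_eval (\<lambda>v. t ^ w v * a v) p"
    unfolding grade_def comm_ring_hom.hom_msubst[OF comm_ring_hom_poly]
    by (simp add: poly_monom mpoly_eval_msubst ev.hom_mult ev.hom_power mult.commute)
  also have "poly (grade w p) (mconst t) = (\<Sum>k\<le>wdeg w p. coeff (grade w p) k * mconst t ^ k)"
    unfolding wdeg_def by (rule poly_altdef)
  finally show ?thesis
    by (simp add: ev.hom_sum ev.hom_mult ev.hom_power mult.commute)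
qed

lemma wt_1_eq_0_iff: "wt (\<lambda>_. 1) \<alpha> = 0 \<longleftrightarrow> \<alpha> = 0"
  by (auto simp: wt_def in_keys_iff intro!: poly_mapping_eqI)

lemma wdeg_1_eq_0: "wdeg (\<lambda>_. 1) p = 0 \<Longrightarrow> p = mconst (mcoeff p 0)"
proof -
  assume "wdeg (\<lambda>_. 1) p = 0"
  then have "\<forall>\<alpha>\<in>Poly_Mapping.keys p. \<alpha> = 0"
    using wdeg_le_iff[of "\<lambda>_. 1" p 0] wt_1_eq_0_iff by auto
  then show ?thesis
    by (intro poly_mapping_eqI) (auto simp: mconst_def lookup_single when_def in_keys_iff)
qed

lemma is_unit_mconst: "c \<noteq> 0 \<Longrightarrow> mconst (c::'a::field) dvd (1 :: ('b, 'a) mpoly)"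
proof -
  interpret comm_ring_hom "mconst :: 'a \<Rightarrow> ('b,'a) mpoly" by (rule comm_ring_hom_mconst)
  assume "c \<noteq> 0"
  then have "mconst c * mconst (inverse c) = (1 :: ('b,'a) mpoly)" by (metis hom_mult hom_one right_inverse)
  then show ?thesis by (metis dvd_triv_left)
qed

lemma is_unit_iff_wdeg_1:
  fixes p :: "('v::linorder, 'a::field) mpoly"
  shows "p dvd 1 \<longleftrightarrow> p \<noteq> 0 \<and> wdeg (\<lambda>_. 1) p = 0"
proof
  assume "p dvd 1"
  then obtain q where q: "p * q = 1" by (metis dvd_def)
  then have "p \<noteq> 0" "q \<noteq> 0" by fastforce+
  then have "wdeg (\<lambda>_. 1) p + wdeg (\<lambda>_. 1) q = wdeg (\<lambda>_. 1) (1 :: ('v,'a) mpoly)"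
    using wdeg_mult[of p q "\<lambda>_. 1"] q by simp
  then show "p \<noteq> 0 \<and> wdeg (\<lambda>_. 1) p = 0" using \<open>p \<noteq> 0\<close> by (simp add: wdeg_def)
next
  assume *: "p \<noteq> 0 \<and> wdeg (\<lambda>_. 1) p = 0"
  then have p: "p = mconst (mcoeff p 0)" using wdeg_1_eq_0 by blast
  have "mcoeff p 0 \<noteq> 0"
  proof
    assume "mcoeff p 0 = 0"
    then have "mconst (mcoeff p 0) = (0 :: ('v, 'a) mpoly)" by (simp add: mconst_def)
    with p have "p = 0" by (rule trans)
    with * show False by simp
  qed
  then have "mconst (mcoeff p 0) dvd (1 :: ('v, 'a) mpoly)" by (rule is_unit_mconst)
  then show "p dvd 1" by (subst p)
qed

text \<open>Total degree is additive, and positive on nonzero nonunits. The cofactor of smaller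
  degree is part of the claim because later inductions split off one irreducible factor at a
  time.\<close>

lemma irreducible_factor_exists:
  fixes p :: "('v::linorder, 'a::field) mpoly"
  assumes "p \<noteq> 0" "\<not> p dvd 1"
  shows "\<exists>f g. irreducible f \<and> p = f * g \<and> g \<noteq> 0 \<and> wdeg (\<lambda>_. 1) g < wdeg (\<lambda>_. 1) p"
  using assms
proof (induction "wdeg (\<lambda>_. 1) p" arbitrary: p rule: less_induct)
  case less
  show ?case
  proof (cases "irreducible p")
    case True
    have "wdeg (\<lambda>_. 1) p > 0" using less.prems is_unit_iff_wdeg_1[of p] by linarith
    then show ?thesis by (intro exI[of _ p] exI[of _ 1]) (use True less.prems in \<open>auto simp: wdeg_def\<close>)
  next
    case False
    then obtain a b where ab: "p = a * b" "\<not> a dvd 1" "\<not> b dvd 1"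
      using less.prems unfolding irreducible_def by auto
    then have nz: "a \<noteq> 0" "b \<noteq> 0" using less.prems by auto
    then have pos: "wdeg (\<lambda>_. 1) a > 0" "wdeg (\<lambda>_. 1) b > 0" using ab nz is_unit_iff_wdeg_1[of a] is_unit_iff_wdeg_1[of b] by linarith+
    have sum: "wdeg (\<lambda>_. 1) p = wdeg (\<lambda>_. 1) a + wdeg (\<lambda>_. 1) b" unfolding ab(1) by (rule wdeg_mult[OF nz])
    then obtain f g where fg: "irreducible f" "a = f * g" "g \<noteq> 0" "wdeg (\<lambda>_. 1) g < wdeg (\<lambda>_. 1) a"
      using less.hyps[OF _ nz(1) ab(2)] pos(2) sum by auto
    have "wdeg (\<lambda>_. 1) (g * b) = wdeg (\<lambda>_. 1) g + wdeg (\<lambda>_. 1) b"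
      by (rule wdeg_mult[OF fg(3) nz(2)])
    then have "wdeg (\<lambda>_. 1) (g * b) < wdeg (\<lambda>_. 1) p" using fg(4) sum by linarith
    moreover have "p = f * (g * b)" unfolding ab(1) fg(2) by (rule mult.assoc)
    moreover have "g * b \<noteq> 0" using fg(3) nz(2) by simp
    ultimately show ?thesis using fg(1) by blast
  qed
qed


section \<open>Unique factorization\<close>

definition invars :: "'v set \<Rightarrow> ('v, 'a::zero) mpoly \<Rightarrow> bool" where
  "invars W p \<longleftrightarrow> (\<forall>\<alpha>\<in>Poly_Mapping.keys p. Poly_Mapping.keys \<alpha> \<subseteq> W)"

lemma invars_add: "invars W p \<Longrightarrow> invars W q \<Longrightarrow> invars W (p + q)"
  using Poly_Mapping.keys_add[of p q] unfolding invars_def by blast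

lemma keys_add_nat: "Poly_Mapping.keys (\<alpha> + \<beta> :: 'v \<Rightarrow>\<^sub>0 nat) = Poly_Mapping.keys \<alpha> \<union> Poly_Mapping.keys \<beta>"
  by (auto simp: in_keys_iff lookup_add)

lemma invars_mult:
  fixes p q :: "('v, 'a::comm_ring_1) mpoly"
  shows "invars W p \<Longrightarrow> invars W q \<Longrightarrow> invars W (p * q)"
  using Poly_Mapping.keys_mult[of p q] unfolding invars_def by (force simp: keys_add_nat)

lemma invars_mconst [simp]: "invars W (mconst c)"
  by (simp add: invars_def mconst_def)

lemma invars_0 [simp]: "invars W 0"
  by (simp add: invars_def)

lemma invars_1 [simp]: "invars W (1 :: ('v, 'a::zero_neq_one) mpoly)"
  by (simp add: invars_def)

lemma invars_uminus [simp]: "invars W (- p :: ('v, 'a::ab_group_add) mpoly) \<longleftrightarrow> invars W p"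
  by (simp add: invars_def in_keys_iff)

lemma invars_diff:
  fixes p q :: "('v, 'a::ab_group_add) mpoly"
  shows "invars W p \<Longrightarrow> invars W q \<Longrightarrow> invars W (p - q)"
  using invars_add[of W p "- q"] by simp

lemma invars_mvar: "v \<in> W \<Longrightarrow> invars W (mvar v :: ('v, 'a::zero_neq_one) mpoly)"
  by (simp add: invars_def mvar_def)

lemma invars_power: "invars W p \<Longrightarrow> invars W (p ^ k :: ('v, 'a::comm_ring_1) mpoly)"
  by (induction k) (auto intro: invars_mult)

lemma invars_sum: "(\<And>i. i \<in> A \<Longrightarrow> invars W (f i)) \<Longrightarrow> invars W (\<Sum>i\<in>A. f i)"
  by (induction A rule: infinite_finite_induct) (auto intro: invars_add)

lemma invars_prod: "(\<And>i. i \<in> A \<Longrightarrow> invars W (f i)) \<Longrightarrow> invars W (\<Prod>i\<in>A. f i :: ('v, 'a::comm_ring_1) mpoly)"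
  by (induction A rule: infinite_finite_induct) (auto intro: invars_mult)

lemma invars_mono: "invars W p \<Longrightarrow> W \<subseteq> W' \<Longrightarrow> invars W' p"
  unfolding invars_def by blast

lemma invars_finite: "\<exists>W. finite W \<and> invars W p"
  by (rule exI[of _ "\<Union>\<alpha>\<in>Poly_Mapping.keys p. Poly_Mapping.keys \<alpha>"]) (auto simp: invars_def)

text \<open>Since degrees add up, this form of the condition shows that factors of a nonzero
  polynomial involve no new variables (\<open>invars_multD\<close>).\<close>

lemma invars_iff_wdeg:
  fixes p :: "('v, 'a::comm_ring_1) mpoly"
  shows "invars W p \<longleftrightarrow> (\<forall>v. v \<notin> W \<longrightarrow> wdeg (\<lambda>u. if u = v then 1 else 0) p = 0)"
proof -
  have wt: "wt (\<lambda>u. if u = v then 1 else 0) \<alpha> = expo \<alpha> v" for v :: 'v and \<alpha>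
  proof -
    have "wt (\<lambda>u. if u = v then 1 else 0) \<alpha> =
        (\<Sum>u\<in>Poly_Mapping.keys \<alpha>. if u = v then expo \<alpha> v else 0)"
      unfolding wt_def by (intro sum.cong) auto
    then show ?thesis by (auto simp: in_keys_iff)
  qed
  have "wdeg (\<lambda>u. if u = v then 1 else 0) p = 0 \<longleftrightarrow> (\<forall>\<alpha>\<in>Poly_Mapping.keys p. v \<notin> Poly_Mapping.keys \<alpha>)" for v
    using wdeg_le_iff[of "\<lambda>u. if u = v then 1 else 0" p 0] by (simp add: wt in_keys_iff[of v])
  then show ?thesis unfolding invars_def by blast
qed

lemma invars_multD:
  fixes p q :: "('v::linorder, 'a::idom) mpoly"
  assumes "invars W (p * q)" "p \<noteq> 0" "q \<noteq> 0"
  shows "invars W p" "invars W q"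
  using assms by (auto simp: invars_iff_wdeg wdeg_mult)

text \<open>The coefficients remain in the full ring, so that no smaller polynomial ring has to be
  formed; \<open>invars_coeff_unipoly\<close> shows that they are free of \<open>y\<close>.\<close>

definition unipoly :: "'v \<Rightarrow> ('v, 'a::comm_ring_1) mpoly \<Rightarrow> ('v, 'a) mpoly poly" where
  "unipoly y = msubst (\<lambda>c. [:mconst c:]) (\<lambda>v. if v = y then [:0, 1:] else [:mvar v:])"

abbreviation vdeg :: "'v \<Rightarrow> ('v, 'a::comm_ring_1) mpoly \<Rightarrow> nat" where
  "vdeg y p \<equiv> degree (unipoly y p)"

lemma comm_ring_hom_unipoly: "comm_ring_hom (unipoly y)"
  unfolding unipoly_def by (rule comm_ring_hom_msubst) (rule comm_ring_homs)

interpretation unipoly: comm_ring_hom "unipoly y" for y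
  by (rule comm_ring_hom_unipoly)

lemma poly_unipoly: "poly (unipoly y p) (mvar y) = p"
proof -
  have "poly (unipoly y p) (mvar y) = msubst mconst mvar p"
    unfolding unipoly_def comm_ring_hom.hom_msubst[OF comm_ring_hom_poly]
    by (intro arg_cong2[of _ _ _ _ "\<lambda>h x. msubst h x p"] ext) auto
  then show ?thesis by (simp add: msubst_mvar_id)
qed

lemma unipoly_eq_0_iff [simp]: "unipoly y p = 0 \<longleftrightarrow> p = 0"
  by (metis unipoly.hom_zero poly_0 poly_unipoly)

lemma unipoly_free:
  assumes "invars (- {y}) p"
  shows "unipoly y p = [:p:]"
proof -
  have "unipoly y p = msubst (\<lambda>c. [:mconst c:]) (\<lambda>v. [:mvar v:]) p"
    unfolding unipoly_def by (rule msubst_cong) (use assms in \<open>auto simp: invars_def\<close>)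
  also have "\<dots> = [:msubst mconst mvar p:]"
    by (simp add: comm_ring_hom.hom_msubst[OF comm_ring_hom_pconst])
  finally show ?thesis by (simp add: msubst_mvar_id)
qed

lemma unipoly_mvar: "unipoly y (mvar y) = monom 1 1"
  unfolding unipoly_def by (simp add: monom_altdef msubst_mvar[OF comm_ring_hom_comp[OF comm_ring_hom_pconst comm_ring_hom_mconst]])

lemma invars_coeff_unipoly:
  fixes p :: "('v, 'a::comm_ring_1) mpoly"
  assumes "invars (insert y W) p"
  shows "invars (W - {y}) (coeff (unipoly y p) k)"
proof -
  define S where "S = {q :: ('v, 'a) mpoly poly. \<forall>k. invars (W - {y}) (coeff q k)}"
  have mult: "q * r \<in> S" if "q \<in> S" "r \<in> S" for q r
    using that by (auto simp: S_def coeff_mult intro!: invars_sum invars_mult)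
  have one: "1 \<in> S" by (auto simp: S_def coeff_1)
  have power: "q ^ k \<in> S" if "q \<in> S" for q k
    by (induction k) (use that in \<open>auto intro: mult one\<close>)
  have const: "[:q:] \<in> S" if "invars (W - {y}) q" for q
    using that by (auto simp: S_def coeff_pCons split: nat.splits)
  have X: "[:0, 1:] \<in> S"
    by (auto simp: S_def coeff_pCons split: nat.splits)
  have prod: "(\<Prod>i\<in>A. f i) \<in> S" if "\<And>i. i \<in> A \<Longrightarrow> f i \<in> S" for A :: "'v set" and f
    using that by (induction A rule: infinite_finite_induct) (auto intro: mult one)
  have sum: "(\<Sum>i\<in>A. f i) \<in> S" if "\<And>i. i \<in> A \<Longrightarrow> f i \<in> S" for A :: "('v \<Rightarrow>\<^sub>0 nat) set" and f
    using that by (auto simp: S_def coeff_sum intro!: invars_sum)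
  have "unipoly y p \<in> S"
    unfolding unipoly_def msubst_def mon_eval_def
  proof (intro sum mult prod power const)
    fix \<alpha> v assume "\<alpha> \<in> Poly_Mapping.keys p" "v \<in> Poly_Mapping.keys \<alpha>"
    then have "v \<in> insert y W" using assms by (auto simp: invars_def)
    then have "v \<noteq> y \<Longrightarrow> [:mvar v:] \<in> S" by (intro const invars_mvar) auto
    then show "(if v = y then [:0, 1:] else [:mvar v:]) \<in> S"
      using X by presburger
  qed auto
  then show ?thesis by (simp add: S_def)
qed

lemma vdeg_0_iff: "vdeg y p = 0 \<longleftrightarrow> invars (- {y}) p"
proof
  assume "vdeg y p = 0"
  then obtain a where a: "unipoly y p = [:a:]" by (rule degree_eq_zeroE)
  have "invars (- {y}) (coeff (unipoly y p) 0)"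
    using invars_coeff_unipoly[of y UNIV p 0] by (simp add: Compl_eq_Diff_UNIV invars_def)
  moreover have "p = a" using poly_unipoly[of y p] a by simp
  ultimately show "invars (- {y}) p" using a by simp
next
  assume "invars (- {y}) p"
  then show "vdeg y p = 0" by (simp add: unipoly_free)
qed

lemma vdeg_mult:
  fixes p q :: "('v::linorder, 'a::idom) mpoly"
  shows "p \<noteq> 0 \<Longrightarrow> q \<noteq> 0 \<Longrightarrow> vdeg y (p * q) = vdeg y p + vdeg y q"
  by (simp add: unipoly.hom_mult degree_mult_eq)

definition vlead :: "'v \<Rightarrow> ('v, 'a::comm_ring_1) mpoly \<Rightarrow> ('v, 'a) mpoly" where
  "vlead y p = lead_coeff (unipoly y p)"

lemma invars_vlead: "invars (insert y W) p \<Longrightarrow> invars (W - {y}) (vlead y p)"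
  unfolding vlead_def by (rule invars_coeff_unipoly)

lemma vlead_nonzero: "p \<noteq> 0 \<Longrightarrow> vlead y p \<noteq> 0"
  by (simp add: vlead_def)

text \<open>Each step multiplies by the leading coefficient of \<open>m\<close> and cancels the top
  power of \<open>y\<close>; \<open>e\<close> counts the steps. The case \<open>r = 0\<close> is
  separate because the zero polynomial has degree 0, like the constants.\<close>

lemma pseudo_division:
  fixes f m :: "('v::linorder, 'a::idom) mpoly"
  assumes "m \<noteq> 0" "invars (insert y W) m" "invars (insert y W) f"
  shows "\<exists>e q r. vlead y m ^ e * f = q * m + r \<and> (r = 0 \<or> vdeg y r < vdeg y m)
     \<and> invars (insert y W) q \<and> invars (insert y W) r"
  using assms(3)
proof (induction "vdeg y f" arbitrary: f rule: less_induct)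
  case less
  consider "f = 0 \<or> vdeg y f < vdeg y m" | "f \<noteq> 0" "vdeg y m \<le> vdeg y f" by linarith
  then show ?case
  proof cases
    case 1
    then show ?thesis
      by (intro exI[of _ 0] exI[of _ 0] exI[of _ f]) (use less.prems in auto)
  next
    case 2
    define k where "k = vdeg y f - vdeg y m"
    define t where "t = vlead y f * mvar y ^ k"
    define g where "g = vlead y m * f - t * m"
    have free: "unipoly y (vlead y p) = [:vlead y p:]" for p :: "('v, 'a) mpoly"
      by (rule unipoly_free) (use invars_vlead[of y UNIV p] in \<open>simp add: Compl_eq_Diff_UNIV invars_def\<close>)
    have inv_lead: "invars (insert y W) (vlead y p)" if "invars (insert y W) p" for p :: "('v, 'a) mpoly"
      by (rule invars_mono[OF invars_vlead[OF that]]) auto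
    have inv_t: "invars (insert y W) t"
      unfolding t_def by (intro invars_mult invars_power invars_mvar inv_lead less.prems) auto
    have inv_g: "invars (insert y W) g"
      unfolding g_def by (intro invars_diff invars_mult inv_lead less.prems assms inv_t)
    have X: "monom 1 1 ^ k = (monom 1 k :: ('v,'a) mpoly poly)" by (simp add: monom_power)
    have g_eq: "unipoly y g = smult (vlead y m) (unipoly y f) - smult (vlead y f) (monom 1 k * unipoly y m)"
      by (simp add: g_def t_def unipoly.hom_minus unipoly.hom_mult unipoly.hom_power free unipoly_mvar X del: One_nat_def)
    have deg_k: "degree (monom 1 k * unipoly y m) = vdeg y f"
      using assms(1) 2 by (subst degree_mult_eq) (auto simp: k_def degree_monom_eq monom_eq_0_iff)
    have "coeff (unipoly y g) (vdeg y f) = 0"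
      using 2 by (simp add: g_eq vlead_def k_def coeff_monom_mult)
    moreover have "degree (unipoly y g) \<le> vdeg y f"
      unfolding g_eq by (intro degree_diff_le order.trans[OF degree_smult_le]) (auto simp: deg_k)
    ultimately have small: "g = 0 \<or> vdeg y g < vdeg y f"
      by (metis leading_coeff_0_iff le_neq_implies_less unipoly_eq_0_iff)
    have "\<exists>e q r. vlead y m ^ e * g = q * m + r \<and> (r = 0 \<or> vdeg y r < vdeg y m)
       \<and> invars (insert y W) q \<and> invars (insert y W) r"
    proof (cases "g = 0")
      case True
      then show ?thesis
        by (intro exI[of _ 0] exI[of _ 0] exI[of _ 0]) auto
    next
      case False
      then show ?thesis using less.hyps[of g] small inv_g by blast
    qed
    then obtain e q r where *: "vlead y m ^ e * g = q * m + r" "r = 0 \<or> vdeg y r < vdeg y m"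
      "invars (insert y W) q" "invars (insert y W) r" by blast
    have "vlead y m ^ Suc e * f = vlead y m ^ e * g + vlead y m ^ e * t * m"
      by (simp add: g_def algebra_simps)
    also have "\<dots> = (q + vlead y m ^ e * t) * m + r" using *(1) by (simp add: algebra_simps)
    finally have "vlead y m ^ Suc e * f = (q + vlead y m ^ e * t) * m + r" .
    moreover have "invars (insert y W) (q + vlead y m ^ e * t)"
      by (intro invars_add invars_mult invars_power inv_lead inv_t * assms)
    ultimately show ?thesis using * by blast
  qed
qed

section \<open>Gauss's lemma, and primality of irreducible polynomials by adding one variable at a
  time\<close>

lemma const_dvd_iff_coeffs:
  fixes c :: "('v::linorder, 'a::idom) mpoly"
  assumes "invars (- {y}) c"
  shows "c dvd f \<longleftrightarrow> (\<forall>k. c dvd coeff (unipoly y f) k)"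
proof
  assume "c dvd f"
  then have "[:c:] dvd unipoly y f"
    using unipoly.hom_dvd[of c f y] by (simp add: unipoly_free[OF assms])
  then show "\<forall>k. c dvd coeff (unipoly y f) k" by (simp add: const_poly_dvd_iff)
next
  assume "\<forall>k. c dvd coeff (unipoly y f) k"
  then have "[:c:] dvd unipoly y f" by (simp add: const_poly_dvd_iff)
  then obtain h where "unipoly y f = [:c:] * h" by (auto simp: dvd_def)
  then have "f = c * poly h (mvar y)" using poly_unipoly[of y f] by simp
  then show "c dvd f" by simp
qed

text \<open>Divisibility is meant in the full ring and only the test factors are confined to
  \<open>W\<close>. All polynomials keep the same type while the induction enlarges
  \<open>W\<close>.\<close>

definition primein :: "'v set \<Rightarrow> ('v, 'a::comm_ring_1) mpoly \<Rightarrow> bool" where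
  "primein W p \<longleftrightarrow> (\<forall>f g. invars W f \<longrightarrow> invars W g \<longrightarrow> p dvd f * g \<longrightarrow> p dvd f \<or> p dvd g)"

text \<open>Gauss's lemma: if \<open>i\<close> and \<open>j\<close> are the lowest indices of
  coefficients of \<open>f\<close> and \<open>g\<close> that \<open>p\<close> does not divide, then
  in the coefficient of \<open>f * g\<close> at \<open>i + j\<close> every product but one is
  divisible by \<open>p\<close>.\<close>

lemma primein_insert_free:
  fixes p :: "('v::linorder, 'a::idom) mpoly"
  assumes p: "primein W p" and free: "invars W p" and y: "y \<notin> W"
  shows "primein (insert y W) p"
  unfolding primein_def
proof (intro allI impI, rule ccontr)
  fix f g assume f: "invars (insert y W) f" and g: "invars (insert y W) g" and dvd: "p dvd f * g"
    and not: "\<not> (p dvd f \<or> p dvd g)"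
  have free': "invars (- {y}) p" by (rule invars_mono[OF free]) (use y in auto)
  let ?f = "coeff (unipoly y f)" and ?g = "coeff (unipoly y g)"
  from not obtain i0 j0 where "\<not> p dvd ?f i0" "\<not> p dvd ?g j0"
    using const_dvd_iff_coeffs[OF free', of f] const_dvd_iff_coeffs[OF free', of g] by blast
  define i where "i = (LEAST i. \<not> p dvd ?f i)"
  define j where "j = (LEAST i. \<not> p dvd ?g i)"
  have i: "\<not> p dvd ?f i" "\<And>k. k < i \<Longrightarrow> p dvd ?f k"
    unfolding i_def using LeastI[of "\<lambda>i. \<not> p dvd ?f i", OF \<open>\<not> p dvd ?f i0\<close>] not_less_Least by auto
  have j: "\<not> p dvd ?g j" "\<And>k. k < j \<Longrightarrow> p dvd ?g k"
    unfolding j_def using LeastI[of "\<lambda>i. \<not> p dvd ?g i", OF \<open>\<not> p dvd ?g j0\<close>] not_less_Least by auto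
  have "p dvd coeff (unipoly y (f * g)) (i + j)"
    using dvd const_dvd_iff_coeffs[OF free', of "f * g"] by blast
  also have "coeff (unipoly y (f * g)) (i + j) = (\<Sum>k\<le>i + j. ?f k * ?g (i + j - k))"
    by (simp add: unipoly.hom_mult coeff_mult)
  also have "\<dots> = ?f i * ?g j + (\<Sum>k\<in>{..i + j} - {i}. ?f k * ?g (i + j - k))"
    by (subst sum.remove[of _ i]) auto
  finally have sum: "p dvd ?f i * ?g j + (\<Sum>k\<in>{..i + j} - {i}. ?f k * ?g (i + j - k))" .
  have "p dvd (\<Sum>k\<in>{..i + j} - {i}. ?f k * ?g (i + j - k))"
  proof (rule dvd_sum)
    fix k assume "k \<in> {..i + j} - {i}"
    then have "k < i \<or> i + j - k < j" by auto
    then show "p dvd ?f k * ?g (i + j - k)" using i(2) j(2) by (auto intro: dvd_mult dvd_mult2)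
  qed
  with sum have "p dvd ?f i * ?g j" using dvd_add_left_iff by blast
  moreover have "invars W (?f i)" "invars W (?g j)"
    using invars_mono[OF invars_coeff_unipoly[OF f]] invars_mono[OF invars_coeff_unipoly[OF g]] by auto
  ultimately show False using p i(1) j(1) unfolding primein_def by blast
qed

text \<open>The irreducible factors of \<open>a\<close> are removed one by one: each is prime also
  in the presence of \<open>y\<close> by \<open>primein_insert_free\<close>, hence divides
  \<open>u\<close> or \<open>v\<close>. A unit that remains is absorbed by \<open>u\<close>.\<close>

lemma strip_free_factor:
  fixes a :: "('v::linorder, 'a::field) mpoly"
  assumes primes: "\<And>p :: ('v, 'a) mpoly. irreducible p \<Longrightarrow> invars W p \<Longrightarrow> primein W p" and y: "y \<notin> W"
  assumes "a \<noteq> 0" "invars W a" "a * q = u * v"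
    and "invars (insert y W) u" "invars (insert y W) v" "u \<noteq> 0" "v \<noteq> 0"
  shows "\<exists>b c u' v'. u = b * u' \<and> v = c * v' \<and> q = u' * v' \<and> invars W b \<and> invars W c"
  using assms(3-)
proof (induction "wdeg (\<lambda>_. 1) a" arbitrary: a u v rule: less_induct)
  case less
  show ?case
  proof (cases "a dvd 1")
    case True
    then obtain i where i: "a * i = 1" by (metis dvd_def)
    have "i \<noteq> 0" using i by fastforce
    then have "invars W i" using i invars_multD(2)[of W a i] less.prems by simp
    moreover have "q = (i * u) * v" 
      using less.prems(3) i by (metis mult.assoc mult.commute mult_1)
    moreover have "u = a * (i * u)" using i by (metis mult.assoc mult_1)
    ultimately show ?thesis
      using less.prems by (intro exI[of _ a] exI[of _ 1] exI[of _ "i * u"] exI[of _ v]) auto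
  next
    case False
    with less.prems obtain p a' where p: "irreducible p" "a = p * a'" "a' \<noteq> 0"
      and small: "wdeg (\<lambda>_. 1) a' < wdeg (\<lambda>_. 1) a"
      using irreducible_factor_exists by blast
    have "p \<noteq> 0" using p(1) by auto
    then have inv: "invars W p" "invars W a'" using invars_multD[of W p a'] p less.prems by auto
    have "primein (insert y W) p"
      by (rule primein_insert_free[OF primes[OF p(1) inv(1)] inv(1) y])
    moreover have "p dvd u * v" using less.prems(3) p(2) by (metis dvd_triv_left mult.assoc)
    ultimately consider "p dvd u" | "p dvd v" using less.prems unfolding primein_def by blast
    then show ?thesis
    proof cases
      case 1
      then obtain u1 where u1: "u = p * u1" by (auto simp: dvd_def)
      have nz: "u1 \<noteq> 0" using u1 less.prems by auto
      have "p * (a' * q) = p * (u1 * v)" using less.prems(3) by (simp add: u1 p(2) mult.assoc)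
      then have "a' * q = u1 * v" using \<open>p \<noteq> 0\<close> by simp
      moreover have "invars (insert y W) u1" using invars_multD(2)[of _ p u1] less.prems u1 nz \<open>p \<noteq> 0\<close> by auto
      ultimately obtain b c u' v' where "u1 = b * u'" "v = c * v'" "q = u' * v'" "invars W b" "invars W c"
        using less.hyps[OF small p(3) inv(2)] less.prems nz by blast
      then show ?thesis using u1 inv
        by (intro exI[of _ "p * b"] exI[of _ c] exI[of _ u'] exI[of _ v']) (auto simp: mult.assoc intro: invars_mult)
    next
      case 2
      then obtain v1 where v1: "v = p * v1" by (auto simp: dvd_def)
      have nz: "v1 \<noteq> 0" using v1 less.prems by auto
      have "p * (a' * q) = p * (u * v1)" using less.prems(3) by (simp add: v1 p(2) mult_ac)
      then have "a' * q = u * v1" using \<open>p \<noteq> 0\<close> by simp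
      moreover have "invars (insert y W) v1" using invars_multD(2)[of _ p v1] less.prems v1 nz \<open>p \<noteq> 0\<close> by auto
      ultimately obtain b c u' v' where "u = b * u'" "v1 = c * v'" "q = u' * v'" "invars W b" "invars W c"
        using less.hyps[OF small p(3) inv(2)] less.prems nz by blast
      then show ?thesis using v1 inv
        by (intro exI[of _ b] exI[of _ "p * c"] exI[of _ u'] exI[of _ v']) (auto simp: mult.assoc intro: invars_mult)
    qed
  qed
qed

text \<open>The combination \<open>m\<close> of \<open>p\<close> and \<open>f\<close> of least
  degree in \<open>y\<close> divides both of them up to powers of its leading coefficient, which is
  free of \<open>y\<close>. Stripping free factors leaves \<open>p = q1 * m1\<close>. If
  \<open>q1\<close> is a unit, \<open>p\<close> divides \<open>m\<close> and therefore
  \<open>f\<close>; if \<open>m1\<close> is a unit, \<open>m\<close> is free of \<open>y\<close> up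
  to that unit, and since \<open>p\<close> divides \<open>m * g\<close>, it divides
  \<open>g\<close>.\<close>

lemma irreducible_primein_insert:
  fixes p :: "('v::linorder, 'a::field) mpoly"
  assumes primes: "\<And>p :: ('v, 'a) mpoly. irreducible p \<Longrightarrow> invars W p \<Longrightarrow> primein W p" and y: "y \<notin> W"
    and p: "irreducible p" "invars (insert y W) p"
  shows "primein (insert y W) p"
proof (cases "invars W p")
  case True
  show ?thesis by (rule primein_insert_free[OF primes[OF p(1) True] True y])
next
  case False
  let ?W = "insert y W"
  have pos: "vdeg y p > 0"
  proof (rule ccontr)
    assume "\<not> vdeg y p > 0"
    then have "invars (- {y}) p" by (simp add: vdeg_0_iff)
    with p(2) have "invars W p" unfolding invars_def by blast
    with False show False by simp
  qed
  have p0: "p \<noteq> 0" using p(1) by auto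
  have free_vdeg: "vdeg y b = 0" if "invars W b" for b :: "('v, 'a) mpoly"
    using vdeg_0_iff[of y b] invars_mono[OF that, of "- {y}"] y by blast
  have unit_vdeg: "vdeg y b = 0" if "b dvd 1" for b :: "('v, 'a) mpoly"
  proof -
    have "wdeg (\<lambda>_. 1) b = 0" using is_unit_iff_wdeg_1[of b] that by blast
    then have b: "b = mconst (mcoeff b 0)" by (rule wdeg_1_eq_0)
    have "invars (- {y}) b" by (subst b) (rule invars_mconst)
    then show ?thesis by (simp add: vdeg_0_iff)
  qed
  \<comment> \<open>Gauss: factors free of \<open>y\<close> can be removed without losing divisibility by \<open>p\<close>.\<close>
  have cancel: "p dvd f" if f: "p dvd a * f" "a \<noteq> 0" "invars W a" "invars ?W f" for a f
  proof (cases "f = 0")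
    case False
    from f obtain h where h: "a * f = p * h" by (auto simp: dvd_def)
    have h0: "h \<noteq> 0" using h f False by auto
    have "invars ?W (a * f)" by (intro invars_mult f invars_mono[OF f(3)]) auto
    then have "invars ?W h" using invars_multD(2)[of ?W p h] h p0 h0 by simp
    then obtain b c u v where *: "p = b * u" "h = c * v" "f = u * v" "invars W b"
      using strip_free_factor[OF primes y f(2,3) h p(2) _ p0 h0] by blast
    have "b \<noteq> 0" "u \<noteq> 0" using * p0 by auto
    then have "vdeg y u > 0" using pos *(1) vdeg_mult[of b u y] free_vdeg[OF *(4)] by simp
    then have "\<not> u dvd 1" using unit_vdeg by fastforce
    then have "b dvd 1" using irreducibleD[OF p(1) *(1)] by blast
    then obtain i where i: "b * i = 1" by (metis dvd_def)
    have "p * i = u * (b * i)" unfolding *(1) by (simp only: mult_ac)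
    then have "u = p * i" using i by simp
    then show ?thesis using *(3) by (metis dvd_mult2 dvd_triv_left)
  qed simp
  show ?thesis
    unfolding primein_def
  proof (intro allI impI)
    fix f g assume f: "invars ?W f" and g: "invars ?W g" and dvd: "p dvd f * g"
    define I where "I = {m. m \<noteq> 0 \<and> (\<exists>u v. invars ?W u \<and> invars ?W v \<and> m = u * p + v * f)}"
    have "p = 1 * p + 0 * f" by simp
    then have "p \<in> I" unfolding I_def using p0 invars_1 invars_0 by blast
    then obtain m where m: "m \<in> I" "\<And>m'. m' \<in> I \<Longrightarrow> vdeg y m \<le> vdeg y m'"
      using ex_has_least_nat[of "\<lambda>m. m \<in> I" p "vdeg y"] by blast
    then obtain u v where uv: "invars ?W u" "invars ?W v" "m = u * p + v * f" and m0: "m \<noteq> 0"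
      unfolding I_def by blast
    have inv_m: "invars ?W m" unfolding uv(3) by (intro invars_add invars_mult uv p f)
    let ?l = "vlead y m"
    have l: "invars W ?l" "?l \<noteq> 0"
      using invars_mono[OF invars_vlead[OF inv_m], of W] vlead_nonzero[OF m0] by auto
    have exact: "\<exists>e q. ?l ^ e * h = q * m \<and> invars ?W q"
      if h: "invars ?W h" "\<exists>u v. invars ?W u \<and> invars ?W v \<and> h = u * p + v * f" for h
    proof -
      obtain e q r where *: "?l ^ e * h = q * m + r" "r = 0 \<or> vdeg y r < vdeg y m" "invars ?W q" "invars ?W r"
        using pseudo_division[OF m0 inv_m h(1)] by blast
      obtain u' v' where h': "invars ?W u'" "invars ?W v'" "h = u' * p + v' * f" using h(2) by blast
      have "r = (?l ^ e * u' - q * u) * p + (?l ^ e * v' - q * v) * f"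
        using *(1) by (simp add: h'(3) uv(3) algebra_simps)
      moreover have "invars ?W (?l ^ e * u' - q * u)" "invars ?W (?l ^ e * v' - q * v)"
        by (intro invars_diff invars_mult invars_power *(3) uv h' invars_mono[OF l(1)] subset_insertI)+
      ultimately have "r \<in> I \<or> r = 0" unfolding I_def by blast
      then have "r = 0" using *(2) m(2)[of r] by (metis not_less)
      then show ?thesis using * by auto
    qed
    obtain e q where q: "?l ^ e * p = q * m" "invars ?W q"
      using exact[OF p(2)] by (metis invars_0 invars_1 mult_1 mult_zero_left add_0_right)
    obtain e' q' where q': "?l ^ e' * f = q' * m"
      using exact[OF f] by (metis invars_0 invars_1 mult_1 mult_zero_left add_0_left)
    have lpow: "?l ^ k \<noteq> 0" "invars W (?l ^ k)" for k using l by (auto intro: invars_power)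
    have "q \<noteq> 0" using q lpow[of e] p0 by auto
    then obtain b c q1 m1 where *: "q = b * q1" "m = c * m1" "p = q1 * m1" "invars W b" "invars W c"
      using strip_free_factor[OF primes y lpow[of e] q(1) q(2) inv_m _ m0] by blast
    have "q1 dvd 1 \<or> m1 dvd 1" using irreducibleD[OF p(1) *(3)] .
    then show "p dvd f \<or> p dvd g"
    proof
      assume "q1 dvd 1"
      then obtain i where i: "q1 * i = 1" by (metis dvd_def)
      have "p * i = m1 * (q1 * i)" unfolding *(3) by (simp only: mult_ac)
      then have "p * i = m1" using i by simp
      then have "p dvd m" using *(2) by (metis dvd_mult dvd_triv_left)
      then have "p dvd ?l ^ e' * f" using q' by simp
      then show ?thesis using cancel lpow f by blast
    next
      assume "m1 dvd 1"
      then obtain i where i: "m1 * i = 1" by (metis dvd_def)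
      have "p dvd m * g" unfolding uv(3) distrib_right
        using dvd by (intro dvd_add) (simp_all add: mult.assoc dvd_mult)
      then have "p dvd (m * g) * i" by simp
      also have "(m * g) * i = c * g * (m1 * i)" unfolding *(2) by (simp only: mult_ac)
      finally have "p dvd c * g" using i by simp
      moreover have "c \<noteq> 0" using *(2) m0 by auto
      ultimately show ?thesis using cancel g *(5) by blast
    qed
  qed
qed

text \<open>Only finitely many variables occur, so they can be added one by one; the induction
  starts with the constants, none of which is irreducible.\<close>

theorem irreducible_dvd_mult:
  fixes p :: "('v::linorder, 'a::field) mpoly"
  assumes "irreducible p" "p dvd f * g"
  shows "p dvd f \<or> p dvd g"
proof -
  have primes: "primein W p" if "finite W" "irreducible p" "invars W p" for W and p :: "('v, 'a) mpoly"
    using that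
  proof (induction W arbitrary: p rule: finite_induct)
    case empty
    have "\<forall>\<alpha>\<in>Poly_Mapping.keys p. wt (\<lambda>_. 1) \<alpha> \<le> 0"
      using empty.prems(2) unfolding invars_def by (auto simp: wt_def)
    then have "wdeg (\<lambda>_. 1) p = 0" using wdeg_le_iff[of "\<lambda>_. 1" p 0] by simp
    moreover have "p \<noteq> 0" using empty by auto
    ultimately have "p dvd 1" using is_unit_iff_wdeg_1[of p] by blast
    then show ?case using empty by (auto simp: irreducible_def)
  next
    case (insert y W)
    show ?case by (rule irreducible_primein_insert) (use insert in auto)
  qed
  obtain W1 W2 W3 where W: "finite W1" "invars W1 p" "finite W2" "invars W2 f" "finite W3" "invars W3 g"
    using invars_finite by metis
  let ?W = "W1 \<union> W2 \<union> W3"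
  have "invars ?W p" "invars ?W f" "invars ?W g" using W by (auto elim: invars_mono)
  then show ?thesis using primes[of ?W p] W assms unfolding primein_def by blast
qed

lemma irreducible_dvd_power:
  fixes p :: "('v::linorder, 'a::field) mpoly"
  shows "irreducible p \<Longrightarrow> p dvd f ^ k \<Longrightarrow> p dvd f"
proof (induction k)
  case 0
  then show ?case by (auto simp: irreducible_def)
next
  case (Suc k)
  then show ?case using irreducible_dvd_mult[of p f "f ^ k"] by auto
qed


section \<open>Polynomial identities and specialization\<close>

lemma poly_coeff_map_eval:
  fixes p :: "('v, complex) mpoly"
  shows "poly (map_poly (mpoly_eval a) (unipoly y p)) t = mpoly_eval (a(y := t)) p"
proof -
  have free: "mpoly_eval (a(y := t)) (coeff (unipoly y p) k) = mpoly_eval a (coeff (unipoly y p) k)" for k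
  proof (rule mpoly_eval_cong)
    fix \<alpha> v assume "\<alpha> \<in> Poly_Mapping.keys (coeff (unipoly y p) k)" "v \<in> Poly_Mapping.keys \<alpha>"
    moreover have "invars (UNIV - {y}) (coeff (unipoly y p) k)"
      by (rule invars_coeff_unipoly) (simp add: invars_def)
    ultimately show "(a(y := t)) v = a v" unfolding invars_def by auto
  qed
  have "mpoly_eval (a(y := t)) p = mpoly_eval (a(y := t)) (poly (unipoly y p) (mvar y))"
    by (simp only: poly_unipoly)
  also have "\<dots> = (\<Sum>k\<le>vdeg y p. mpoly_eval a (coeff (unipoly y p) k) * t ^ k)"
    by (simp add: poly_altdef ev.hom_sum ev.hom_mult ev.hom_power free)
  also have "\<dots> = poly (map_poly (mpoly_eval a) (unipoly y p)) t"
    unfolding poly_altdef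
  proof (rule sum.mono_neutral_cong_right)
    show "{..degree (map_poly (mpoly_eval a) (unipoly y p))} \<subseteq> {..vdeg y p}"
      using degree_map_poly_le[of "mpoly_eval a" "unipoly y p"] by auto
    show "\<forall>k\<in>{..vdeg y p} - {..degree (map_poly (mpoly_eval a) (unipoly y p))}.
        mpoly_eval a (coeff (unipoly y p) k) * t ^ k = 0"
      using coeff_eq_0[of "map_poly (mpoly_eval a) (unipoly y p)"] by (auto simp: coeff_map_poly)
  qed (auto simp: coeff_map_poly)
  finally show ?thesis ..
qed

lemma poly_eq_0_of_roots:
  fixes p :: "'a::idom poly"
  assumes "degree p < card S" "\<And>s. s \<in> S \<Longrightarrow> poly p s = 0"
  shows "p = 0"
proof (rule ccontr)
  assume "p \<noteq> 0"
  then have "card S \<le> card {x. poly p x = 0}"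
    using assms(2) poly_roots_finite by (intro card_mono) auto
  also have "\<dots> \<le> degree p" by (rule card_poly_roots_bound[OF \<open>p \<noteq> 0\<close>])
  finally show False using assms(1) by simp
qed

lemma mpoly_eq_0I:
  fixes p :: "('v, complex) mpoly"
  assumes "\<And>a. mpoly_eval a p = 0"
  shows "p = 0"
proof -
  have "p = 0" if "finite W" "invars W p" "\<And>a. mpoly_eval a p = 0" for W and p :: "('v, complex) mpoly"
    using that
  proof (induction W arbitrary: p rule: finite_induct)
    case empty
    then have "\<forall>\<alpha>\<in>Poly_Mapping.keys p. \<alpha> = 0" by (auto simp: invars_def)
    then have "p = mconst (mcoeff p 0)"
      by (intro poly_mapping_eqI) (auto simp: mconst_def lookup_single when_def in_keys_iff)
    moreover from this have "mcoeff p 0 = 0" using empty(2)[of "\<lambda>_. 0"] by (metis mpoly_eval_mconst)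
    ultimately show "p = 0" by (metis mconst_def single_zero)
  next
    case (insert y W)
    have "coeff (unipoly y p) k = 0" for k
    proof (rule insert.IH)
      show "invars W (coeff (unipoly y p) k)"
        by (rule invars_mono[OF invars_coeff_unipoly[OF insert.prems(1)]]) auto
      fix a
      have "map_poly (mpoly_eval a) (unipoly y p) = 0"
        by (simp add: poly_all_0_iff_0[symmetric] poly_coeff_map_eval insert.prems(2))
      then show "mpoly_eval a (coeff (unipoly y p) k) = 0"
        by (metis coeff_0 coeff_map_poly ev.hom_zero)
    qed
    then have "unipoly y p = 0" by (intro poly_eqI) simp
    then show ?case by simp
  qed
  then show ?thesis using invars_finite assms by metis
qed

lemma degree_msubst_le:
  assumes "\<And>v. degree (x v) \<le> w v" "\<And>c. degree (h c) = 0"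
  shows "degree (msubst h x p) \<le> wdeg w p"
  unfolding msubst_def
proof (intro degree_sum_le)
  fix \<alpha> assume \<alpha>: "\<alpha> \<in> Poly_Mapping.keys p"
  have "degree (\<Prod>v\<in>Poly_Mapping.keys \<alpha>. x v ^ expo \<alpha> v) \<le>
      (\<Sum>v\<in>Poly_Mapping.keys \<alpha>. degree (x v ^ expo \<alpha> v))"
    using degree_prod_sum_le[of "Poly_Mapping.keys \<alpha>" "\<lambda>v. x v ^ expo \<alpha> v"] by (simp add: o_def)
  also have "\<dots> \<le> (\<Sum>v\<in>Poly_Mapping.keys \<alpha>. w v * expo \<alpha> v)"
    by (intro sum_mono order.trans[OF degree_power_le] mult_right_mono assms) auto
  finally have "degree (mon_eval x \<alpha>) \<le> wt w \<alpha>" by (simp add: mon_eval_def wt_def)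
  then have "degree (h (mcoeff p \<alpha>) * mon_eval x \<alpha>) \<le> wt w \<alpha>"
    using degree_mult_le[of "h (mcoeff p \<alpha>)" "mon_eval x \<alpha>"] assms(2) by simp
  also have "\<dots> \<le> wdeg w p" using wdeg_le_iff \<alpha> by blast
  finally show "degree (h (mcoeff p \<alpha>) * mon_eval x \<alpha>) \<le> wdeg w p" .
qed auto


section \<open>Systems of forms\<close>

text \<open>A system of forms is given by the assignment of its coefficients, as in \<open>coeffs_of\<close>.\<close>

type_synonym coefs = "nat \<times> (nat \<Rightarrow>\<^sub>0 nat) \<Rightarrow> complex"
type_synonym cpoly = "(nat \<times> (nat \<Rightarrow>\<^sub>0 nat), complex) mpoly"

text \<open>The coefficient ring is left open because forms and points depending polynomially on a
  parameter are used as well.\<close>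

definition fval :: "nat \<Rightarrow> nat \<Rightarrow> (nat \<times> (nat \<Rightarrow>\<^sub>0 nat) \<Rightarrow> 'a::comm_semiring_1) \<Rightarrow> nat \<Rightarrow> (nat \<Rightarrow> 'a) \<Rightarrow> 'a" where
  "fval n d a i x = (\<Sum>\<alpha>\<in>monomials n d. a (i, \<alpha>) * mon_eval x \<alpha>)"

definition common_zero :: "nat \<Rightarrow> nat \<Rightarrow> coefs \<Rightarrow> bool" where
  "common_zero n d a \<longleftrightarrow> (\<exists>x. (\<exists>j<n. x j \<noteq> 0) \<and> (\<forall>i<n. fval n d a i x = 0))"

definition zero_ideal :: "nat \<Rightarrow> nat \<Rightarrow> cpoly set" where
  "zero_ideal n d = {p. \<forall>a. common_zero n d a \<longrightarrow> mpoly_eval a p = 0}"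

definition coef_vars :: "nat \<Rightarrow> nat \<Rightarrow> (nat \<times> (nat \<Rightarrow>\<^sub>0 nat)) set" where
  "coef_vars n d = {..<n} \<times> monomials n d"

lemma mon_degree_eq: "Poly_Mapping.keys \<alpha> \<subseteq> {..<n::nat} \<Longrightarrow> mon_degree \<alpha> = (\<Sum>v<n. expo \<alpha> v)"
  unfolding mon_degree_def by (rule sum.mono_neutral_left) (auto simp: in_keys_iff)

lemma mem_monomials_iff:
  "\<alpha> \<in> monomials n d \<longleftrightarrow> Poly_Mapping.keys \<alpha> \<subseteq> {..<n} \<and> (\<Sum>v<n. expo \<alpha> v) = d"
  unfolding monomials_def using mon_degree_eq by auto

lemma lookup_outside: "Poly_Mapping.keys \<alpha> \<subseteq> {..<n::nat} \<Longrightarrow> v \<ge> n \<Longrightarrow> expo \<alpha> v = 0"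
  by (rule ccontr) (meson in_keys_iff leD lessThan_iff subsetD)

lemma lookup_le: "\<alpha> \<in> monomials n d \<Longrightarrow> expo \<alpha> v \<le> d"
proof -
  assume \<alpha>: "\<alpha> \<in> monomials n d"
  show ?thesis
  proof (cases "v < n")
    case True
    then have "expo \<alpha> v \<le> (\<Sum>v<n. expo \<alpha> v)"
      by (intro member_le_sum) auto
    then show ?thesis using \<alpha> by (simp add: mem_monomials_iff)
  next
    case False
    then show ?thesis using \<alpha> lookup_outside[of \<alpha> n v] by (simp add: mem_monomials_iff)
  qed
qed

lemma inj_on_lookup_restrict:
  assumes "\<And>\<alpha>. \<alpha> \<in> M \<Longrightarrow> Poly_Mapping.keys \<alpha> \<subseteq> {..<n::nat}"
  shows "inj_on (\<lambda>\<alpha>. restrict (expo \<alpha>) {..<n}) M"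
proof (rule inj_onI, rule poly_mapping_eqI)
  fix \<alpha> \<beta> v assume M: "\<alpha> \<in> M" "\<beta> \<in> M"
    and eq: "restrict (expo \<alpha>) {..<n} = restrict (expo \<beta>) {..<n}"
  show "expo \<alpha> v = expo \<beta> v"
    using fun_cong[OF eq, of v] lookup_outside[OF assms[OF M(1)], of v] lookup_outside[OF assms[OF M(2)], of v]
    by (cases "v < n") (auto simp: not_less)
qed

lemma finite_monomials [simp]: "finite (monomials n d)"
proof (rule finite_imageD)
  show "inj_on (\<lambda>\<alpha>. restrict (expo \<alpha>) {..<n}) (monomials n d)"
    by (rule inj_on_lookup_restrict) (simp add: monomials_def)
  have "(\<lambda>\<alpha>. restrict (expo \<alpha>) {..<n}) ` monomials n d \<subseteq> PiE {..<n} (\<lambda>_. {..d})"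
    using lookup_le by (auto simp: PiE_iff extensional_def split: if_splits)
  then show "finite ((\<lambda>\<alpha>. restrict (expo \<alpha>) {..<n}) ` monomials n d)"
    by (rule finite_subset) (auto intro: finite_PiE)
qed

lemma finite_coef_vars: "finite (coef_vars n d)"
  by (simp add: coef_vars_def)

lemma mon_eval_monomial: "\<alpha> \<in> monomials n d \<Longrightarrow> mon_eval x \<alpha> = (\<Prod>v<n. x v ^ expo \<alpha> v)"
  by (rule mon_eval_superset) (auto simp: monomials_def)

lemma mon_eval_scale: "\<alpha> \<in> monomials n d \<Longrightarrow> mon_eval (\<lambda>v. c * x v) \<alpha> = c ^ d * mon_eval x \<alpha>"
  by (simp add: mon_eval_monomial power_mult_distrib prod.distrib power_sum[symmetric])
    (simp add: mem_monomials_iff)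

lemma fval_scale: "fval n d a i (\<lambda>v. c * x v) = c ^ d * fval n d a i x"
  by (simp add: fval_def mon_eval_scale sum_distrib_left mult_ac)

lemma single_in_monomials [simp]: "j < n \<Longrightarrow> Poly_Mapping.single j d \<in> monomials n d"
  by (cases "d = 0") (auto simp: monomials_def mon_degree_def)

lemma linear_times_power_in_monomials:
  assumes "i < n" "j < n" "d > 0"
  shows "Poly_Mapping.single i 1 + Poly_Mapping.single j (d - 1) \<in> monomials n d"
  using single_in_monomials[OF assms(1), of 1] single_in_monomials[OF assms(2), of "d - 1"] assms(3)
  by (auto simp: monomials_def mon_degree_add keys_add_nat)

lemma fval_cong: "(\<And>v. v < n \<Longrightarrow> x v = y v) \<Longrightarrow> fval n d a i x = fval n d a i y"
  unfolding fval_def by (intro sum.cong refl arg_cong2[of _ _ _ _ "(*)"]) (auto simp: mon_eval_monomial)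

lemma poly_mon_eval: "poly (mon_eval x \<alpha>) t = mon_eval (\<lambda>v. poly (x v) t) (\<alpha> :: 'v \<Rightarrow>\<^sub>0 nat)"
  for x :: "'v \<Rightarrow> 'a::comm_ring_1 poly"
  by (rule comm_ring_hom.hom_mon_eval[OF comm_ring_hom_poly])

lemma poly_fval: "poly (fval n d a i x) t = fval n d (\<lambda>v. poly (a v) t) i (\<lambda>v. poly (x v) t)"
  for x :: "nat \<Rightarrow> 'a::comm_ring_1 poly"
  by (simp add: fval_def poly_sum poly_mon_eval)

lemma nonroot: "p \<noteq> 0 \<Longrightarrow> \<exists>s. poly p s \<noteq> (0::complex)"
  using poly_all_0_iff_0 by blast

text \<open>Choose \<open>x_i^d + c x_j^d\<close> with \<open>i\<close> and \<open>j\<close> taken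
  from nonzero coordinates of the two points. Both values are nonzero polynomials in
  \<open>c\<close>.\<close>

lemma form_nonzero_at_two_points:
  fixes x1 x2 :: "nat \<Rightarrow> complex"
  assumes "\<exists>j<n. x1 j \<noteq> 0" "\<exists>j<n. x2 j \<noteq> 0"
  shows "\<exists>B. (\<Sum>\<alpha>\<in>monomials n d. B \<alpha> * mon_eval x1 \<alpha>) \<noteq> 0 \<and> (\<Sum>\<alpha>\<in>monomials n d. B \<alpha> * mon_eval x2 \<alpha>) \<noteq> 0"
proof -
  obtain i j where ij: "i < n" "x1 i \<noteq> 0" "j < n" "x2 j \<noteq> 0" using assms by blast
  define B where "B c \<alpha> = (if \<alpha> = Poly_Mapping.single i d then 1 else 0) + c * (if \<alpha> = Poly_Mapping.single j d then 1 else 0)"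
    for c :: complex and \<alpha>
  have B: "(\<Sum>\<alpha>\<in>monomials n d. B c \<alpha> * mon_eval x \<alpha>) = x i ^ d + c * x j ^ d" for c x
    using ij by (simp add: B_def distrib_right sum.distrib mult.assoc if_distrib[of "\<lambda>z. z * _"] if_distrib[of "\<lambda>z. c * z"] cong: if_cong)
  have "[:x1 i ^ d, x1 j ^ d:] \<noteq> 0" "[:x2 i ^ d, x2 j ^ d:] \<noteq> 0" using ij by simp_all
  then have "[:x1 i ^ d, x1 j ^ d:] * [:x2 i ^ d, x2 j ^ d:] \<noteq> 0" by (rule no_zero_divisors)
  then obtain c where "poly ([:x1 i ^ d, x1 j ^ d:] * [:x2 i ^ d, x2 j ^ d:]) c \<noteq> 0" using nonroot by blast
  then have "poly [:x1 i ^ d, x1 j ^ d:] c \<noteq> 0" "poly [:x2 i ^ d, x2 j ^ d:] c \<noteq> 0"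
    unfolding poly_mult by fastforce+
  then show ?thesis by (intro exI[of _ "B c"]) (simp add: B)
qed

text \<open>
  Two systems with zeros \<open>x1\<close>, \<open>x2\<close> are joined by a polynomial path of systems which vanish at the
  points of the line through \<open>x1\<close> and \<open>x2\<close>: subtract from the linear interpolation of the systems a
  multiple of an auxiliary form \<open>B\<close>.
\<close>

lemma zero_ideal_prime:
  assumes "p * q \<in> zero_ideal n d" "d > 0"
  shows "p \<in> zero_ideal n d \<or> q \<in> zero_ideal n d"
proof (rule ccontr)
  assume "\<not> ?thesis"
  then obtain a1 a2 where a: "common_zero n d a1" "mpoly_eval a1 p \<noteq> 0" "common_zero n d a2" "mpoly_eval a2 q \<noteq> 0"
    unfolding zero_ideal_def by blast
  obtain x1 where x1: "\<exists>j<n. x1 j \<noteq> 0" "\<And>i. i < n \<Longrightarrow> fval n d a1 i x1 = 0"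
    using a(1) unfolding common_zero_def by blast
  obtain x2 where x2: "\<exists>j<n. x2 j \<noteq> 0" "\<And>i. i < n \<Longrightarrow> fval n d a2 i x2 = 0"
    using a(3) unfolding common_zero_def by blast
  note x = x1 x2
  define L where "L u v = [:u, v - u:]" for u v :: complex
  have L0: "poly (L u v) 0 = u" and L1: "poly (L u v) 1 = v" for u v by (simp_all add: L_def)
  obtain B where B: "(\<Sum>\<alpha>\<in>monomials n d. B \<alpha> * mon_eval x1 \<alpha>) \<noteq> 0" "(\<Sum>\<alpha>\<in>monomials n d. B \<alpha> * mon_eval x2 \<alpha>) \<noteq> 0"
    using form_nonzero_at_two_points[OF x(1,3)] by blast
  define b where "b x = (\<Sum>\<alpha>\<in>monomials n d. B \<alpha> * mon_eval x \<alpha>)" for x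
  have b_scale: "b (\<lambda>j. c * x j) = c ^ d * b x" for c x
    by (simp add: b_def mon_eval_scale sum_distrib_left mult_ac)
  define X where "X j = L (x1 j) (x2 j)" for j
  define S where "S v = L (a1 v) (a2 v)" for v
  define \<beta> where "\<beta> = (\<Sum>\<alpha>\<in>monomials n d. [:B \<alpha>:] * mon_eval X \<alpha>)"
  \<comment> \<open>At the ends of the path \<open>X\<close> is a zero of \<open>S\<close>, so only
    \<open>\<nu> * \<beta> * S\<close> survives there. Since \<beta> takes the values
    \<open>b x1\<close> and \<open>b x2\<close>, this factor makes the path start at
    \<open>a1\<close> and end at \<open>a2\<close> exactly.\<close>
  define \<nu> where "\<nu> = L (inverse (b x1)) (inverse (b x2))"
  define A where "A = (\<lambda>(i, \<alpha>). if i < n \<and> \<alpha> \<in> monomials n d then \<nu> * (\<beta> * S (i, \<alpha>) - fval n d S i X * [:B \<alpha>:]) else S (i, \<alpha>))"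
  have \<beta>: "poly \<beta> s = b (\<lambda>j. poly (X j) s)" for s
    by (simp add: \<beta>_def b_def poly_sum poly_mon_eval)
  have "poly (A v) 0 = a1 v" for v
    using B x(2) by (cases v) (auto simp: A_def poly_fval \<beta> L0 X_def S_def \<nu>_def b_def)
  then have p: "msubst (\<lambda>c. [:c:]) A p \<noteq> 0" using a(2) poly_msubst[of A p 0] by auto
  have "poly (A v) 1 = a2 v" for v
    using B x(4) by (cases v) (auto simp: A_def poly_fval \<beta> L1 X_def S_def \<nu>_def b_def)
  then have q: "msubst (\<lambda>c. [:c:]) A q \<noteq> 0" using a(4) poly_msubst[of A q 1] by auto
  have "poly \<beta> 0 \<noteq> 0" using B by (simp add: \<beta> X_def L0 b_def)
  then have "\<beta> \<noteq> 0" by auto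
  \<comment> \<open>The line through \<open>x1\<close> and \<open>x2\<close> may pass through the
    origin. Avoiding the roots of \<beta> excludes this, since \<open>b\<close> vanishes at the
    origin.\<close>
  obtain s where s: "poly (msubst (\<lambda>c. [:c:]) A p * msubst (\<lambda>c. [:c:]) A q * \<beta>) s \<noteq> 0"
    using nonroot p q \<open>\<beta> \<noteq> 0\<close> by (metis no_zero_divisors)
  let ?a = "\<lambda>v. poly (A v) s" and ?x = "\<lambda>j. poly (X j) s"
  have "common_zero n d ?a"
    unfolding common_zero_def
  proof (intro exI[of _ ?x] conjI allI impI)
    have "b ?x \<noteq> 0" using s \<beta> by auto
    show "\<exists>j<n. ?x j \<noteq> 0"
    proof (rule ccontr)
      assume "\<not> ?thesis"
      then have *: "?x j = 0" if "j < n" for j using that by blast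
      have "b ?x = b (\<lambda>j. 0 * x1 j)"
        unfolding b_def using * by (intro sum.cong arg_cong2[of _ _ _ _ "(*)"]) (auto simp: mon_eval_monomial)
      also have "\<dots> = 0 ^ d * b x1" by (rule b_scale)
      finally show False using \<open>b ?x \<noteq> 0\<close> assms(2) by simp
    qed
    fix i assume i: "i < n"
    have hS: "poly (fval n d S i X) s = (\<Sum>\<alpha>\<in>monomials n d. poly (S (i, \<alpha>)) s * mon_eval ?x \<alpha>)"
      unfolding poly_fval by (simp add: fval_def)
    have "fval n d ?a i ?x = (\<Sum>\<alpha>\<in>monomials n d. poly \<nu> s * (poly \<beta> s * (poly (S (i, \<alpha>)) s * mon_eval ?x \<alpha>)
        - poly (fval n d S i X) s * (B \<alpha> * mon_eval ?x \<alpha>)))"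
      unfolding fval_def using i by (intro sum.cong refl) (simp add: A_def algebra_simps fval_def)
    also have "\<dots> = poly \<nu> s * (poly \<beta> s * poly (fval n d S i X) s - poly (fval n d S i X) s * poly \<beta> s)"
      by (simp add: sum_subtractf sum_distrib_left[symmetric] hS \<beta> b_def)
    finally show "fval n d ?a i ?x = 0" by simp
  qed
  moreover have "mpoly_eval ?a (p * q) \<noteq> 0"
    using s by (simp add: poly_msubst ev.hom_mult)
  ultimately show False using assms unfolding zero_ideal_def by blast
qed



section \<open>Macaulay's determinant\<close>

text \<open>As a weight it measures the degree in the coefficients of the \<open>i\<close>-th
  form.\<close>

definition block :: "nat \<Rightarrow> nat \<times> (nat \<Rightarrow>\<^sub>0 nat) \<Rightarrow> nat" where
  "block i v = (if fst v = i then 1 else 0)"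

lemma wdeg_add_le: "wdeg w (p + q) \<le> max (wdeg w p) (wdeg w q)"
  by (simp add: wdeg_def grade.hom_add degree_add_le_max)

lemma wdeg_mult_le: "wdeg w (p * q) \<le> wdeg w p + wdeg w q"
  by (simp add: wdeg_def grade.hom_mult degree_mult_le)

lemma wdeg_sum_le: "(\<And>i. i \<in> A \<Longrightarrow> wdeg w (f i) \<le> m) \<Longrightarrow> wdeg w (\<Sum>i\<in>A. f i) \<le> m"
proof (induction A rule: infinite_finite_induct)
  case (insert x A)
  have "wdeg w (f x + sum f A) \<le> max (wdeg w (f x)) (wdeg w (sum f A))" by (rule wdeg_add_le)
  also have "\<dots> \<le> m" using insert by auto
  finally show ?case using insert by simp
qed (simp_all add: wdeg_def)

lemma wdeg_prod_le: "(\<And>i. i \<in> A \<Longrightarrow> wdeg w (f i) \<le> g i) \<Longrightarrow> wdeg w (\<Prod>i\<in>A. f i) \<le> (\<Sum>i\<in>A. g i)"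
proof (induction A rule: infinite_finite_induct)
  case (insert x A)
  have "wdeg w (f x * prod f A) \<le> wdeg w (f x) + wdeg w (prod f A)" by (rule wdeg_mult_le)
  also have "\<dots> \<le> g x + sum g A" using insert by (intro add_mono) auto
  finally show ?case using insert by simp
qed (simp_all add: wdeg_def)

lemma wdeg_mvar: "wdeg w (mvar v) \<le> w v"
  by (auto simp: wdeg_le_iff mvar_def wt_def)

lemma wdeg_0 [simp]: "wdeg w 0 = 0"
  by (simp add: wdeg_def)

lemma wdeg_signof_mult: "wdeg w (signof p * q) = wdeg w q"
  by (cases p rule: sign_cases) (simp_all add: wdeg_def grade.hom_uminus)

definition power_system :: "nat \<Rightarrow> coefs" where
  "power_system d = (\<lambda>(i, \<alpha>). if \<alpha> = Poly_Mapping.single i d then 1 else 0)"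

text \<open>Row \<alpha> of the matrix lists the coefficients of \<open>F_i\<close> times the
  monomial \<open>\<rho> \<alpha>\<close>, where \<open>i = sel \<alpha>\<close> and \<alpha> is
  \<open>\<rho> \<alpha>\<close> times \<open>x_i^d\<close>. At a common zero, the values of all
  monomials of degree \<delta> form a kernel vector; it is nonzero because it contains a power of a
  nonzero coordinate.\<close>

lemma macaulay_determinant:
  assumes d: "d > 0" and i0: "i0 < n"
  shows "\<exists>D \<in> zero_ideal n d. invars (coef_vars n d) D \<and> mpoly_eval (power_system d) D = 1
    \<and> wdeg (block i0) D \<le> d ^ (n - 1)"
proof -
  \<comment> \<open>The least degree in which every monomial must have an exponent of at least
    \<open>d\<close>, by the pigeonhole principle.\<close>
  define \<delta> where "\<delta> = n * (d - 1) + 1"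
  define M where "M = monomials n \<delta>"
  define m where "m = card M"
  obtain e where e: "bij_betw e {0..<m} M"
    using ex_bij_betw_nat_finite[of M] unfolding m_def M_def by auto
  then have e_M: "e k \<in> M" if "k < m" for k using that by (auto simp: bij_betw_def)
  have e_inj: "e k = e l \<longleftrightarrow> k = l" if "k < m" "l < m" for k l
    using e that by (auto simp: bij_betw_def inj_on_def)
  \<comment> \<open>The index \<open>i0\<close> is used only when no other is possible. This keeps
    the number of rows belonging to form \<open>i0\<close>, and with it the degree in that block,
    small.\<close>
  define sel where "sel \<alpha> = (if \<exists>i<n. i \<noteq> i0 \<and> expo \<alpha> i \<ge> d
      then SOME i. i < n \<and> i \<noteq> i0 \<and> expo \<alpha> i \<ge> d else i0)" for \<alpha>
  have sel_i0: "expo \<alpha> i < d" if "sel \<alpha> = i0" "i < n" "i \<noteq> i0" for \<alpha> i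
  proof (rule ccontr)
    assume "\<not> ?thesis"
    then have ex: "\<exists>i<n. i \<noteq> i0 \<and> expo \<alpha> i \<ge> d" using that by (meson not_le)
    then have "sel \<alpha> \<noteq> i0" using someI_ex[OF ex] by (simp add: sel_def)
    then show False using that by simp
  qed
  have sel: "sel \<alpha> < n \<and> expo \<alpha> (sel \<alpha>) \<ge> d" if \<alpha>: "\<alpha> \<in> M" for \<alpha>
  proof (cases "\<exists>i<n. i \<noteq> i0 \<and> expo \<alpha> i \<ge> d")
    case True
    then show ?thesis using someI_ex[OF True] by (simp add: sel_def)
  next
    case False
    have "\<delta> = expo \<alpha> i0 + (\<Sum>v\<in>{..<n} - {i0}. expo \<alpha> v)"
      using \<alpha> i0 by (simp add: M_def mem_monomials_iff sum.remove[symmetric])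
    also have "(\<Sum>v\<in>{..<n} - {i0}. expo \<alpha> v) \<le> (\<Sum>v\<in>{..<n} - {i0}. d - 1)"
      using False d by (intro sum_mono) force
    also have "\<dots> = (n - 1) * (d - 1)" using i0 by simp
    finally have "n * (d - 1) + 1 \<le> expo \<alpha> i0 + (n - 1) * (d - 1)" by (simp add: \<delta>_def)
    moreover have "n * (d - 1) = (n - 1) * (d - 1) + (d - 1)" using i0 by (cases n) auto
    ultimately have "expo \<alpha> i0 \<ge> d" by linarith
    then show ?thesis using i0 unfolding sel_def if_not_P[OF False] by simp
  qed
  define \<rho> where "\<rho> \<alpha> = \<alpha> - Poly_Mapping.single (sel \<alpha>) d" for \<alpha>
  have \<rho>: "\<rho> \<alpha> + Poly_Mapping.single (sel \<alpha>) d = \<alpha>" if "\<alpha> \<in> M" for \<alpha>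
    by (rule poly_mapping_eqI) (use sel[OF that] in \<open>auto simp: \<rho>_def lookup_add lookup_minus lookup_single when_def\<close>)
  have \<rho>_M: "\<rho> \<alpha> + \<gamma> \<in> M" if "\<alpha> \<in> M" "\<gamma> \<in> monomials n d" for \<alpha> \<gamma>
  proof -
    have "mon_degree (\<rho> \<alpha>) + mon_degree (Poly_Mapping.single (sel \<alpha>) d) = \<delta>"
      unfolding mon_degree_add[symmetric] \<rho>[OF that(1)] using that by (simp add: M_def monomials_def)
    moreover have "Poly_Mapping.single (sel \<alpha>) d \<in> monomials n d" using sel[OF that(1)] by simp
    ultimately have "mon_degree (\<rho> \<alpha> + \<gamma>) = \<delta>"
      using that by (simp add: mon_degree_add monomials_def)
    moreover have "Poly_Mapping.keys (\<rho> \<alpha>) \<subseteq> Poly_Mapping.keys \<alpha>"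
      by (subst (2) \<rho>[OF that(1), symmetric]) (auto simp: keys_add_nat)
    ultimately show ?thesis using that by (auto simp: M_def monomials_def keys_add_nat)
  qed
  define entry :: "(nat \<Rightarrow>\<^sub>0 nat) \<Rightarrow> (nat \<Rightarrow>\<^sub>0 nat) \<Rightarrow> cpoly" where
    "entry \<alpha> \<beta> = (if \<beta> \<in> (\<lambda>\<gamma>. \<rho> \<alpha> + \<gamma>) ` monomials n d then mvar (sel \<alpha>, \<beta> - \<rho> \<alpha>) else 0)" for \<alpha> \<beta>
  define A where "A = mat m m (\<lambda>(k, l). entry (e k) (e l))"
  have A: "A \<in> carrier_mat m m" by (simp add: A_def)
  have det: "det A = (\<Sum>p | p permutes {0..<m}. signof p * (\<Prod>k = 0..<m. entry (e k) (e (p k))))"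
    unfolding det_def'[OF A] by (intro sum.cong prod.cong refl arg_cong2[of _ _ _ _ "(*)"])
      (auto simp: A_def permutes_in_image)
  have row: "(\<Sum>\<beta>\<in>M. mpoly_eval a (entry \<alpha> \<beta>) * mon_eval x \<beta>) = mon_eval x (\<rho> \<alpha>) * fval n d a (sel \<alpha>) x"
    if \<alpha>: "\<alpha> \<in> M" for a x \<alpha>
  proof -
    have "(\<Sum>\<beta>\<in>M. mpoly_eval a (entry \<alpha> \<beta>) * mon_eval x \<beta>) =
        (\<Sum>\<beta>\<in>(\<lambda>\<gamma>. \<rho> \<alpha> + \<gamma>) ` monomials n d. mpoly_eval a (entry \<alpha> \<beta>) * mon_eval x \<beta>)"
      by (rule sum.mono_neutral_right) (use \<rho>_M[OF \<alpha>] in \<open>auto simp: M_def entry_def\<close>)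
    also have "\<dots> = (\<Sum>\<gamma>\<in>monomials n d. mpoly_eval a (entry \<alpha> (\<rho> \<alpha> + \<gamma>)) * mon_eval x (\<rho> \<alpha> + \<gamma>))"
      by (subst sum.reindex) (auto simp: inj_on_def)
    also have "\<dots> = mon_eval x (\<rho> \<alpha>) * fval n d a (sel \<alpha>) x"
      unfolding fval_def sum_distrib_left
      by (intro sum.cong refl) (simp add: entry_def mon_eval_add mult_ac)
    finally show ?thesis .
  qed
  have "det A \<in> zero_ideal n d"
    unfolding zero_ideal_def
  proof (intro CollectI allI impI)
    fix a assume "common_zero n d a"
    then obtain x j where x: "j < n" "x j \<noteq> 0" "\<And>i. i < n \<Longrightarrow> fval n d a i x = 0"
      unfolding common_zero_def by blast
    define v where "v = vec m (\<lambda>l. mon_eval x (e l))"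
    have "Poly_Mapping.single j \<delta> \<in> M" using x by (simp add: M_def)
    then obtain l where l: "l < m" "e l = Poly_Mapping.single j \<delta>"
      using e unfolding bij_betw_def by (metis atLeastLessThan_iff imageE)
    have "v \<noteq> 0\<^sub>v m"
    proof
      assume "v = 0\<^sub>v m"
      then have "v $ l = 0" using l by simp
      then show False using l x by (simp add: v_def)
    qed
    moreover have "map_mat (mpoly_eval a) A *\<^sub>v v = 0\<^sub>v m"
    proof (rule eq_vecI)
      fix k assume k: "k < dim_vec (0\<^sub>v m)"
      have "(map_mat (mpoly_eval a) A *\<^sub>v v) $ k = (\<Sum>l = 0..<m. mpoly_eval a (entry (e k) (e l)) * mon_eval x (e l))"
        using k by (simp add: A_def v_def scalar_prod_def)
      also have "\<dots> = (\<Sum>\<beta>\<in>M. mpoly_eval a (entry (e k) \<beta>) * mon_eval x \<beta>)"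
        by (rule sum.reindex_bij_betw[OF e])
      also have "\<dots> = 0" using row[of "e k" a x] e_M[of k] sel[of "e k"] x(3) k by simp
      finally show "(map_mat (mpoly_eval a) A *\<^sub>v v) $ k = 0\<^sub>v m $ k" using k by simp
    qed (simp add: A_def)
    moreover have "map_mat (mpoly_eval a) A \<in> carrier_mat m m" "v \<in> carrier_vec m"
      by (simp_all add: A_def v_def)
    ultimately have "det (map_mat (mpoly_eval a) A) = 0"
      using det_0_iff_vec_prod_zero_field by blast
    then show "mpoly_eval a (det A) = 0" by (simp add: ev.hom_det)
  qed
  moreover have "invars (coef_vars n d) (det A)"
  proof -
    have "invars (coef_vars n d) (entry (e k) (e l))" if "k < m" "l < m" for k l
      using that sel[OF e_M[OF that(1)]] by (auto simp: entry_def coef_vars_def intro!: invars_mvar)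
    moreover have "invars (coef_vars n d) (signof p :: cpoly)" for p :: "nat \<Rightarrow> nat"
      by (cases p rule: sign_cases) auto
    ultimately show ?thesis unfolding det
      by (intro invars_sum invars_mult invars_prod) (auto simp: permutes_in_image)
  qed
  \<comment> \<open>For the forms \<open>x_i^d\<close>, the product in row \<alpha> is the monomial
    \<alpha> itself, so the matrix becomes the identity.\<close>
  moreover have "mpoly_eval (power_system d) (det A) = 1"
  proof -
    have "mpoly_eval (power_system d) (entry (e k) (e l)) = (if k = l then 1 else 0)" if kl: "k < m" "l < m" for k l
    proof -
      have "\<rho> (e k) + \<gamma> = e k \<longleftrightarrow> \<gamma> = Poly_Mapping.single (sel (e k)) d" for \<gamma>
        using \<rho>[OF e_M[OF kl(1)]] by (metis add_left_cancel)
      moreover have "Poly_Mapping.single (sel (e k)) d \<in> monomials n d"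
        using sel[OF e_M[OF kl(1)]] by simp
      ultimately have eq: "e k = \<rho> (e k) + \<gamma> \<longleftrightarrow> \<gamma> = Poly_Mapping.single (sel (e k)) d"
        and mem: "e k \<in> (\<lambda>\<gamma>. \<rho> (e k) + \<gamma>) ` monomials n d" for \<gamma>
        by (metis, metis image_eqI)
      show ?thesis
      proof (cases "e l \<in> (\<lambda>\<gamma>. \<rho> (e k) + \<gamma>) ` monomials n d")
        case True
        then obtain \<gamma> where \<gamma>: "e l = \<rho> (e k) + \<gamma>" by blast
        have "entry (e k) (e l) = mvar (sel (e k), \<gamma>)" using True by (simp add: entry_def \<gamma>)
        moreover have "k = l \<longleftrightarrow> \<gamma> = Poly_Mapping.single (sel (e k)) d"
          using e_inj[OF kl] eq[of \<gamma>] \<gamma> by simp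
        ultimately show ?thesis by (simp add: power_system_def)
      next
        case False
        then have "k \<noteq> l" using mem by auto
        then show ?thesis using False by (simp add: entry_def)
      qed
    qed
    then have "map_mat (mpoly_eval (power_system d)) A = 1\<^sub>m m"
      by (intro eq_matI) (auto simp: A_def)
    then show ?thesis by (metis det_one ev.hom_det)
  qed
  moreover have "wdeg (block i0) (det A) \<le> d ^ (n - 1)"
  proof -
    have entry: "wdeg (block i0) (entry \<alpha> \<beta>) \<le> (if sel \<alpha> = i0 then 1 else 0)" for \<alpha> \<beta>
      using wdeg_mvar[of "block i0" "(sel \<alpha>, \<beta> - \<rho> \<alpha>)"] by (auto simp: entry_def block_def)
    have "wdeg (block i0) (det A) \<le> (\<Sum>k = 0..<m. if sel (e k) = i0 then 1 else 0)"
      unfolding det by (intro wdeg_sum_le, subst wdeg_signof_mult, intro wdeg_prod_le entry)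
    also have "\<dots> = (\<Sum>\<alpha>\<in>M. if sel \<alpha> = i0 then 1 else 0)"
      by (rule sum.reindex_bij_betw[OF e])
    also have "\<dots> = card {\<alpha> \<in> M. sel \<alpha> = i0}"
      by (simp add: sum.If_cases M_def Int_def)
    \<comment> \<open>In such a row all exponents other than that of \<open>i0\<close> are below
      \<open>d\<close>, and the total degree \<delta> determines the remaining one.\<close>
    also have "\<dots> \<le> card (PiE ({..<n} - {i0}) (\<lambda>_. {..<d}))"
    proof (rule card_inj_on_le)
      let ?f = "\<lambda>\<alpha>. restrict (expo \<alpha>) ({..<n} - {i0})"
      show "?f ` {\<alpha> \<in> M. sel \<alpha> = i0} \<subseteq> PiE ({..<n} - {i0}) (\<lambda>_. {..<d})"
        by (intro image_subsetI, subst restrict_PiE_iff) (use sel_i0 in auto)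
      show "inj_on ?f {\<alpha> \<in> M. sel \<alpha> = i0}"
      proof (rule inj_onI)
        fix \<alpha> \<beta> assume \<alpha>: "\<alpha> \<in> {\<alpha> \<in> M. sel \<alpha> = i0}" and \<beta>: "\<beta> \<in> {\<alpha> \<in> M. sel \<alpha> = i0}" and eq: "?f \<alpha> = ?f \<beta>"
        have other: "expo \<alpha> v = expo \<beta> v" if "v < n" "v \<noteq> i0" for v
          using fun_cong[OF eq, of v] that by simp
        have "\<delta> = expo \<gamma> i0 + (\<Sum>v\<in>{..<n} - {i0}. expo \<gamma> v)" if "\<gamma> \<in> M" for \<gamma>
          using that i0 by (simp add: M_def mem_monomials_iff sum.remove[symmetric])
        from this[of \<alpha>] this[of \<beta>] \<alpha> \<beta>
        have "expo \<alpha> i0 + (\<Sum>v\<in>{..<n} - {i0}. expo \<alpha> v) =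
            expo \<beta> i0 + (\<Sum>v\<in>{..<n} - {i0}. expo \<beta> v)" by simp
        also have "(\<Sum>v\<in>{..<n} - {i0}. expo \<alpha> v) = (\<Sum>v\<in>{..<n} - {i0}. expo \<beta> v)"
          by (intro sum.cong refl other) auto
        finally have "expo \<alpha> i0 = expo \<beta> i0" by simp
        moreover have "expo \<gamma> v = 0" if "\<gamma> \<in> M" "\<not> v < n" for \<gamma> v
          using that lookup_outside[of \<gamma> n v] by (simp add: M_def mem_monomials_iff)
        ultimately show "\<alpha> = \<beta>" using other \<alpha> \<beta> by (intro poly_mapping_eqI) (metis (mono_tags, lifting) mem_Collect_eq)
      qed
      show "finite (PiE ({..<n} - {i0}) (\<lambda>_. {..<d}))" by (intro finite_PiE) auto
    qed
    also have "\<dots> = d ^ (n - 1)" using i0 by (simp add: card_PiE)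
    finally show ?thesis .
  qed
  ultimately show ?thesis by blast
qed


section \<open>Generic number of roots\<close>

lemma resultant_pderiv_eq_0_iff:
  fixes f :: "complex poly"
  assumes "degree f > 0"
  shows "Resultant_Prelim.resultant f (pderiv f) = 0 \<longleftrightarrow> \<not> rsquarefree f"
proof -
  have "Resultant_Prelim.resultant f (pderiv f) = 0 \<longleftrightarrow> degree (gcd f (pderiv f)) \<noteq> 0"
    by (rule div_exp_sound_gcd.resultant_0_gcd[of basic_div_exp]) unfold_locales
  also have "\<dots> \<longleftrightarrow> (\<exists>a. poly f a = 0 \<and> poly (pderiv f) a = 0)"
  proof
    assume "degree (gcd f (pderiv f)) \<noteq> 0"
    then obtain a where "poly (gcd f (pderiv f)) a = 0"
      using fundamental_theorem_of_algebra[of "gcd f (pderiv f)"] by (auto simp: constant_degree)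
    then show "\<exists>a. poly f a = 0 \<and> poly (pderiv f) a = 0"
      by (metis dvd_trans gcd_dvd1 gcd_dvd2 poly_eq_0_iff_dvd)
  next
    assume "\<exists>a. poly f a = 0 \<and> poly (pderiv f) a = 0"
    then obtain a where "[:- a, 1:] dvd gcd f (pderiv f)" by (auto simp: poly_eq_0_iff_dvd)
    moreover have "gcd f (pderiv f) \<noteq> 0" using assms by auto
    ultimately have "degree [:- a, 1:] \<le> degree (gcd f (pderiv f))" by (rule dvd_imp_degree_le)
    then show "degree (gcd f (pderiv f)) \<noteq> 0" by simp
  qed
  also have "\<dots> \<longleftrightarrow> \<not> rsquarefree f" by (simp add: rsquarefree_roots)
  finally show ?thesis .
qed

text \<open>The discriminant times the leading coefficient is a polynomial in \<open>s\<close> which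
  does not vanish at \<open>s1\<close>. Away from its roots the degrees do not drop, so the
  resultant of \<open>q\<close> and its derivative commutes with specialization.\<close>

lemma rsquarefree_generic:
  fixes q :: "complex poly poly"
  defines "ev \<equiv> \<lambda>s. map_poly (\<lambda>p. poly p s) q"
  assumes deg: "\<And>s. degree (ev s) \<le> K" and K: "K > 0"
    and one: "degree (ev s1) = K" "rsquarefree (ev s1)"
  shows "finite {s. \<not> (degree (ev s) = K \<and> rsquarefree (ev s))}"
proof -
  have coeff_ev: "coeff (ev s) k = poly (coeff q k) s" for s k
    by (simp add: ev_def coeff_map_poly)
  have "coeff q k = 0" if "k > K" for k
  proof -
    have "poly (coeff q k) s = 0" for s
      using coeff_eq_0[of "ev s" k] deg[of s] that by (simp add: coeff_ev)
    then show ?thesis using poly_all_0_iff_0 by blast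
  qed
  then have "degree q \<le> K" by (intro degree_le) auto
  have lead1: "poly (coeff q K) s1 \<noteq> 0" using one K by (metis coeff_ev degree_0 leading_coeff_0_iff not_less_zero)
  then have "coeff q K \<noteq> 0" by auto
  then have degq: "degree q = K" using \<open>degree q \<le> K\<close> le_degree by force
  have ev_deg: "degree (ev s) = K" if "poly (coeff q K) s \<noteq> 0" for s
    using le_degree[of "ev s" K] deg[of s] that by (simp add: coeff_ev)
  have pderiv_ev: "pderiv (ev s) = map_poly (\<lambda>p. poly p s) (pderiv q)" for s
    by (rule poly_eqI) (simp add: coeff_pderiv coeff_ev coeff_map_poly)
  define D where "D = Resultant_Prelim.resultant q (pderiv q)"
  have D: "poly D s = Resultant_Prelim.resultant (ev s) (pderiv (ev s))" if "poly (coeff q K) s \<noteq> 0" for s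
  proof -
    have "degree (map_poly (\<lambda>p. poly p s) (pderiv q)) = degree (pderiv q)"
      using ev_deg[OF that] by (simp add: pderiv_ev[symmetric] degree_pderiv degq)
    then show ?thesis
      unfolding D_def pderiv_ev unfolding ev_def
      using comm_ring_hom.resultant_map_poly[OF comm_ring_hom_poly[of s], of q "pderiv q"]
        ev_deg[OF that] degq by (simp add: ev_def)
  qed
  have iff: "poly D s \<noteq> 0 \<longleftrightarrow> rsquarefree (ev s)" if "poly (coeff q K) s \<noteq> 0" for s
    using D[OF that] resultant_pderiv_eq_0_iff[of "ev s"] ev_deg[OF that] K by simp
  have "D \<noteq> 0" using iff[OF lead1] one(2) by auto
  then have "D * coeff q K \<noteq> 0" using \<open>coeff q K \<noteq> 0\<close> by simp
  then have "finite {s. poly (D * coeff q K) s = 0}" by (rule poly_roots_finite)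
  moreover have "{s. \<not> (degree (ev s) = K \<and> rsquarefree (ev s))} \<subseteq> {s. poly (D * coeff q K) s = 0}"
    using ev_deg iff by auto
  ultimately show ?thesis by (rule finite_subset[rotated])
qed


section \<open>Zeros of \<open>n\<close> forms in \<open>n + 1\<close> variables\<close>

definition merge_last :: "nat \<Rightarrow> (nat \<Rightarrow>\<^sub>0 nat) \<Rightarrow> nat \<Rightarrow>\<^sub>0 nat" where
  "merge_last n \<alpha> = \<alpha> + Poly_Mapping.single (n - 1) (expo \<alpha> n)
     - Poly_Mapping.single n (expo \<alpha> n)"

text \<open>
  \<open>hidden n d \<sigma> \<tau> b\<close> are the forms in \<open>n\<close> variables which arise from the forms \<open>b\<close> in \<open>n + 1\<close>
  variables by substituting \<open>\<sigma> y\<close> and \<open>\<tau> y\<close> for the last two variables, where \<open>y\<close> is the last of the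
  \<open>n\<close> variables.
\<close>

definition hidden :: "nat \<Rightarrow> nat \<Rightarrow> 'a \<Rightarrow> 'a \<Rightarrow> (nat \<times> (nat \<Rightarrow>\<^sub>0 nat) \<Rightarrow> 'a::comm_ring_1) \<Rightarrow> nat \<times> (nat \<Rightarrow>\<^sub>0 nat) \<Rightarrow> 'a" where
  "hidden n d \<sigma> \<tau> b = (\<lambda>(i, \<beta>). \<Sum>\<alpha> | \<alpha> \<in> monomials (Suc n) d \<and> merge_last n \<alpha> = \<beta>.
     b (i, \<alpha>) * \<sigma> ^ expo \<alpha> (n - 1) * \<tau> ^ expo \<alpha> n)"

definition unhide :: "nat \<Rightarrow> 'a \<Rightarrow> 'a \<Rightarrow> (nat \<Rightarrow> 'a) \<Rightarrow> nat \<Rightarrow> 'a::comm_ring_1" where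
  "unhide n \<sigma> \<tau> x = (\<lambda>v. if v = n - 1 then \<sigma> * x (n - 1) else if v = n then \<tau> * x (n - 1) else x v)"

lemma lookup_merge_last:
  "n > 0 \<Longrightarrow> expo (merge_last n \<alpha>) v = (if v = n - 1 then expo \<alpha> (n - 1) + expo \<alpha> n
     else if v = n then 0 else expo \<alpha> v)"
  by (auto simp: merge_last_def lookup_add lookup_minus lookup_single when_def)

lemma sum_split_last: "n > 0 \<Longrightarrow> (\<Sum>v<n. f v) = (\<Sum>v<n - 1. f v) + f (n - 1 :: nat)"
  by (cases n) auto

lemma prod_split_last: "n > 0 \<Longrightarrow> (\<Prod>v<n. f v) = (\<Prod>v<n - 1. f v) * f (n - 1 :: nat)"
  by (cases n) auto

lemma merge_last_in_monomials:
  assumes "n > 0" "\<alpha> \<in> monomials (Suc n) d"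
  shows "merge_last n \<alpha> \<in> monomials n d"
  unfolding mem_monomials_iff
proof
  show "Poly_Mapping.keys (merge_last n \<alpha>) \<subseteq> {..<n}"
  proof (intro subsetI, rule ccontr)
    fix v assume v: "v \<in> Poly_Mapping.keys (merge_last n \<alpha>)" "v \<notin> {..<n}"
    then have "v \<noteq> n - 1" "v \<noteq> n" "expo \<alpha> v \<noteq> 0"
      using assms(1) by (auto simp: in_keys_iff lookup_merge_last split: if_splits)
    then show False using v assms(2) lookup_outside[of \<alpha> "Suc n" v] by (simp add: mem_monomials_iff)
  qed
  have "(\<Sum>v<n. expo (merge_last n \<alpha>) v) = (\<Sum>v<n - 1. expo \<alpha> v) + expo \<alpha> (n - 1) + expo \<alpha> n"
    using assms(1) by (auto simp add: sum_split_last lookup_merge_last intro!: sum.cong)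
  also have "\<dots> = (\<Sum>v<Suc n. expo \<alpha> v)"
    using assms(1) by (simp add: sum_split_last)
  finally show "(\<Sum>v<n. expo (merge_last n \<alpha>) v) = d"
    using assms(2) by (simp add: mem_monomials_iff)
qed

lemma mon_eval_unhide:
  assumes n: "n > 0" and \<alpha>: "\<alpha> \<in> monomials (Suc n) d"
  shows "mon_eval (unhide n \<sigma> \<tau> x) \<alpha> = \<sigma> ^ expo \<alpha> (n - 1) * \<tau> ^ expo \<alpha> n * mon_eval x (merge_last n \<alpha>)"
proof -
  have "mon_eval (unhide n \<sigma> \<tau> x) \<alpha> = (\<Prod>v<Suc n. unhide n \<sigma> \<tau> x v ^ expo \<alpha> v)"
    by (rule mon_eval_monomial[OF \<alpha>])
  also have "\<dots> = (\<Prod>v<n - 1. x v ^ expo \<alpha> v) * (\<sigma> * x (n - 1)) ^ expo \<alpha> (n - 1) * (\<tau> * x (n - 1)) ^ expo \<alpha> n"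
  proof -
    have "(\<Prod>v<n - 1. unhide n \<sigma> \<tau> x v ^ expo \<alpha> v) = (\<Prod>v<n - 1. x v ^ expo \<alpha> v)"
      by (rule prod.cong) (auto simp: unhide_def)
    moreover have "(\<Prod>v<Suc n. f v) = (\<Prod>v<n - 1. f v) * f (n - 1) * f n" for f :: "nat \<Rightarrow> 'a"
      using n by (simp add: prod_split_last)
    moreover have "unhide n \<sigma> \<tau> x (n - 1) = \<sigma> * x (n - 1)" "unhide n \<sigma> \<tau> x n = \<tau> * x (n - 1)"
      using n by (auto simp: unhide_def)
    ultimately show ?thesis by (simp only:)
  qed
  also have "\<dots> = \<sigma> ^ expo \<alpha> (n - 1) * \<tau> ^ expo \<alpha> n *
      (\<Prod>v<n. x v ^ expo (merge_last n \<alpha>) v)"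
  proof -
    have "(\<Prod>v<n - 1. x v ^ expo (merge_last n \<alpha>) v) = (\<Prod>v<n - 1. x v ^ expo \<alpha> v)"
      by (rule prod.cong) (auto simp: lookup_merge_last[OF n])
    moreover have "expo (merge_last n \<alpha>) (n - 1) = expo \<alpha> (n - 1) + expo \<alpha> n"
      by (simp add: lookup_merge_last[OF n])
    ultimately show ?thesis
      by (simp only: prod_split_last[OF n] power_mult_distrib power_add mult_ac)
  qed
  also have "(\<Prod>v<n. x v ^ expo (merge_last n \<alpha>) v) = mon_eval x (merge_last n \<alpha>)"
    by (rule mon_eval_monomial[OF merge_last_in_monomials[OF n \<alpha>], symmetric])
  finally show ?thesis .
qed

lemma fval_hidden:
  assumes n: "n > 0"
  shows "fval n d (hidden n d \<sigma> \<tau> b) i x = fval (Suc n) d b i (unhide n \<sigma> \<tau> x)"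
proof -
  have "fval n d (hidden n d \<sigma> \<tau> b) i x = (\<Sum>\<beta>\<in>monomials n d. \<Sum>\<alpha> | \<alpha> \<in> monomials (Suc n) d \<and> merge_last n \<alpha> = \<beta>.
     b (i, \<alpha>) * mon_eval (unhide n \<sigma> \<tau> x) \<alpha>)"
    unfolding fval_def hidden_def
    by (simp add: sum_distrib_right) (intro sum.cong refl, auto simp: mon_eval_unhide[OF n] mult_ac)
  also have "\<dots> = fval (Suc n) d b i (unhide n \<sigma> \<tau> x)"
    unfolding fval_def by (rule sum.group) (use merge_last_in_monomials[OF n] in auto)
  finally show ?thesis .
qed

text \<open>Every monomial that merges into \<beta> contributes degree
  \<open>expo \<beta> (n - 1)\<close> in \<sigma> and \<tau> together. This is where the weights in
  \<open>R_scale\<close> come from.\<close>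

lemma hidden_scale:
  assumes "n > 0"
  shows "hidden n d (t * \<sigma>) (t * \<tau>) b = (\<lambda>(i, \<beta>). t ^ expo \<beta> (n - 1) * hidden n d \<sigma> \<tau> b (i, \<beta>))"
  unfolding hidden_def
  by (auto simp: fun_eq_iff sum_distrib_left lookup_merge_last[OF assms] power_mult_distrib power_add mult_ac intro!: sum.cong)

lemma (in comm_ring_hom) hom_hidden:
  "hom (hidden n d \<sigma> \<tau> b v) = hidden n d (hom \<sigma>) (hom \<tau>) (\<lambda>v. hom (b v)) v"
  by (cases v) (simp add: hidden_def hom_sum hom_mult hom_power)

lemmas poly_hidden = comm_ring_hom.hom_hidden[OF comm_ring_hom_poly]

text \<open>What the induction on the number of variables has to know about the resultant.\<close>

locale lower_resultant =
  fixes n d :: nat and R :: cpoly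
  assumes n: "n > 0" and d: "d > 0" and R_vars: "invars (coef_vars n d) R"
    and R_zero: "mpoly_eval a R = 0 \<longleftrightarrow> common_zero n d a"
    and R_scale: "t \<noteq> 0 \<Longrightarrow> mpoly_eval (\<lambda>(i, \<beta>). t ^ expo \<beta> (n - 1) * a (i, \<beta>)) R = t ^ (d ^ n) * mpoly_eval a R"
begin

text \<open>The binary form in \<sigma> and \<tau>, dehomogenized by \<open>\<tau> = 1\<close>. For
  good systems its roots are the values of \<open>x_{n-1} / x_n\<close> at common zeros.\<close>

definition elim :: "coefs \<Rightarrow> complex poly" where
  "elim b = msubst (\<lambda>c. [:c:]) (hidden n d [:0, 1:] 1 (\<lambda>v. [:b v:])) R"

lemma elim_cong:
  assumes "\<And>j \<alpha>. j < n \<Longrightarrow> b (j, \<alpha>) = b' (j, \<alpha>)"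
  shows "elim b = elim b'"
  unfolding elim_def
proof (rule msubst_cong)
  fix \<alpha> v assume "\<alpha> \<in> Poly_Mapping.keys R" "v \<in> Poly_Mapping.keys \<alpha>"
  then have "v \<in> {..<n} \<times> monomials n d" using R_vars unfolding invars_def coef_vars_def by blast
  then have "fst v < n" by auto
  then show "hidden n d [:0, 1:] 1 (\<lambda>v. [:b v:]) v = hidden n d [:0, 1:] 1 (\<lambda>v. [:b' v:]) v"
    by (cases v) (simp add: hidden_def assms)
qed

lemma poly_elim: "poly (elim b) s = mpoly_eval (hidden n d s 1 b) R"
  by (simp add: elim_def poly_msubst poly_hidden)

lemma hom_eval: "t \<noteq> 0 \<Longrightarrow> mpoly_eval (hidden n d (t * \<sigma>) (t * \<tau>) b) R = t ^ (d ^ n) * mpoly_eval (hidden n d \<sigma> \<tau> b) R"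
  unfolding hidden_scale[OF n] by (rule R_scale)

text \<open>With \<sigma> set to 1 instead one obtains \<open>g\<close>, and homogeneity gives
  \<open>elim b (s) = s^K g(1/s)\<close>. Thus \<open>elim b\<close> is \<open>g\<close> reversed up
  to a power of the variable, and degrees can be compared.\<close>

lemma degree_elim: "degree (elim b) \<le> d ^ n"
proof (cases "elim b = 0")
  case False
  define g where "g = msubst (\<lambda>c. [:c:]) (hidden n d 1 [:0, 1:] (\<lambda>v. [:b v:])) R"
  have g: "poly g s = mpoly_eval (hidden n d 1 s b) R" for s
    by (simp add: g_def poly_msubst poly_hidden)
  define K where "K = d ^ n"
  have "poly (elim b * monom 1 (degree g) - monom 1 K * reflect_poly g) s = 0" if "s \<noteq> 0" for s
  proof -
    have "poly (elim b) s = s ^ K * poly g (inverse s)"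
      using hom_eval[OF that, of 1 "inverse s" b] that by (simp add: poly_elim g K_def)
    then show ?thesis
      using that by (simp add: poly_reflect_poly_nz poly_monom mult_ac)
  qed
  then have "elim b * monom 1 (degree g) - monom 1 K * reflect_poly g = 0"
    by (intro poly_eq_0_of_roots[where S = "of_nat ` {1..degree (elim b * monom 1 (degree g) - monom 1 K * reflect_poly g) + 1}"])
      (auto simp: card_image inj_on_def)
  then have eq: "elim b * monom 1 (degree g) = monom 1 K * reflect_poly g" by simp
  have "reflect_poly g \<noteq> 0" using eq False by (auto simp: monom_eq_0_iff)
  have "degree (elim b) + degree g = K + degree (reflect_poly g)"
    using arg_cong[OF eq, of degree] False \<open>reflect_poly g \<noteq> 0\<close>
    by (simp add: degree_mult_eq monom_eq_0_iff degree_monom_eq)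
  also have "\<dots> \<le> K + degree g" using degree_reflect_poly_le[of g] by simp
  finally show ?thesis by (simp add: K_def)
qed simp

text \<open>By \<open>good_points\<close> each of the \<open>d ^ n\<close> simple roots is the
  coordinate \<open>x_{n-1}\<close> of a common zero with \<open>x_n = 1\<close>, so the zeros are
  told apart by this coordinate.\<close>

definition good :: "coefs \<Rightarrow> bool" where
  "good b \<longleftrightarrow> degree (elim b) = d ^ n \<and> rsquarefree (elim b)"

lemma good_iff_card: "good b \<longleftrightarrow> elim b \<noteq> 0 \<and> card {s. poly (elim b) s = 0} = d ^ n"
proof -
  have K: "d ^ n > 0" using d by simp
  have "good b" if "elim b \<noteq> 0" "card {s. poly (elim b) s = 0} = d ^ n"
    using that rsquarefree_card_degree[of "elim b"] degree_elim[of b] card_poly_roots_bound[of "elim b"]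
    by (auto simp: good_def)
  moreover have "elim b \<noteq> 0 \<and> card {s. poly (elim b) s = 0} = d ^ n" if "good b"
  proof -
    have "elim b \<noteq> 0" using that K by (auto simp: good_def)
    then show ?thesis using that rsquarefree_card_degree[of "elim b"] by (simp add: good_def)
  qed
  ultimately show ?thesis by blast
qed

text \<open>Along a line \<open>elim\<close> is the specialization of one polynomial with
  coefficients in the parameter, so the discriminant argument applies. A single good system then
  provides good ones on every line through it.\<close>

lemma good_generic:
  assumes "good c"
  shows "finite {s. \<not> good (\<lambda>v. b v + s * (c v - b v))}"
proof -
  define q where "q = msubst (\<lambda>c. [:[:c:]:]) (hidden n d [:0, 1:] 1 (\<lambda>v. [:[:b v, c v - b v:]:])) R"
  have hom: "comm_ring_hom (map_poly (\<lambda>p :: complex poly. poly p s))" for s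
  proof -
    interpret comm_ring_hom "\<lambda>p. poly p s" by (rule comm_ring_hom_poly)
    interpret map_poly_comm_ring_hom "\<lambda>p. poly p s" ..
    show ?thesis by unfold_locales
  qed
  have mp: "map_poly (\<lambda>p. poly p s) (pCons a p) = pCons (poly a s) (map_poly (\<lambda>p. poly p s) p)" for a s and p :: "complex poly poly"
    by (rule poly_eqI) (simp add: coeff_map_poly coeff_pCons split: nat.splits)
  have ev: "map_poly (\<lambda>p. poly p s) q = elim (\<lambda>v. b v + s * (c v - b v))" for s
    unfolding q_def elim_def comm_ring_hom.hom_msubst[OF hom]
    by (intro arg_cong2[of _ _ _ _ "\<lambda>h x. msubst h x R"] ext)
      (simp_all add: comm_ring_hom.hom_hidden[OF hom] mp del: pCons_one)
  have "finite {s. \<not> (degree (map_poly (\<lambda>p. poly p s) q) = d ^ n \<and> rsquarefree (map_poly (\<lambda>p. poly p s) q))}"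
    by (rule rsquarefree_generic[where ?s1.0 = 1])
      (use assms d in \<open>auto simp: ev degree_elim good_def\<close>)
  then show ?thesis by (simp add: ev good_def)
qed

lemma good_points:
  assumes "good b" "poly (elim b) s = 0"
  shows "\<exists>x. x n = 1 \<and> x (n - 1) = s \<and> (\<forall>i<n. fval (Suc n) d b i x = 0)"
proof -
  obtain x where x: "\<exists>j<n. x j \<noteq> 0" "\<And>i. i < n \<Longrightarrow> fval n d (hidden n d s 1 b) i x = 0"
    using assms(2) by (auto simp: poly_elim R_zero common_zero_def)
  \<comment> \<open>Otherwise both hidden coordinates are 0 whatever \<open>s\<close> is, and every
    number would be a root of \<open>elim b\<close>.\<close>
  have "x (n - 1) \<noteq> 0"
  proof
    assume "x (n - 1) = 0"
    then have uh: "unhide n s' 1 x = unhide n s 1 x" for s' by (auto simp: unhide_def)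
    have "fval n d (hidden n d s' 1 b) i x = fval n d (hidden n d s 1 b) i x" for s' i
      by (simp only: fval_hidden[OF n] uh[of s'])
    then have "common_zero n d (hidden n d s' 1 b)" for s'
      unfolding common_zero_def using x(1)
      by (intro exI[of _ x] conjI allI impI x(1)) (simp only: x(2) \<open>\<And>s' i. fval n d (hidden n d s' 1 b) i x = _\<close>[of s'])
    then have "poly (elim b) s' = 0" for s' by (simp add: poly_elim R_zero)
    then have "elim b = 0" using poly_all_0_iff_0 by blast
    then show False using assms(1) by (simp add: good_iff_card)
  qed
  then show ?thesis
    using x(2) n
    by (intro exI[of _ "\<lambda>v. inverse (x (n - 1)) * unhide n s 1 x v"])
      (auto simp: fval_hidden[OF n] fval_scale, auto simp: unhide_def)
qed

text \<open>
  The common zeros of these forms with \<open>x\<^sub>n = 1\<close> are parametrized by the roots of unity of order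
  \<open>d ^ n\<close>: each coordinate is the \<open>d\<close>-th power of the next one, and \<open>x\<^sub>0\<^sup>d = 1\<close>.
\<close>

definition chain :: "nat \<Rightarrow> (nat, complex) mpoly" where
  "chain i = (if i < n - 1
     then Poly_Mapping.single (Poly_Mapping.single (Suc i) d) 1
       - Poly_Mapping.single (Poly_Mapping.single i 1 + Poly_Mapping.single n (d - 1)) 1
     else Poly_Mapping.single (Poly_Mapping.single 0 d) 1 - Poly_Mapping.single (Poly_Mapping.single n d) 1)"

lemma fval_chain:
  assumes "i < n"
  shows "fval (Suc n) d (coeffs_of chain) i x =
    (if i < n - 1 then x (Suc i) ^ d - x i * x n ^ (d - 1) else x 0 ^ d - x n ^ d)"
proof -
  have in_mon: "Poly_Mapping.single i 1 + Poly_Mapping.single n (d - 1) \<in> monomials (Suc n) d"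
    using assms d by (simp add: linear_times_power_in_monomials del: One_nat_def)
  have keys: "Poly_Mapping.keys (chain i) \<subseteq> monomials (Suc n) d"
  proof -
    have *: "Poly_Mapping.keys (Poly_Mapping.single \<alpha> 1 - Poly_Mapping.single \<beta> (1::complex)) \<subseteq> {\<alpha>, \<beta>}" for \<alpha> \<beta> :: "nat \<Rightarrow>\<^sub>0 nat"
      by (auto simp: in_keys_iff lookup_minus lookup_single when_def split: if_splits)
    show ?thesis
    proof (cases "i < n - 1")
      case True
      then show ?thesis
        unfolding chain_def if_P[OF True] using in_mon single_in_monomials[of "Suc i" "Suc n" d]
        by (intro order.trans[OF *]) auto
    next
      case False
      then show ?thesis
        unfolding chain_def if_not_P[OF False] by (intro order.trans[OF *]) auto
    qed
  qed
  have "fval (Suc n) d (coeffs_of chain) i x = mpoly_eval x (chain i)"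
    unfolding fval_def coeffs_of_def by (simp add: mpoly_eval_superset[OF _ keys])
  then show ?thesis
    by (simp add: chain_def ev.hom_minus mpoly_eval_single mon_eval_add del: One_nat_def)
qed

lemma poly_elim_chain: "poly (elim (coeffs_of chain)) s = 0 \<longleftrightarrow> s ^ (d ^ n) = 1"
proof
  assume "poly (elim (coeffs_of chain)) s = 0"
  then obtain x where x: "\<exists>j<n. x j \<noteq> 0" "\<And>i. i < n \<Longrightarrow> fval n d (hidden n d s 1 (coeffs_of chain)) i x = 0"
    by (auto simp: poly_elim R_zero common_zero_def)
  define X where "X = unhide n s 1 x"
  have step: "X (Suc i) ^ d = X i * X n ^ (d - 1)" if "i < n - 1" for i
    using x(2)[of i] that by (simp add: fval_hidden[OF n] fval_chain X_def)
  have last: "X 0 ^ d = X n ^ d"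
    using x(2)[of "n - 1"] n by (simp add: fval_hidden[OF n] fval_chain X_def)
  have Xn: "X n = x (n - 1)" "X (n - 1) = s * x (n - 1)" using n by (auto simp: X_def unhide_def)
  \<comment> \<open>With \<open>x_n = 0\<close> the last equation gives \<open>x_0 = 0\<close>, and
    the others then annihilate one coordinate after the next.\<close>
  have "X n \<noteq> 0"
  proof
    assume Xn0: "X n = 0"
    have X0: "X v = 0" if "v < n" for v
      using that
    proof (induction v)
      case 0
      have "X 0 ^ d = 0" using last d Xn0 by (simp add: power_0_left)
      then show ?case by simp
    next
      case (Suc v)
      then have "X v = 0" "v < n - 1" by auto
      then show ?case using step[of v] d by simp
    qed
    have "x v = 0" if "v < n" for v
      using X0[OF that] Xn0 that Xn n by (cases "v = n - 1") (auto simp: X_def unhide_def)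
    then show False using x(1) by auto
  qed
  define Q where "Q v = X v / X n" for v
  have Q: "Q (n - 1 - k) = s ^ (d ^ k)" if "k < n" for k
    using that
  proof (induction k)
    case 0
    then show ?case using Xn \<open>X n \<noteq> 0\<close> by (simp add: Q_def)
  next
    case (Suc k)
    define i where "i = n - 1 - Suc k"
    have i: "i < n - 1" "n - 1 - k = Suc i" using Suc.prems by (auto simp: i_def)
    have "X n ^ d = X n * X n ^ (d - 1)" using d by (cases d) auto
    then have "Q i = Q (Suc i) ^ d"
      using step[OF i(1)] \<open>X n \<noteq> 0\<close> by (simp add: Q_def power_divide field_simps)
    then have "Q i = s ^ (d ^ Suc k)" using Suc i by (simp add: power_mult[symmetric] mult.commute)
    then show ?case by (simp only: i_def)
  qed
  have "Q 0 ^ d = 1" using last \<open>X n \<noteq> 0\<close> by (simp add: Q_def power_divide)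
  then have "(s ^ (d ^ (n - 1))) ^ d = 1" using Q[of "n - 1"] n by simp
  then show "s ^ (d ^ n) = 1" using n by (cases n) (simp_all add: power_mult[symmetric] mult.commute)
next
  assume s: "s ^ (d ^ n) = 1"
  \<comment> \<open>In the witness below, entry \<open>n - 1\<close> is reset to 1 because it plays
    the role of \<open>y\<close>; \<open>unhide\<close> turns it into \<open>x_{n-1} = s\<close> and
    \<open>x_n = 1\<close>.\<close>
  define x where "x v = s ^ (d ^ (n - 1 - v))" for v
  have X: "unhide n s 1 (x(n - 1 := 1)) v = (if v = n then 1 else x v)" for v
    using n by (auto simp: unhide_def x_def)
  have "fval n d (hidden n d s 1 (coeffs_of chain)) i (x(n - 1 := 1)) = 0" if "i < n" for i
  proof (cases "i < n - 1")
    case True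
    then have "n - 1 - i = Suc (n - 1 - Suc i)" by auto
    then have "x (Suc i) ^ d = x i" by (simp only: x_def power_Suc2 power_mult)
    moreover have "i \<noteq> n" "Suc i \<noteq> n" using True by auto
    ultimately show ?thesis
      using True X[of i] X[of "Suc i"] X[of n] by (simp add: fval_hidden[OF n] fval_chain)
  next
    case False
    have "x 0 ^ d = s ^ (d ^ n)" using n by (cases n) (simp_all add: x_def power_mult[symmetric] mult.commute)
    then show ?thesis
      using False that s n X[of 0] X[of n] by (simp add: fval_hidden[OF n] fval_chain)
  qed
  then have "common_zero n d (hidden n d s 1 (coeffs_of chain))"
    unfolding common_zero_def using n by (intro exI[of _ "x(n - 1 := 1)"]) auto
  then show "poly (elim (coeffs_of chain)) s = 0" by (simp add: poly_elim R_zero)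
qed

lemma good_chain: "good (coeffs_of chain)"
proof -
  have "poly (elim (coeffs_of chain)) 0 \<noteq> 0" using d by (simp add: poly_elim_chain power_0_left)
  then have "elim (coeffs_of chain) \<noteq> 0" by auto
  then show ?thesis using d by (simp add: good_iff_card poly_elim_chain card_roots_unity_eq)
qed

lemma good_cong: "(\<And>j \<alpha>. j < n \<Longrightarrow> b (j, \<alpha>) = b' (j, \<alpha>)) \<Longrightarrow> good b \<longleftrightarrow> good b'"
  unfolding good_def using elim_cong[of b b'] by simp

end


section \<open>The ideal of systems with a common zero\<close>

lemma zero_ideal_mult: "p \<in> zero_ideal n d \<Longrightarrow> q * p \<in> zero_ideal n d"
  by (simp add: zero_ideal_def ev.hom_mult)

lemma zero_ideal_diff: "p \<in> zero_ideal n d \<Longrightarrow> q \<in> zero_ideal n d \<Longrightarrow> p - q \<in> zero_ideal n d"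
  by (simp add: zero_ideal_def ev.hom_minus)

lemma common_zero_0: "n > 0 \<Longrightarrow> common_zero n d (\<lambda>_. 0)"
  unfolding common_zero_def by (intro exI[of _ "\<lambda>_. 1"]) (auto simp: fval_def)

lemma zero_ideal_not_unit:
  assumes "n > 0" "p \<in> zero_ideal n d"
  shows "\<not> p dvd 1"
proof
  assume "p dvd 1"
  then obtain q where "p * q = 1" by (metis dvd_def)
  then have "mpoly_eval (\<lambda>_. 0) p * mpoly_eval (\<lambda>_. 0) q = 1" by (metis ev.hom_mult ev.hom_one)
  moreover have "mpoly_eval (\<lambda>_. 0) p = 0" using assms common_zero_0 unfolding zero_ideal_def by blast
  ultimately show False by simp
qed

lemma zero_ideal_irreducible_factor:
  assumes "n > 0" "d > 0" "p \<in> zero_ideal n d" "p \<noteq> 0"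
  shows "\<exists>f. irreducible f \<and> f \<in> zero_ideal n d \<and> f dvd p"
  using assms(3,4)
proof (induction "wdeg (\<lambda>_. 1) p" arbitrary: p rule: less_induct)
  case less
  obtain f g where fg: "irreducible f" "p = f * g" "g \<noteq> 0" "wdeg (\<lambda>_. 1) g < wdeg (\<lambda>_. 1) p"
    using irreducible_factor_exists[OF less.prems(2) zero_ideal_not_unit[OF assms(1) less.prems(1)]] by blast
  have "f * g \<in> zero_ideal n d" using less.prems(1) fg(2) by simp
  from zero_ideal_prime[OF this assms(2)] show ?case
  proof
    assume "f \<in> zero_ideal n d"
    then show ?thesis using fg by auto
  next
    assume "g \<in> zero_ideal n d"
    then obtain h where "irreducible h" "h \<in> zero_ideal n d" "h dvd g" using less.hyps fg by blast
    then show ?thesis using fg(2) by auto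
  qed
qed

lemma wdeg_dvd_le:
  fixes p q :: "('v::linorder, 'a::idom) mpoly"
  assumes "p dvd q" "q \<noteq> 0"
  shows "wdeg w p \<le> wdeg w q"
proof -
  obtain r where r: "q = p * r" using assms(1) by (auto simp: dvd_def)
  then have "p \<noteq> 0" "r \<noteq> 0" using assms(2) by auto
  then show ?thesis unfolding r by (simp add: wdeg_mult)
qed

lemma vdeg_le_wdeg:
  fixes p :: "('v, 'a::comm_ring_1) mpoly"
  assumes "w y = 1"
  shows "vdeg y p \<le> wdeg w p"
proof -
  show ?thesis
    unfolding unipoly_def
    by (rule degree_msubst_le) (use assms in auto)
qed

lemma wdeg_msubst_le:
  fixes p :: "('v, 'a::comm_ring_1) mpoly" and y :: "'v \<Rightarrow> ('u, 'a) mpoly"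
  assumes "\<And>v. wdeg w (y v) \<le> 1"
  shows "wdeg w (msubst mconst y p) \<le> wdeg (\<lambda>_. 1) p"
  unfolding msubst_def
proof (rule wdeg_sum_le)
  fix \<alpha> assume \<alpha>: "\<alpha> \<in> Poly_Mapping.keys p"
  have pow: "wdeg w (y v ^ k) \<le> k" for v k
  proof (induction k)
    case (Suc k)
    have "wdeg w (y v * y v ^ k) \<le> wdeg w (y v) + wdeg w (y v ^ k)" by (rule wdeg_mult_le)
    also have "\<dots> \<le> 1 + k" using Suc assms by (intro add_mono) auto
    finally show ?case by simp
  qed (simp add: wdeg_def)
  have "wdeg w (mconst (mcoeff p \<alpha>) * mon_eval y \<alpha>) \<le> wdeg w (mconst (mcoeff p \<alpha>) :: ('u, 'a) mpoly) + wdeg w (mon_eval y \<alpha>)"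
    by (rule wdeg_mult_le)
  also have "wdeg w (mconst (mcoeff p \<alpha>) :: ('u, 'a) mpoly) = 0"
    using wdeg_le_iff[of w "mconst (mcoeff p \<alpha>) :: ('u, 'a) mpoly" 0] by (simp add: mconst_def wt_def)
  also have "wdeg w (mon_eval y \<alpha>) \<le> wt (\<lambda>_. 1) \<alpha>"
    unfolding mon_eval_def wt_def by (intro wdeg_prod_le) (simp add: pow)
  also have "\<dots> \<le> wdeg (\<lambda>_. 1) p" using \<alpha> wdeg_le_iff[of "\<lambda>_. 1" p] by blast
  finally show "wdeg w (mconst (mcoeff p \<alpha>) * mon_eval y \<alpha>) \<le> wdeg (\<lambda>_. 1) p" by simp
qed

lemma fval_update:
  fixes a :: "nat \<times> (nat \<Rightarrow>\<^sub>0 nat) \<Rightarrow> 'a::comm_ring_1"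
  assumes "\<beta> \<in> monomials n d"
  shows "fval n d (a((i, \<beta>) := t)) i x = fval n d a i x + (t - a (i, \<beta>)) * mon_eval x \<beta>"
proof -
  have "fval n d (a((i, \<beta>) := t)) i x = (\<Sum>\<alpha>\<in>monomials n d. a (i, \<alpha>) * mon_eval x \<alpha> +
      (if \<alpha> = \<beta> then (t - a (i, \<beta>)) * mon_eval x \<beta> else 0))"
    unfolding fval_def by (intro sum.cong refl) (auto simp: algebra_simps)
  then show ?thesis using assms by (simp add: sum.distrib fval_def algebra_simps)
qed

lemma fval_update_other: "i \<noteq> j \<Longrightarrow> fval n d (a((j, \<beta>) := t)) i x = fval n d a i x"
  by (simp add: fval_def)

lemma fval_line:
  "fval n d (\<lambda>v. a v + s * b v) i x = fval n d a i x + s * fval n d b i x"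
  by (simp add: fval_def sum.distrib sum_distrib_left algebra_simps)

lemma infinite_complex_avoid: "finite A \<Longrightarrow> \<exists>s::complex. s \<notin> A"
  using infinite_UNIV_char_0 by (metis UNIV_eq_I)

lemma finite_eval_line_zero:
  fixes p :: "('v, complex) mpoly"
  assumes "mpoly_eval (\<lambda>v. a v + s0 * b v) p \<noteq> 0"
  shows "finite {s. mpoly_eval (\<lambda>v. a v + s * b v) p = 0}"
proof -
  define q where "q = msubst (\<lambda>c. [:c:]) (\<lambda>v. [:a v, b v:]) p"
  have q: "poly q s = mpoly_eval (\<lambda>v. a v + s * b v) p" for s
    by (simp add: q_def poly_msubst)
  then have "q \<noteq> 0" using assms by auto
  from poly_roots_finite[OF this] show ?thesis by (simp add: q)
qed

text \<open>Form \<open>n\<close> takes the place of form \<open>i\<close>, so that all forms except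
  the \<open>i\<close>-th are indexed by the numbers below \<open>n\<close>, as the statements about
  \<open>n\<close> forms require.\<close>

definition omit :: "nat \<Rightarrow> nat \<Rightarrow> coefs \<Rightarrow> coefs" where
  "omit n i a = (\<lambda>(j, \<alpha>). a (if j = i then n else j, \<alpha>))"

lemma fval_omit: "fval m d (omit n i a) j x = fval m d a (if j = i then n else j) x"
  by (simp add: fval_def omit_def)

context lower_resultant
begin

lemma good_omit_points:
  assumes "good (omit n i a)" "i \<le> n"
  obtains S pt where "finite S" "card S = d ^ n"
    "\<And>s. s \<in> S \<Longrightarrow> pt s n = 1" "\<And>s. s \<in> S \<Longrightarrow> pt s (n - 1) = (s :: complex)"
    "\<And>s j. s \<in> S \<Longrightarrow> j \<le> n \<Longrightarrow> j \<noteq> i \<Longrightarrow> fval (Suc n) d a j (pt s) = 0"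
proof -
  define S where "S = {s. poly (elim (omit n i a)) s = 0}"
  have S: "card S = d ^ n" "finite S"
    using assms(1) poly_roots_finite by (auto simp: good_iff_card S_def)
  have "\<forall>s\<in>S. \<exists>x. x n = 1 \<and> x (n - 1) = s \<and> (\<forall>j<n. fval (Suc n) d (omit n i a) j x = 0)"
    using good_points[OF assms(1)] by (simp add: S_def)
  then obtain pt where pt: "\<And>s. s \<in> S \<Longrightarrow> pt s n = 1 \<and> pt s (n - 1) = s \<and> (\<forall>j<n. fval (Suc n) d (omit n i a) j (pt s) = 0)"
    by metis
  have "fval (Suc n) d a j (pt s) = 0" if s: "s \<in> S" and j: "j \<le> n" "j \<noteq> i" for s j
  proof (cases "j = n")
    case True
    then have "i < n" using j assms(2) by auto
    then have "fval (Suc n) d (omit n i a) i (pt s) = 0" using pt[OF s] by blast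
    then show ?thesis using True by (simp add: fval_omit)
  next
    case False
    then have "fval (Suc n) d (omit n i a) j (pt s) = 0" using pt[OF s] j by auto
    then show ?thesis using j by (simp add: fval_omit)
  qed
  then show thesis using that[of S pt] S pt by blast
qed

lemma good_omit_n: "good (omit n n a) \<longleftrightarrow> good a"
  by (rule good_cong) (auto simp: omit_def)

section \<open>Degrees in one coefficient, and the generator of the ideal\<close>

abbreviation top_var :: "nat \<times> (nat \<Rightarrow>\<^sub>0 nat)" where
  "top_var \<equiv> (n, Poly_Mapping.single n d)"

text \<open>
  For generic coefficients there are \<open>d ^ n\<close> values of the variable \<open>top_var\<close> for which the
  system has a common zero.
\<close>

lemma zero_ideal_vdeg_small:
  assumes r: "r \<in> zero_ideal (Suc n) d" and small: "vdeg top_var r < d ^ n"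
  shows "r = 0"
proof (rule mpoly_eq_0I, rule ccontr)
  fix a assume a: "mpoly_eval a r \<noteq> 0"
  define c where "c = coeffs_of chain"
  have "finite {s. \<not> good (\<lambda>v. a v + s * (c v - a v))}"
    unfolding c_def by (rule good_generic[OF good_chain])
  moreover have "finite {s. mpoly_eval (\<lambda>v. a v + s * (c v - a v)) r = 0}"
    by (rule finite_eval_line_zero[of _ 0]) (use a in simp)
  ultimately obtain s0 where s0: "good (\<lambda>v. a v + s0 * (c v - a v))" "mpoly_eval (\<lambda>v. a v + s0 * (c v - a v)) r \<noteq> 0"
    using infinite_complex_avoid[of "{s. \<not> good (\<lambda>v. a v + s * (c v - a v))} \<union> {s. mpoly_eval (\<lambda>v. a v + s * (c v - a v)) r = 0}"]
    by blast
  define a1 where "a1 = (\<lambda>v. a v + s0 * (c v - a v))"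
  have "good (omit n n a1)" using s0 by (simp add: good_omit_n a1_def)
  then obtain S pt where S: "finite S" "card S = d ^ n" and pt: "\<And>s. s \<in> S \<Longrightarrow> pt s n = 1"
    "\<And>s. s \<in> S \<Longrightarrow> pt s (n - 1) = s" "\<And>s j. s \<in> S \<Longrightarrow> j \<le> n \<Longrightarrow> j \<noteq> n \<Longrightarrow> fval (Suc n) d a1 j (pt s) = 0"
    using good_omit_points[of n a1] by blast
  \<comment> \<open>Adding \<open>t\<close> to this coefficient of the last form adds
    \<open>t * s\<close> to its value at \<open>pt s\<close>. As the points have different
    \<open>s\<close>, a generic \<open>t\<close> makes the values of the last form at them
    distinct.\<close>
  define \<beta> where "\<beta> = Poly_Mapping.single (n - 1) 1 + Poly_Mapping.single n (d - 1)"
  have \<beta>_in: "\<beta> \<in> monomials (Suc n) d"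
    using d by (simp add: \<beta>_def linear_times_power_in_monomials del: One_nat_def)
  have \<beta>_eval: "mon_eval (pt s) \<beta> = s" if "s \<in> S" for s
    using pt(1,2)[OF that] by (simp add: \<beta>_def mon_eval_add)
  define G where "G s = fval (Suc n) d a1 n (pt s)" for s
  define E where "E v = (if v = (n, \<beta>) then 1 else 0 :: complex)" for v
  define a2 where "a2 t = (\<lambda>v. a1 v + t * E v)" for t
  have a2: "a2 t = a1((n, \<beta>) := a1 (n, \<beta>) + t)" for t
    by (auto simp: a2_def E_def)
  have "finite {t. mpoly_eval (a2 t) r = 0}"
    unfolding a2_def by (rule finite_eval_line_zero[of _ 0]) (use s0 in \<open>simp add: a1_def\<close>)
  moreover have "finite (\<Union>(s, s') \<in> {(s, s'). s \<in> S \<and> s' \<in> S \<and> s \<noteq> s'}. {(G s' - G s) / (s - s')})"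
  proof (rule finite_UN_I)
    show "finite {(s, s'). s \<in> S \<and> s' \<in> S \<and> s \<noteq> s'}"
      by (rule finite_subset[OF _ finite_cartesian_product[OF S(1) S(1)]]) auto
  qed auto
  ultimately obtain t where t: "mpoly_eval (a2 t) r \<noteq> 0"
    "\<And>s s'. s \<in> S \<Longrightarrow> s' \<in> S \<Longrightarrow> s \<noteq> s' \<Longrightarrow> t \<noteq> (G s' - G s) / (s - s')"
    using infinite_complex_avoid[of "{t. mpoly_eval (a2 t) r = 0} \<union> (\<Union>(s, s') \<in> {(s, s'). s \<in> S \<and> s' \<in> S \<and> s \<noteq> s'}. {(G s' - G s) / (s - s')})"]
    by blast
  have distinct: "G s + t * s \<noteq> G s' + t * s'" if "s \<in> S" "s' \<in> S" "s \<noteq> s'" for s s'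
    using t(2)[OF that] that(3) by (auto simp: field_simps)
  define \<rho> where "\<rho> = map_poly (mpoly_eval (a2 t)) (unipoly top_var r)"
  \<comment> \<open>Since \<open>x_n = 1\<close> at \<open>pt s\<close>, this is the value of the
    coefficient of \<open>x_n^d\<close> for which the last form vanishes there.\<close>
  define root where "root s = a2 t top_var - (G s + t * s)" for s
  have "\<rho> = 0"
  proof (rule poly_eq_0_of_roots[where S = "root ` S"])
    have "inj_on root S"
    proof (rule inj_onI, rule ccontr)
      fix s s' assume s: "s \<in> S" "s' \<in> S" "root s = root s'" "s \<noteq> s'"
      then have "G s + t * s = G s' + t * s'" unfolding root_def by (metis diff_diff_eq2 add_diff_cancel_left')
      then show False using distinct s by blast
    qed
    then have "card (root ` S) = d ^ n"
      using S(2) by (simp add: card_image)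
    then show "degree \<rho> < card (root ` S)"
      using small degree_map_poly_le[of "mpoly_eval (a2 t)" "unipoly top_var r"] by (simp add: \<rho>_def)
    fix z assume "z \<in> root ` S"
    then obtain s where s: "s \<in> S" "z = root s" by blast
    have "common_zero (Suc n) d ((a2 t)(top_var := root s))"
      unfolding common_zero_def
    proof (intro exI[of _ "pt s"] conjI allI impI)
      show "\<exists>j<Suc n. pt s j \<noteq> 0" using pt(1)[OF s(1)] by (intro exI[of _ n]) auto
      fix j assume j: "j < Suc n"
      show "fval (Suc n) d ((a2 t)(top_var := root s)) j (pt s) = 0"
      proof (cases "j = n")
        case True
        then show ?thesis
          by (simp add: fval_update \<beta>_in pt(1)[OF s(1)] root_def)
            (simp add: a2 fval_update \<beta>_in \<beta>_eval[OF s(1)] G_def)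
      next
        case False
        then show ?thesis using pt(3)[OF s(1), of j] j by (simp add: fval_update_other a2)
      qed
    qed
    then show "poly \<rho> z = 0"
      using r unfolding \<rho>_def s(2) poly_coeff_map_eval zero_ideal_def by blast
  qed
  then have "poly \<rho> (a2 t top_var) = 0" by simp
  then show False using t(1) by (simp add: \<rho>_def poly_coeff_map_eval)
qed

text \<open>The bound in the last block, against the lower bound
  \<open>zero_ideal_vdeg_small\<close>, fixes the degree in \<open>top_var\<close>. By
  \<open>gen_dvd\<close> the choice is unique up to a unit.\<close>

definition gen :: cpoly where
  "gen = (SOME f. irreducible f \<and> f \<in> zero_ideal (Suc n) d \<and> invars (coef_vars (Suc n) d) f
     \<and> wdeg (block n) f \<le> d ^ n)"

lemma gen: "irreducible gen" "gen \<in> zero_ideal (Suc n) d" "invars (coef_vars (Suc n) d) gen"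
  "wdeg (block n) gen \<le> d ^ n"
proof -
  obtain D where D: "D \<in> zero_ideal (Suc n) d" "invars (coef_vars (Suc n) d) D"
    "mpoly_eval (power_system d) D = 1" "wdeg (block n) D \<le> d ^ n"
    using macaulay_determinant[OF d, of n "Suc n"] by auto
  have D0: "D \<noteq> 0" using D(3) by auto
  then obtain f where f: "irreducible f" "f \<in> zero_ideal (Suc n) d" "f dvd D"
    using zero_ideal_irreducible_factor[OF _ d D(1)] by auto
  then obtain g where g: "D = f * g" by (auto simp: dvd_def)
  then have "f \<noteq> 0" "g \<noteq> 0" using D0 by auto
  then have "invars (coef_vars (Suc n) d) f" using D(2) g invars_multD(1) by metis
  moreover have "wdeg (block n) f \<le> d ^ n" using wdeg_dvd_le[OF f(3) D0, of "block n"] D(4) by simp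
  ultimately have "\<exists>f. irreducible f \<and> f \<in> zero_ideal (Suc n) d \<and> invars (coef_vars (Suc n) d) f
     \<and> wdeg (block n) f \<le> d ^ n" using f by blast
  from someI_ex[OF this] show "irreducible gen" "gen \<in> zero_ideal (Suc n) d" "invars (coef_vars (Suc n) d) gen"
    "wdeg (block n) gen \<le> d ^ n" by (simp_all add: gen_def)
qed

lemma gen_nonzero: "gen \<noteq> 0"
  using gen(1) by auto

lemma vdeg_gen: "vdeg top_var gen = d ^ n"
proof (rule antisym)
  have "vdeg top_var gen \<le> wdeg (block n) gen" by (rule vdeg_le_wdeg) (simp add: block_def)
  then show "vdeg top_var gen \<le> d ^ n" using gen(4) by linarith
  show "d ^ n \<le> vdeg top_var gen" using zero_ideal_vdeg_small[OF gen(2)] gen_nonzero not_less by blast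
qed

text \<open>The remainder of a pseudo-division by \<open>gen\<close> stays in the ideal, and its
  degree in \<open>top_var\<close> is too small unless it is 0. The power of the leading coefficient
  is then cancelled by primality: \<open>gen\<close> does not divide a nonzero polynomial free of
  \<open>top_var\<close>.\<close>

theorem gen_dvd:
  assumes "p \<in> zero_ideal (Suc n) d"
  shows "gen dvd p"
proof -
  have top: "invars (insert top_var UNIV) f" for f :: cpoly by (simp add: invars_def)
  obtain e q r where *: "vlead top_var gen ^ e * p = q * gen + r" "r = 0 \<or> vdeg top_var r < vdeg top_var gen"
    using pseudo_division[OF gen_nonzero top top] by blast
  have "r = vlead top_var gen ^ e * p - q * gen" using *(1) by (simp add: algebra_simps)
  then have "r \<in> zero_ideal (Suc n) d" by (simp add: zero_ideal_diff zero_ideal_mult assms gen(2))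
  then have "r = 0" using *(2) zero_ideal_vdeg_small vdeg_gen by auto
  then have "gen dvd vlead top_var gen ^ e * p" using *(1) by simp
  then have "gen dvd vlead top_var gen \<or> gen dvd p"
    using irreducible_dvd_mult[OF gen(1)] irreducible_dvd_power[OF gen(1)] by blast
  moreover have "\<not> gen dvd vlead top_var gen"
  proof
    assume "gen dvd vlead top_var gen"
    then obtain h where h: "vlead top_var gen = gen * h" by (auto simp: dvd_def)
    have nz: "vlead top_var gen \<noteq> 0" by (rule vlead_nonzero[OF gen_nonzero])
    then have "h \<noteq> 0" using h by auto
    then have "vdeg top_var (vlead top_var gen) = d ^ n + vdeg top_var h"
      using h vdeg_mult[OF gen_nonzero] vdeg_gen by metis
    moreover have "vdeg top_var (vlead top_var gen) = 0"
      unfolding vdeg_0_iff using invars_vlead[OF top, of gen] by (simp add: Compl_eq_Diff_UNIV)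
    ultimately show False using d by simp
  qed
  ultimately show ?thesis by blast
qed

text \<open>Each block has a Macaulay determinant adapted to it, and \<open>gen\<close> divides all
  of them.\<close>

lemma wdeg_block_gen: "i \<le> n \<Longrightarrow> wdeg (block i) gen \<le> d ^ n"
proof -
  assume "i \<le> n"
  then obtain D where D: "D \<in> zero_ideal (Suc n) d" "mpoly_eval (power_system d) D = 1" "wdeg (block i) D \<le> d ^ n"
    using macaulay_determinant[OF d, of i "Suc n"] by auto
  have "D \<noteq> 0" using D(2) by auto
  then show ?thesis using wdeg_dvd_le[OF gen_dvd[OF D(1)], of "block i"] D(3) by linarith
qed

lemma gen_power_system: "mpoly_eval (power_system d) gen \<noteq> 0"
proof -
  obtain D where D: "D \<in> zero_ideal (Suc n) d" "mpoly_eval (power_system d) D = 1"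
    using macaulay_determinant[OF d, of 0 "Suc n"] by auto
  then obtain g where "D = gen * g" using gen_dvd by (metis dvd_def)
  then show ?thesis using D(2) by (auto simp: ev.hom_mult)
qed

text \<open>The substituted generator lies in the ideal again, and its total degree has not grown,
  so the cofactor is constant. This serves for mixing forms, for exchanging two of them and for
  scaling the variable \<open>x_n\<close>.\<close>

lemma gen_substitution:
  fixes y :: "nat \<times> (nat \<Rightarrow>\<^sub>0 nat) \<Rightarrow> cpoly"
  assumes deg: "\<And>v. wdeg (\<lambda>_. 1) (y v) \<le> 1"
    and zero: "\<And>a. common_zero (Suc n) d a \<Longrightarrow> common_zero (Suc n) d (\<lambda>v. mpoly_eval a (y v))"
  shows "\<exists>c. \<forall>a. mpoly_eval (\<lambda>v. mpoly_eval a (y v)) gen = c * mpoly_eval a gen"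
proof -
  define q where "q = msubst mconst y gen"
  have q: "mpoly_eval a q = mpoly_eval (\<lambda>v. mpoly_eval a (y v)) gen" for a
    by (simp add: q_def mpoly_eval_msubst)
  have "q \<in> zero_ideal (Suc n) d"
    using gen(2) zero unfolding zero_ideal_def by (auto simp: q)
  then obtain h where h: "q = gen * h" using gen_dvd by (metis dvd_def)
  show ?thesis
  proof (cases "q = 0")
    case True
    then show ?thesis using q by (intro exI[of _ 0]) (metis ev.hom_zero mult_zero_left)
  next
    case False
    then have "h \<noteq> 0" using h by auto
    then have "wdeg (\<lambda>_. 1) gen + wdeg (\<lambda>_. 1) h = wdeg (\<lambda>_. 1) q"
      unfolding h by (rule wdeg_mult[OF gen_nonzero, symmetric])
    also have "\<dots> \<le> wdeg (\<lambda>_. 1) gen" unfolding q_def by (rule wdeg_msubst_le[OF deg])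
    finally have "h = mconst (mcoeff h 0)" by (intro wdeg_1_eq_0) simp
    then have "mpoly_eval a h = mcoeff h 0" for a by (metis mpoly_eval_mconst)
    then show ?thesis
      by (intro exI[of _ "mcoeff h 0"]) (simp add: q[symmetric] h ev.hom_mult)
  qed
qed

lemma block_scale_zero:
  assumes "common_zero m d a"
  shows "common_zero m d (\<lambda>v. t ^ block i v * a v)"
proof -
  have "fval m d (\<lambda>v. t ^ block i v * a v) j x = (if j = i then t else 1) * fval m d a j x" for j x
    by (simp add: fval_def block_def sum_distrib_left mult_ac)
  then show ?thesis using assms unfolding common_zero_def by auto
qed

text \<open>Scaling one form preserves common zeros, so every part of fixed weight lies in the ideal
  and is a multiple of \<open>gen\<close>. Parts of lower weight have too small a degree to be
  nonzero multiples.\<close>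

lemma gen_block_homogeneous:
  "mpoly_eval (\<lambda>v. t ^ block i v * a v) gen = t ^ wdeg (block i) gen * mpoly_eval a gen"
proof -
  let ?g = "\<lambda>k. coeff (grade (block i) gen) k"
  have "?g k \<in> zero_ideal (Suc n) d" for k
    unfolding zero_ideal_def
  proof (intro CollectI allI impI)
    fix a assume a: "common_zero (Suc n) d a"
    define P where "P = map_poly (mpoly_eval a) (grade (block i) gen)"
    have "poly P t = 0" for t
    proof -
      have "(\<Sum>k\<le>wdeg (block i) gen. t ^ k * mpoly_eval a (?g k)) = mpoly_eval (\<lambda>v. t ^ block i v * a v) gen"
        by (rule mpoly_eval_grade[symmetric])
      also have "\<dots> = 0" using gen(2) block_scale_zero[OF a] unfolding zero_ideal_def by blast
      finally show ?thesis
        unfolding poly_altdef P_def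
        by (subst sum.mono_neutral_left[of "{..wdeg (block i) gen}"])
          (use degree_map_poly_le[of "mpoly_eval a" "grade (block i) gen"] coeff_eq_0[of P] in
            \<open>auto simp: wdeg_def coeff_map_poly P_def mult.commute\<close>)
    qed
    then have "P = 0" using poly_all_0_iff_0 by blast
    then show "mpoly_eval a (?g k) = 0" by (metis P_def coeff_0 coeff_map_poly ev.hom_zero)
  qed
  then have dvd: "gen dvd ?g k" for k by (rule gen_dvd)
  have zero: "?g k = 0" if "k < wdeg (block i) gen" for k
  proof (rule ccontr)
    assume "?g k \<noteq> 0"
    then have "wdeg (block i) gen \<le> wdeg (block i) (?g k)" by (rule wdeg_dvd_le[OF dvd])
    also have "\<dots> \<le> k" by (auto simp: wdeg_le_iff in_keys_iff mcoeff_grade split: if_splits)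
    finally show False using that by simp
  qed
  have main: "mpoly_eval (\<lambda>v. t ^ block i v * a v) gen = t ^ wdeg (block i) gen * mpoly_eval a (?g (wdeg (block i) gen))" for t
  proof -
    have "mpoly_eval (\<lambda>v. t ^ block i v * a v) gen = (\<Sum>k\<le>wdeg (block i) gen. t ^ k * mpoly_eval a (?g k))"
      by (rule mpoly_eval_grade)
    also have "\<dots> = (\<Sum>k\<in>{wdeg (block i) gen}. t ^ k * mpoly_eval a (?g k))"
      by (rule sum.mono_neutral_right) (auto simp: zero)
    finally show ?thesis by simp
  qed
  from main[of t] main[of 1] show ?thesis by simp
qed

end


section \<open>Zeros of the generator\<close>

lemma convergent_subseq_reals:
  fixes f :: "nat \<Rightarrow> nat \<Rightarrow> real"
  assumes "\<And>k j. j < m \<Longrightarrow> \<bar>f k j\<bar> \<le> B"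
  shows "\<exists>\<sigma>. strict_mono \<sigma> \<and> (\<forall>j<m. convergent (\<lambda>k. f (\<sigma> k) j))"
  using assms
proof (induction m)
  case 0
  show ?case by (intro exI[of _ id]) (auto simp: strict_mono_def)
next
  case (Suc m)
  then obtain \<sigma> where \<sigma>: "strict_mono \<sigma>" "\<And>j. j < m \<Longrightarrow> convergent (\<lambda>k. f (\<sigma> k) j)" by auto
  obtain \<tau> where \<tau>: "strict_mono \<tau>" "monoseq (\<lambda>k. f (\<sigma> (\<tau> k)) m)"
    using seq_monosub[of "\<lambda>k. f (\<sigma> k) m"] by blast
  have "Bseq (\<lambda>k. f (\<sigma> (\<tau> k)) m)" using Suc.prems by (intro BseqI'[of _ B]) auto
  then have "convergent (\<lambda>k. f (\<sigma> (\<tau> k)) m)" using \<tau>(2) by (rule Bseq_monoseq_convergent)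
  moreover have "convergent (\<lambda>k. f (\<sigma> (\<tau> k)) j)" if "j < m" for j
    using convergent_subseq_convergent[OF \<sigma>(2)[OF that] \<tau>(1)] by (simp add: o_def)
  ultimately show ?case
    using strict_mono_o[OF \<sigma>(1) \<tau>(1)] by (intro exI[of _ "\<lambda>k. \<sigma> (\<tau> k)"]) (auto simp: less_Suc_eq o_def)
qed

lemma convergent_subseq_complex:
  fixes f :: "nat \<Rightarrow> nat \<Rightarrow> complex"
  assumes "\<And>k j. j < m \<Longrightarrow> cmod (f k j) \<le> B"
  shows "\<exists>\<sigma> y. strict_mono \<sigma> \<and> (\<forall>j<m. (\<lambda>k. f (\<sigma> k) j) \<longlonglongrightarrow> y j)"
proof -
  obtain \<sigma> where \<sigma>: "strict_mono \<sigma>" "\<And>j. j < m \<Longrightarrow> convergent (\<lambda>k. Re (f (\<sigma> k) j))"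
    using convergent_subseq_reals[of m "\<lambda>k j. Re (f k j)" B] assms abs_Re_le_cmod order_trans by blast
  obtain \<tau> where \<tau>: "strict_mono \<tau>" "\<And>j. j < m \<Longrightarrow> convergent (\<lambda>k. Im (f (\<sigma> (\<tau> k)) j))"
    using convergent_subseq_reals[of m "\<lambda>k j. Im (f (\<sigma> k) j)" B] assms abs_Im_le_cmod order_trans by blast
  have "\<exists>y. (\<lambda>k. f (\<sigma> (\<tau> k)) j) \<longlonglongrightarrow> y" if "j < m" for j
  proof -
    note jm = that
    have "convergent (\<lambda>k. Re (f (\<sigma> (\<tau> k)) j))"
      using convergent_subseq_convergent[OF \<sigma>(2)[OF that] \<tau>(1)] by (simp add: o_def)
    then obtain u where u: "(\<lambda>k. Re (f (\<sigma> (\<tau> k)) j)) \<longlonglongrightarrow> u" unfolding convergent_def by blast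
    obtain v where v: "(\<lambda>k. Im (f (\<sigma> (\<tau> k)) j)) \<longlonglongrightarrow> v"
      using \<tau>(2)[OF jm] unfolding convergent_def by blast
    have "(\<lambda>k. Complex (Re (f (\<sigma> (\<tau> k)) j)) (Im (f (\<sigma> (\<tau> k)) j))) \<longlonglongrightarrow> Complex u v"
      by (rule tendsto_Complex[OF u v])
    then show ?thesis by (auto simp: complex_surj)
  qed
  then obtain y where "\<And>j. j < m \<Longrightarrow> (\<lambda>k. f (\<sigma> (\<tau> k)) j) \<longlonglongrightarrow> y j" by metis
  then show ?thesis
    using strict_mono_o[OF \<sigma>(1) \<tau>(1)] by (intro exI[of _ "\<lambda>k. \<sigma> (\<tau> k)"] exI[of _ y]) (auto simp: o_def)
qed

definition near :: "nat \<Rightarrow> nat \<Rightarrow> real \<Rightarrow> coefs \<Rightarrow> coefs \<Rightarrow> bool" where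
  "near n d \<epsilon> a a' \<longleftrightarrow> (\<forall>v\<in>coef_vars n d. cmod (a' v - a v) < \<epsilon>)"

text \<open>Division by a coordinate of largest modulus. The resulting inequalities are closed
  conditions; in the limit they still exclude the zero vector.\<close>

lemma common_zero_normalized:
  assumes "common_zero n d a"
  shows "\<exists>x. (\<forall>i<n. fval n d a i x = 0) \<and> (\<forall>j<n. cmod (x j) \<le> 1) \<and> (\<Sum>j<n. cmod (x j)) \<ge> 1"
proof -
  obtain x where x: "\<exists>j<n. x j \<noteq> 0" "\<And>i. i < n \<Longrightarrow> fval n d a i x = 0"
    using assms unfolding common_zero_def by blast
  define M where "M = Max ((\<lambda>j. cmod (x j)) ` {..<n})"
  have ne: "(\<lambda>j. cmod (x j)) ` {..<n} \<noteq> {}" using x(1) by auto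
  have le: "cmod (x j) \<le> M" if "j < n" for j unfolding M_def using that by (intro Max_ge) auto
  have "M \<in> (\<lambda>j. cmod (x j)) ` {..<n}" unfolding M_def by (rule Max_in) (use ne in auto)
  then obtain j0 where j0: "j0 < n" "M = cmod (x j0)" by auto
  have "M > 0" using x(1) le by (metis not_le order_trans zero_less_norm_iff less_le_trans)
  let ?y = "\<lambda>j. inverse (of_real M) * x j"
  have "(\<Sum>j<n. cmod (?y j)) \<ge> cmod (?y j0)" using j0 by (intro member_le_sum) auto
  moreover have "cmod (?y j0) = 1" using j0 \<open>M > 0\<close> by (simp add: norm_mult norm_inverse)
  moreover have "cmod (?y j) \<le> 1" if "j < n" for j
    using le[OF that] \<open>M > 0\<close> by (simp add: norm_mult norm_inverse) (simp add: field_simps)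
  moreover have "fval n d a i ?y = 0" if "i < n" for i using x(2)[OF that] by (simp add: fval_scale)
  ultimately show ?thesis by (intro exI[of _ ?y]) auto
qed

text \<open>Normalized zeros of systems converging to \<open>a\<close> have a convergent
  subsequence, and its limit is a nontrivial zero of \<open>a\<close>.\<close>

lemma no_common_zero_open:
  assumes "\<not> common_zero n d a"
  shows "\<exists>\<epsilon>>0. \<forall>a'. near n d \<epsilon> a a' \<longrightarrow> \<not> common_zero n d a'"
proof (rule ccontr)
  assume "\<not> ?thesis"
  then have "\<exists>a'. near n d (inverse (real (Suc k))) a a' \<and> common_zero n d a'" for k
    by (metis inverse_positive_iff_positive of_nat_0_less_iff zero_less_Suc)
  then obtain A where A: "\<And>k. near n d (inverse (real (Suc k))) a (A k)" "\<And>k. common_zero n d (A k)" by metis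
  from common_zero_normalized[OF A(2)]
  obtain x where x: "\<And>k i. i < n \<Longrightarrow> fval n d (A k) i (x k) = 0" "\<And>k j. j < n \<Longrightarrow> cmod (x k j) \<le> 1"
    "\<And>k. (\<Sum>j<n. cmod (x k j)) \<ge> 1" by metis
  obtain \<sigma> y where \<sigma>: "strict_mono \<sigma>" "\<And>j. j < n \<Longrightarrow> (\<lambda>k. x (\<sigma> k) j) \<longlonglongrightarrow> y j"
    using convergent_subseq_complex[of n x 1] x(2) by metis
  have A_lim: "(\<lambda>k. A (\<sigma> k) v) \<longlonglongrightarrow> a v" if "v \<in> coef_vars n d" for v
  proof -
    have "(\<lambda>k. A k v - a v) \<longlonglongrightarrow> 0"
    proof (rule tendsto_0_le[OF LIMSEQ_inverse_real_of_nat, of _ 1], rule always_eventually, rule allI)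
      fix k
      have "cmod (A k v - a v) \<le> inverse (real (Suc k))"
        using A(1)[of k] that unfolding near_def by (meson less_imp_le)
      then show "cmod (A k v - a v) \<le> norm (inverse (real (Suc k))) * 1" by simp
    qed
    then have "(\<lambda>k. A k v) \<longlonglongrightarrow> a v" by (rule LIM_zero_cancel)
    then show ?thesis using LIMSEQ_subseq_LIMSEQ[OF _ \<sigma>(1)] by (force simp: o_def)
  qed
  have "fval n d a i y = 0" if i: "i < n" for i
  proof -
    have "(\<lambda>k. \<Sum>\<alpha>\<in>monomials n d. A (\<sigma> k) (i, \<alpha>) * (\<Prod>v<n. x (\<sigma> k) v ^ expo \<alpha> v))
        \<longlonglongrightarrow> (\<Sum>\<alpha>\<in>monomials n d. a (i, \<alpha>) * (\<Prod>v<n. y v ^ expo \<alpha> v))"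
      by (intro tendsto_intros A_lim \<sigma>(2)) (use i in \<open>auto simp: coef_vars_def\<close>)
    then have "(\<lambda>k. fval n d (A (\<sigma> k)) i (x (\<sigma> k))) \<longlonglongrightarrow> fval n d a i y"
      by (simp add: fval_def mon_eval_monomial)
    then have "(\<lambda>k. 0) \<longlonglongrightarrow> fval n d a i y" by (simp add: x(1)[OF i])
    then show ?thesis by (simp add: LIMSEQ_const_iff)
  qed
  moreover have "\<exists>j<n. y j \<noteq> 0"
  proof (rule ccontr)
    assume "\<not> ?thesis"
    then have "(\<Sum>j<n. cmod (y j)) = 0" by simp
    moreover have "(\<lambda>k. \<Sum>j<n. cmod (x (\<sigma> k) j)) \<longlonglongrightarrow> (\<Sum>j<n. cmod (y j))"
      by (intro tendsto_intros \<sigma>(2)) auto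
    then have "(\<Sum>j<n. cmod (y j)) \<ge> 1"
      by (rule LIMSEQ_le_const) (use x(3) in auto)
    ultimately show False by simp
  qed
  ultimately show False using assms unfolding common_zero_def by blast
qed

text \<open>Every root \<open>z\<close> satisfies \<open>cmod z \<ge> \<delta> > cmod t\<close>,
  hence \<open>cmod (t - z) \<le> 2 * cmod z\<close>; multiply over the roots. The constant depends
  on the degree only, so the bound survives a limit of polynomials of bounded degree.\<close>

lemma poly_bound_of_no_small_roots:
  fixes p :: "complex poly"
  assumes "\<And>z. cmod z < \<delta> \<Longrightarrow> poly p z \<noteq> 0" "cmod t < \<delta>"
  shows "cmod (poly p t) \<le> 2 ^ degree p * cmod (poly p 0)"
  using assms(1)
proof (induction "degree p" arbitrary: p)
  case 0
  then obtain c where "p = [:c:]" by (metis degree_eq_zeroE)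
  then show ?case by simp
next
  case (Suc k)
  then obtain z where "poly p z = 0"
    using fundamental_theorem_of_algebra[of p] by (metis constant_degree nat.distinct(1))
  then obtain q where q: "p = [:- z, 1:] * q" by (metis dvd_def poly_eq_0_iff_dvd)
  have "q \<noteq> 0" using Suc.hyps(2) q by auto
  then have deg: "degree p = Suc (degree q)" unfolding q by (subst degree_mult_eq) auto
  have "cmod z \<ge> \<delta>" using Suc.prems[of z] \<open>poly p z = 0\<close> by (meson not_le)
  have "poly q w \<noteq> 0" if "cmod w < \<delta>" for w using Suc.prems[OF that] by (auto simp: q)
  then have IH: "cmod (poly q t) \<le> 2 ^ degree q * cmod (poly q 0)"
    using Suc.hyps(1)[of q] Suc.hyps(2) deg by simp
  have "cmod (t - z) \<le> 2 * cmod z"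
    using norm_triangle_ineq4[of t z] \<open>cmod z \<ge> \<delta>\<close> assms(2) by linarith
  then have "cmod (t - z) * cmod (poly q t) \<le> (2 * cmod z) * (2 ^ degree q * cmod (poly q 0))"
    using IH by (intro mult_mono) auto
  moreover have "poly p t = (t - z) * poly q t" "poly p 0 = - z * poly q 0"
    by (simp_all add: q algebra_simps)
  ultimately show ?case by (simp add: norm_mult deg mult_ac)
qed

lemma eventually_notin_finite: "finite A \<Longrightarrow> eventually (\<lambda>s. s \<notin> A) (at (a :: complex))"
proof -
  assume "finite A"
  then have "closed (A - {a})" by (intro finite_imp_closed) auto
  then have "open (- (A - {a}))" by (rule open_Compl)
  then show ?thesis unfolding eventually_at_topological by (intro exI[of _ "- (A - {a})"]) auto
qed

section \<open>The generator vanishes only at systems with a common zero\<close>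

context lower_resultant
begin

abbreviation move_block :: "nat \<Rightarrow> coefs \<Rightarrow> coefs \<Rightarrow> complex \<Rightarrow> coefs" where
  "move_block i a h t \<equiv> (\<lambda>v. if fst v = i then a v + t * h v else a v)"

lemma poly_move_block:
  "\<exists>q. (\<forall>t. poly q t = mpoly_eval (move_block i a h t) gen) \<and> degree q \<le> wdeg (block i) gen"
proof (intro exI conjI allI)
  let ?q = "msubst (\<lambda>c. [:c:]) (\<lambda>v. if fst v = i then [:a v, h v:] else [:a v:]) gen"
  show "poly ?q t = mpoly_eval (move_block i a h t) gen" for t
    unfolding poly_msubst by (rule arg_cong[of _ _ "\<lambda>x. mpoly_eval x gen"]) auto
  show "degree ?q \<le> wdeg (block i) gen" by (rule degree_msubst_le) (auto simp: block_def)
qed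

text \<open>
  If \<open>a\<close> has no common zero, then the polynomial \<open>t \<mapsto> gen (a + t h')\<close> of degree at most \<open>d ^ n\<close>
  vanishes at the \<open>d ^ n\<close> nonzero values of \<open>t\<close> for which the \<open>i\<close>-th form vanishes at one of the zeros
  of the others, and at \<open>0\<close>.
\<close>

lemma gen_zero_fibre:
  assumes i: "i \<le> n" and good: "good (omit n i a)"
    and h: "mpoly_eval (\<lambda>v. if fst v = i then h v else a v) gen \<noteq> 0"
    and zero: "mpoly_eval a gen = 0"
  shows "common_zero (Suc n) d a"
proof (rule ccontr)
  assume no_zero: "\<not> ?thesis"
  obtain S pt where S: "finite S" "card S = d ^ n" and pt: "\<And>s. s \<in> S \<Longrightarrow> pt s n = 1"
    "\<And>s. s \<in> S \<Longrightarrow> pt s (n - 1) = s" "\<And>s j. s \<in> S \<Longrightarrow> j \<le> n \<Longrightarrow> j \<noteq> i \<Longrightarrow> fval (Suc n) d a j (pt s) = 0"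
    using good_omit_points[OF good i] by blast
  have common: "common_zero (Suc n) d b" if "s \<in> S" "fval (Suc n) d b i (pt s) = 0"
    "\<And>v. fst v \<noteq> i \<Longrightarrow> b v = a v" for b s
    unfolding common_zero_def
  proof (intro exI[of _ "pt s"] conjI allI impI)
    show "\<exists>j<Suc n. pt s j \<noteq> 0" using pt(1)[OF that(1)] by (intro exI[of _ n]) auto
    fix j assume "j < Suc n"
    then show "fval (Suc n) d b j (pt s) = 0"
      using that(2) pt(3)[OF that(1), of j] that(3) by (cases "j = i") (auto simp: fval_def)
  qed
  define G where "G s = fval (Suc n) d a i (pt s)" for s
  define H where "H s = fval (Suc n) d h i (pt s)" for s
  have G: "G s \<noteq> 0" if "s \<in> S" for s using common[OF that, of a] no_zero by (auto simp: G_def)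
  define \<beta> where "\<beta> = Poly_Mapping.single (n - 1) 1 + Poly_Mapping.single n (d - 1)"
  \<comment> \<open>A form with the value \<open>s + u\<close> at \<open>pt s\<close>. A multiple of
    it is added to \<open>h\<close> in order to separate the roots \<open>- G s / H' s\<close>
    below.\<close>
  define B where "B u v = (if v = (i, \<beta>) then 1 else 0) + u * (if v = (i, Poly_Mapping.single n d) then 1 else 0 :: complex)" for u v
  have \<beta>_in: "\<beta> \<in> monomials (Suc n) d"
    using d by (simp add: \<beta>_def linear_times_power_in_monomials del: One_nat_def)
  have B: "fval (Suc n) d (B u) i (pt s) = s + u" if "s \<in> S" for u s
  proof -
    have "fval (Suc n) d (B u) i (pt s) = mon_eval (pt s) \<beta> + u * mon_eval (pt s) (Poly_Mapping.single n d)"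
      using \<beta>_in by (simp add: fval_def B_def distrib_right sum.distrib if_distrib[of "\<lambda>z. z * _"] if_distrib[of "\<lambda>z. u * z"] cong: if_cong)
    then show ?thesis using pt(1,2)[OF that] by (simp add: \<beta>_def mon_eval_add)
  qed
  let ?D = "{(s, s'). s \<in> S \<and> s' \<in> S \<and> s \<noteq> s'}"
  have finD: "finite ?D" by (rule finite_subset[OF _ finite_cartesian_product[OF S(1) S(1)]]) auto
  have lin: "finite {z :: complex. p + z * q = 0}" if "p \<noteq> 0 \<or> q \<noteq> 0" for p q
  proof -
    have "[:p, q:] \<noteq> 0" using that by auto
    from poly_roots_finite[OF this] show ?thesis by simp
  qed
  \<comment> \<open>Two roots coincide only if \<open>G s * H' s' = G s' * H' s\<close>. The
    difference of the two sides is affine in \<open>c\<close> with this expression as its slope,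
    which therefore has to be nonzero for every pair.\<close>
  obtain u where u: "\<And>s s'. s \<in> S \<Longrightarrow> s' \<in> S \<Longrightarrow> s \<noteq> s' \<Longrightarrow> (G s * s' - G s' * s) + u * (G s - G s') \<noteq> 0"
  proof -
    have "finite (\<Union>(s, s') \<in> ?D. {z. (G s * s' - G s' * s) + z * (G s - G s') = 0})"
    proof (rule finite_UN_I[OF finD])
      fix p assume "p \<in> ?D"
      then obtain s s' where p: "p = (s, s')" "s \<in> S" "s' \<in> S" "s \<noteq> s'" by auto
      have "G s * s' - G s' * s \<noteq> 0 \<or> G s - G s' \<noteq> 0" using G[OF p(2)] p(4) by auto
      from lin[OF this] show "finite (case p of (s, s') \<Rightarrow> {z. (G s * s' - G s' * s) + z * (G s - G s') = 0})"
        by (simp add: p(1))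
    qed
    from infinite_complex_avoid[OF this] that show thesis by blast
  qed
  define h' where "h' c = (\<lambda>v. h v + c * B u v)" for c
  have "finite {c. mpoly_eval (\<lambda>v. (if fst v = i then h v else a v) + c * (if fst v = i then B u v else 0)) gen = 0}"
    by (rule finite_eval_line_zero[of _ 0]) (use h in simp)
  moreover have "(\<lambda>v. (if fst v = i then h v else a v) + c * (if fst v = i then B u v else 0)) =
      (\<lambda>v. if fst v = i then h' c v else a v)" for c by (auto simp: h'_def)
  ultimately have fin1: "finite {c. mpoly_eval (\<lambda>v. if fst v = i then h' c v else a v) gen = 0}" by simp
  have fin2: "finite (\<Union>(s, s') \<in> ?D. {c. (G s * H s' - G s' * H s) + c * ((G s * s' - G s' * s) + u * (G s - G s')) = 0})"
  proof (rule finite_UN_I[OF finD])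
    fix p assume "p \<in> ?D"
    then obtain s s' where p: "p = (s, s')" "s \<in> S" "s' \<in> S" "s \<noteq> s'" by auto
    from lin[OF disjI2[OF u[OF p(2-4)]]]
    show "finite (case p of (s, s') \<Rightarrow> {c. (G s * H s' - G s' * H s) + c * ((G s * s' - G s' * s) + u * (G s - G s')) = 0})"
      by (simp add: p(1))
  qed
  obtain c where c: "mpoly_eval (\<lambda>v. if fst v = i then h' c v else a v) gen \<noteq> 0"
    "\<And>s s'. s \<in> S \<Longrightarrow> s' \<in> S \<Longrightarrow> s \<noteq> s' \<Longrightarrow> (G s * H s' - G s' * H s) + c * ((G s * s' - G s' * s) + u * (G s - G s')) \<noteq> 0"
    using infinite_complex_avoid[OF finite_UnI[OF fin1 fin2]] by blast
  define H' where "H' s = fval (Suc n) d (h' c) i (pt s)" for s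
  have H'_eq: "H' s = H s + c * (s + u)" if "s \<in> S" for s
    unfolding H'_def h'_def fval_line B[OF that] H_def ..
  have H': "H' s \<noteq> 0" if s: "s \<in> S" for s
  proof
    assume "H' s = 0"
    then have "fval (Suc n) d (\<lambda>v. if fst v = i then h' c v else a v) i (pt s) = 0"
      by (simp add: H'_def fval_def)
    then have "common_zero (Suc n) d (\<lambda>v. if fst v = i then h' c v else a v)"
      by (intro common[OF s]) auto
    then show False using c(1) gen(2) unfolding zero_ideal_def by blast
  qed
  define root where "root s = - G s / H' s" for s
  have inj: "inj_on root S"
  proof (rule inj_onI, rule ccontr)
    fix s s' assume s: "s \<in> S" "s' \<in> S" "root s = root s'" "s \<noteq> s'"
    then have "G s * H' s' - G s' * H' s = 0" using H' by (simp add: root_def field_simps)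
    then show False using c(2)[OF s(1,2,4)] s by (simp add: H'_eq algebra_simps)
  qed
  have "0 \<notin> root ` S" using G H' by (auto simp: root_def)
  then have card: "card (insert 0 (root ` S)) = Suc (d ^ n)" using S inj by (simp add: card_image)
  obtain q where q: "\<And>t. poly q t = mpoly_eval (move_block i a (h' c) t) gen" "degree q \<le> wdeg (block i) gen"
    using poly_move_block by blast
  have "q = 0"
  proof (rule poly_eq_0_of_roots[where S = "insert 0 (root ` S)"])
    show "degree q < card (insert 0 (root ` S))" using q(2) wdeg_block_gen[OF i] card by linarith
    fix t assume "t \<in> insert 0 (root ` S)"
    then consider "t = 0" | s where "s \<in> S" "t = root s" by blast
    then show "poly q t = 0"
    proof cases
      case 1
      have "move_block i a (h' c) 0 = a" by auto
      then show ?thesis using zero by (simp only: q(1) 1)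
    next
      case 2
      have "fval (Suc n) d (move_block i a (h' c) t) i (pt s) = G s + t * H' s"
        unfolding G_def H'_def fval_line[symmetric] by (simp add: fval_def)
      also have "\<dots> = 0" using H'[OF 2(1)] 2(2) by (simp add: root_def)
      finally have "common_zero (Suc n) d (move_block i a (h' c) t)" by (intro common[OF 2(1)]) auto
      then show ?thesis using gen(2) unfolding q(1) zero_ideal_def by blast
    qed
  qed
  \<comment> \<open>Homogeneity in block \<open>i\<close> makes \<open>r\<close> the reversal of
    \<open>q\<close>, so \<open>q = 0\<close> forces \<open>r = 0\<close>. But \<open>r\<close> at 0
    is the value of \<open>gen\<close> at \<open>Y\<close>, which \<open>c\<close> was chosen to
    keep nonzero.\<close>
  define Y where "Y = (\<lambda>v. if fst v = i then h' c v else a v)"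
  obtain r where r: "\<And>t. poly r t = mpoly_eval (move_block i Y a t) gen"
    using poly_move_block[of i Y a] by blast
  have "poly r t = 0" if "t \<noteq> 0" for t
  proof -
    have "(\<lambda>v. (inverse t) ^ block i v * move_block i Y a t v) =
        move_block i a (h' c) (inverse t)"
    proof
      fix v
      show "(inverse t) ^ block i v * move_block i Y a t v = move_block i a (h' c) (inverse t) v"
        using that by (cases "fst v = i") (simp_all add: block_def Y_def distrib_left mult.assoc[symmetric])
    qed
    then have "(inverse t) ^ wdeg (block i) gen * poly r t = poly q (inverse t)"
      unfolding q(1) r gen_block_homogeneous[symmetric] by (rule arg_cong)
    then show ?thesis using that \<open>q = 0\<close> by simp
  qed
  then have "infinite {t. poly r t = 0}"
    using infinite_UNIV_char_0[where 'a = complex] finite_subset[of UNIV "insert 0 {t. poly r t = 0}"] by auto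
  then have "r = 0" using poly_roots_finite by blast
  moreover have "move_block i Y a 0 = Y" by auto
  ultimately have "mpoly_eval Y gen = 0" using r[of 0] by (simp only: poly_0)
  then show False using c(1) by (simp add: Y_def)
qed

lemma good_omit_exists:
  assumes "i \<le> n"
  obtains e where "good (omit n i e)" "mpoly_eval e gen \<noteq> 0"
proof -
  \<comment> \<open>Form \<open>i\<close> of the chain is stored at index \<open>n\<close>, from
    where \<open>omit\<close> fetches it. Joining \<open>e0\<close> with the power system gives a
    system at which \<open>gen\<close> is nonzero as well.\<close>
  define e0 where "e0 = (\<lambda>(k, \<alpha>). coeffs_of chain (if k = n then i else k, \<alpha>))"
  have "good (omit n i e0) \<longleftrightarrow> good (coeffs_of chain)"
    by (rule good_cong) (auto simp: omit_def e0_def)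
  then have "good (omit n i e0)" using good_chain by simp
  then have "finite {s. \<not> good (\<lambda>v. omit n i (power_system d) v + s * (omit n i e0 v - omit n i (power_system d) v))}"
    by (rule good_generic)
  moreover have "finite {s. mpoly_eval (\<lambda>v. power_system d v + s * (e0 v - power_system d v)) gen = 0}"
    by (rule finite_eval_line_zero[of _ 0]) (simp add: gen_power_system)
  ultimately obtain s where s: "good (\<lambda>v. omit n i (power_system d) v + s * (omit n i e0 v - omit n i (power_system d) v))"
    "mpoly_eval (\<lambda>v. power_system d v + s * (e0 v - power_system d v)) gen \<noteq> 0"
    using infinite_complex_avoid[OF finite_UnI] by blast
  moreover have "(\<lambda>v. omit n i (power_system d) v + s * (omit n i e0 v - omit n i (power_system d) v)) =
      omit n i (\<lambda>v. power_system d v + s * (e0 v - power_system d v))"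
    by (auto simp: omit_def)
  ultimately show thesis using that by simp
qed

text \<open>
  On a generic line \<open>A s\<close> through \<open>a = A 0\<close> and for small \<open>s \<noteq> 0\<close>, the polynomial
  \<open>t \<mapsto> gen (A s + t h)\<close> of degree at most \<open>d ^ n\<close> has no small roots, so for small \<open>t\<close> its values are
  bounded by a constant times its value at \<open>0\<close>.  The bound persists for \<open>s = 0\<close>, where the value at \<open>0\<close>
  vanishes.
\<close>

lemma gen_zero_move_block:
  assumes i: "i \<le> n" and zero: "mpoly_eval a gen = 0"
    and \<epsilon>: "\<epsilon> > 0" "\<And>a'. near (Suc n) d \<epsilon> a a' \<Longrightarrow> \<not> common_zero (Suc n) d a'"
  shows "mpoly_eval (move_block i a h t) gen = 0"
proof -
  obtain e where e: "good (omit n i e)" "mpoly_eval e gen \<noteq> 0" using good_omit_exists[OF i] by blast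
  define A where "A s = (\<lambda>v. a v + s * (e v - a v))" for s
  define r where "r s t = mpoly_eval (move_block i (A s) h t) gen" for s t
  \<comment> \<open>Bounds the change of each coefficient per unit of \<open>s\<close> and
    \<open>t\<close>, so that parameters below \<open>\<epsilon> / M\<close> stay within distance
    \<epsilon> of \<open>a\<close>. The summand 1 keeps \<open>M\<close> positive and the inequality
    strict.\<close>
  define M where "M = 1 + (\<Sum>v\<in>coef_vars (Suc n) d. cmod (e v - a v) + cmod (h v))"
  have M: "M > 0" unfolding M_def by (intro add_pos_nonneg sum_nonneg) auto
  have M_le: "cmod (e v - a v) + cmod (h v) < M" if "v \<in> coef_vars (Suc n) d" for v
  proof -
    have "cmod (e v - a v) + cmod (h v) \<le> (\<Sum>v\<in>coef_vars (Suc n) d. cmod (e v - a v) + cmod (h v))"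
      by (rule member_le_sum[OF that _ finite_coef_vars]) auto
    then show ?thesis by (simp add: M_def)
  qed
  define \<delta> where "\<delta> = \<epsilon> / M"
  have \<delta>: "\<delta> > 0" using M \<epsilon>(1) by (simp add: \<delta>_def)
  have not_common: "\<not> common_zero (Suc n) d (move_block i (A s) h t)" if "cmod s < \<delta>" "cmod t < \<delta>" for s t
  proof (rule \<epsilon>(2), unfold near_def, rule ballI)
    fix v assume v: "v \<in> coef_vars (Suc n) d"
    have "cmod (move_block i (A s) h t v - a v) \<le> cmod s * cmod (e v - a v) + cmod t * cmod (h v)"
      using norm_triangle_ineq[of "s * (e v - a v)" "t * h v"] by (auto simp: A_def norm_mult)
    also have "\<dots> \<le> \<delta> * cmod (e v - a v) + \<delta> * cmod (h v)"
      using that by (intro add_mono mult_right_mono) auto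
    also have "\<dots> < \<delta> * M" using M_le[OF v] \<delta> by (simp add: distrib_left[symmetric])
    also have "\<dots> = \<epsilon>" using M by (simp add: \<delta>_def)
    finally show "cmod (move_block i (A s) h t v - a v) < \<epsilon>" .
  qed
  \<comment> \<open>The parameters at which \<open>gen_zero_fibre\<close> does not apply to
    \<open>A s\<close>. Moving block \<open>i\<close> affects neither condition: one concerns the
    other forms, and in the other form \<open>i\<close> is replaced by that of
    \<open>e\<close>.\<close>
  define F where "F = {s. \<not> good (omit n i (A s))} \<union> {s. mpoly_eval (\<lambda>v. if fst v = i then e v else A s v) gen = 0}"
  have "finite F"
  proof -
    have "omit n i (A s) = (\<lambda>v. omit n i a v + s * (omit n i e v - omit n i a v))" for s
      by (auto simp: omit_def A_def)
    then have "finite {s. \<not> good (omit n i (A s))}" using good_generic[OF e(1), of "omit n i a"] by simp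
    have "(\<lambda>v. if fst v = i then e v else A s v) =
        (\<lambda>v. (if fst v = i then e v else a v) + s * (if fst v = i then 0 else e v - a v))" for s
      by (auto simp: A_def)
    moreover have "(\<lambda>v. (if fst v = i then e v else a v) + 1 * (if fst v = i then 0 else e v - a v)) = e"
      by auto
    then have "finite {s. mpoly_eval (\<lambda>v. (if fst v = i then e v else a v) + s * (if fst v = i then 0 else e v - a v)) gen = 0}"
      by (intro finite_eval_line_zero[of _ 1]) (simp only: e(2) not_False_eq_True)
    ultimately have "finite {s. mpoly_eval (\<lambda>v. if fst v = i then e v else A s v) gen = 0}"
      by (simp only:)
    with \<open>finite {s. \<not> good (omit n i (A s))}\<close> show ?thesis by (simp add: F_def)
  qed
  have nonzero: "r s t \<noteq> 0" if s: "s \<notin> F" "cmod s < \<delta>" "cmod t < \<delta>" for s t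
  proof
    assume "r s t = 0"
    have "good (omit n i (move_block i (A s) h t)) \<longleftrightarrow> good (omit n i (A s))"
      by (rule good_cong) (auto simp: omit_def)
    then have "good (omit n i (move_block i (A s) h t))" using s(1) by (simp add: F_def)
    moreover have "(\<lambda>v. if fst v = i then e v else move_block i (A s) h t v) = (\<lambda>v. if fst v = i then e v else A s v)"
      by auto
    then have "mpoly_eval (\<lambda>v. if fst v = i then e v else move_block i (A s) h t v) gen \<noteq> 0"
      using s(1) by (simp add: F_def)
    ultimately have "common_zero (Suc n) d (move_block i (A s) h t)"
      using gen_zero_fibre[OF i] \<open>r s t = 0\<close> unfolding r_def by blast
    then show False using not_common s by blast
  qed
  have poly_s: "\<exists>p. \<forall>s. poly p s = r s t" for t
  proof (rule exI, rule allI)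
    fix s
    show "poly (msubst (\<lambda>c. [:c:]) (\<lambda>v. if fst v = i then [:a v + t * h v, e v - a v:] else [:a v, e v - a v:]) gen) s = r s t"
      unfolding poly_msubst r_def by (rule arg_cong[of _ _ "\<lambda>x. mpoly_eval x gen"]) (auto simp: A_def)
  qed
  have small: "r 0 t = 0" if t: "cmod t < \<delta>" for t
  proof -
    obtain p0 where p0: "\<And>s. poly p0 s = r s 0" using poly_s by blast
    obtain p1 where p1: "\<And>s. poly p1 s = r s t" using poly_s by blast
    have bound: "cmod (r s t) \<le> 2 ^ (d ^ n) * cmod (r s 0)" if s: "s \<notin> F" "cmod s < \<delta>" for s
    proof -
      obtain q where q: "\<And>t. poly q t = r s t" "degree q \<le> wdeg (block i) gen"
        unfolding r_def using poly_move_block by blast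
      have "cmod (poly q t) \<le> 2 ^ degree q * cmod (poly q 0)"
        by (rule poly_bound_of_no_small_roots[OF _ t]) (use nonzero[OF s] q(1) in auto)
      also have "\<dots> \<le> 2 ^ (d ^ n) * cmod (poly q 0)"
        using q(2) wdeg_block_gen[OF i] by (intro mult_right_mono power_increasing) auto
      finally show ?thesis by (simp add: q(1))
    qed
    have "eventually (\<lambda>s. s \<notin> F) (at 0)" by (rule eventually_notin_finite[OF \<open>finite F\<close>])
    moreover have "eventually (\<lambda>s. cmod s < \<delta>) (at 0)"
      using \<delta> by (auto simp: eventually_at intro!: exI[of _ \<delta>])
    ultimately have "eventually (\<lambda>s. cmod (poly p1 s) \<le> 2 ^ (d ^ n) * cmod (poly p0 s)) (at 0)"
      by eventually_elim (simp add: p0 p1 bound)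
    moreover have "((\<lambda>s. cmod (poly p1 s)) \<longlongrightarrow> cmod (poly p1 0)) (at 0)"
      "((\<lambda>s. 2 ^ (d ^ n) * cmod (poly p0 s)) \<longlongrightarrow> 2 ^ (d ^ n) * cmod (poly p0 0)) (at 0)"
      by (intro tendsto_intros poly_isCont[unfolded isCont_def])+
    ultimately have "cmod (poly p1 0) \<le> 2 ^ (d ^ n) * cmod (poly p0 0)"
      by (intro tendsto_le[of "at (0::complex)"]) auto
    moreover have "poly p0 0 = 0" using zero by (simp add: p0 r_def A_def cong: if_cong)
    ultimately show ?thesis by (simp add: p1)
  qed
  obtain q where q: "\<And>t. poly q t = r 0 t" unfolding r_def using poly_move_block by blast
  have "q = 0"
  proof (rule ccontr)
    assume "q \<noteq> 0"
    have "(\<lambda>k. of_real (\<delta> / real (k + 2))) ` UNIV \<subseteq> {t. poly q t = 0}"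
    proof (rule image_subsetI)
      fix k :: nat
      have "\<delta> / real (k + 2) < \<delta>" using \<delta> by (simp add: divide_less_eq)
      then have "cmod (of_real (\<delta> / real (k + 2))) < \<delta>" using \<delta> by (simp del: of_real_divide)
      then show "of_real (\<delta> / real (k + 2)) \<in> {t. poly q t = 0}" using small q by simp
    qed
    moreover have "inj (\<lambda>k::nat. of_real (\<delta> / real (k + 2)) :: complex)"
      using \<delta> by (auto simp: inj_def simp del: of_real_divide)
    then have "infinite (range (\<lambda>k::nat. of_real (\<delta> / real (k + 2)) :: complex))" by (rule range_inj_infinite)
    ultimately show False using poly_roots_finite[OF \<open>q \<noteq> 0\<close>] finite_subset by blast
  qed
  then have "r 0 t = 0" using q[of t] by simp
  then show ?thesis by (simp add: r_def A_def cong: if_cong)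
qed

theorem gen_zero_iff: "mpoly_eval a gen = 0 \<longleftrightarrow> common_zero (Suc n) d a"
proof
  show "common_zero (Suc n) d a \<Longrightarrow> mpoly_eval a gen = 0" using gen(2) unfolding zero_ideal_def by blast
  assume zero: "mpoly_eval a gen = 0"
  show "common_zero (Suc n) d a"
  proof (rule ccontr)
    assume "\<not> common_zero (Suc n) d a"
    then obtain \<epsilon> where \<epsilon>: "\<epsilon> > 0" "\<And>a'. near (Suc n) d \<epsilon> a a' \<Longrightarrow> \<not> common_zero (Suc n) d a'"
      using no_common_zero_open by blast
    have near_zero: "mpoly_eval a' gen = 0" if near: "near (Suc n) d (\<epsilon> / 2) a a'" for a'
    proof -
      define A where "A m v = (if fst v < m then a' v else a v)" for m v
      have "mpoly_eval (A m) gen = 0" if "m \<le> Suc n" for m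
        using that
      proof (induction m)
        case 0
        show ?case using zero by (simp add: A_def)
      next
        case (Suc m)
        \<comment> \<open>The intermediate systems lie within \<open>\<epsilon> / 2\<close> of
          \<open>a\<close>, which leaves around each of them the neighbourhood without common zeros
          that moving the next block requires.\<close>
        have "\<not> common_zero (Suc n) d b" if "near (Suc n) d (\<epsilon> / 2) (A m) b" for b
        proof (rule \<epsilon>(2), unfold near_def, rule ballI)
          fix v assume v: "v \<in> coef_vars (Suc n) d"
          have "cmod (A m v - a v) < \<epsilon> / 2" using near v \<epsilon>(1) by (auto simp: near_def A_def)
          moreover have "cmod (b v - A m v) < \<epsilon> / 2" using that v by (auto simp: near_def)
          ultimately show "cmod (b v - a v) < \<epsilon>" using norm_triangle_ineq[of "b v - A m v" "A m v - a v"] by simp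
        qed
        then have "mpoly_eval (move_block m (A m) (\<lambda>v. a' v - a v) 1) gen = 0"
          using Suc \<epsilon>(1) by (intro gen_zero_move_block[of m _ "\<epsilon> / 2"]) auto
        moreover have "move_block m (A m) (\<lambda>v. a' v - a v) 1 = A (Suc m)" by (auto simp: A_def)
        ultimately show ?case by simp
      qed
      from this[of "Suc n"] have "mpoly_eval (A (Suc n)) gen = 0" by simp
      also have "mpoly_eval (A (Suc n)) gen = mpoly_eval a' gen"
      proof (rule mpoly_eval_cong)
        fix \<alpha> v assume "\<alpha> \<in> Poly_Mapping.keys gen" "v \<in> Poly_Mapping.keys \<alpha>"
        then have "v \<in> {..<Suc n} \<times> monomials (Suc n) d" using gen(3) unfolding invars_def coef_vars_def by blast
        then show "A (Suc n) v = a' v" by (auto simp: A_def)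
      qed
      finally show ?thesis .
    qed
    \<comment> \<open>On the line from \<open>a\<close> to the power system \<open>gen\<close> has
      only finitely many zeros, so it is nonzero at points arbitrarily close to
      \<open>a\<close>.\<close>
    define p where "p = (\<lambda>v. power_system d v - a v)"
    have "mpoly_eval (\<lambda>v. a v + 1 * p v) gen \<noteq> 0" using gen_power_system by (simp add: p_def)
    then have fin: "finite {s. mpoly_eval (\<lambda>v. a v + s * p v) gen = 0}" by (rule finite_eval_line_zero)
    define M where "M = 1 + (\<Sum>v\<in>coef_vars (Suc n) d. cmod (p v))"
    have M: "M > 0" unfolding M_def by (intro add_pos_nonneg sum_nonneg) auto
    have "eventually (\<lambda>s. s \<notin> {s. mpoly_eval (\<lambda>v. a v + s * p v) gen = 0}) (at 0)"
      by (rule eventually_notin_finite[OF fin])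
    moreover have "eventually (\<lambda>s. cmod s < \<epsilon> / 2 / M) (at 0)"
      using \<epsilon>(1) M by (auto simp: eventually_at intro!: exI[of _ "\<epsilon> / 2 / M"])
    ultimately have "eventually (\<lambda>s. s \<notin> {s. mpoly_eval (\<lambda>v. a v + s * p v) gen = 0} \<and> cmod s < \<epsilon> / 2 / M) (at 0)"
      by eventually_elim auto
    then obtain s where s: "mpoly_eval (\<lambda>v. a v + s * p v) gen \<noteq> 0" "cmod s < \<epsilon> / 2 / M"
      using eventually_happens[of _ "at (0::complex)"] by (auto simp: at_neq_bot)
    have "near (Suc n) d (\<epsilon> / 2) a (\<lambda>v. a v + s * p v)"
      unfolding near_def
    proof (rule ballI)
      fix v assume v: "v \<in> coef_vars (Suc n) d"
      have "cmod (p v) \<le> (\<Sum>v\<in>coef_vars (Suc n) d. cmod (p v))"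
        by (rule member_le_sum[OF v _ finite_coef_vars]) auto
      then have "cmod (p v) \<le> M" by (simp add: M_def)
      then have "cmod s * cmod (p v) \<le> cmod s * M" by (intro mult_left_mono) auto
      also have "\<dots> < \<epsilon> / 2" using s(2) M by (simp add: field_simps)
      finally show "cmod (a v + s * p v - a v) < \<epsilon> / 2" by (simp add: norm_mult)
    qed
    then show False using near_zero s(1) by blast
  qed
qed

end


section \<open>Linear combinations of the forms\<close>

definition mix :: "nat \<Rightarrow> (nat \<Rightarrow> nat \<Rightarrow> complex) \<Rightarrow> coefs \<Rightarrow> coefs" where
  "mix m M a = (\<lambda>(i, \<alpha>). if i < m then \<Sum>l<m. M i l * a (l, \<alpha>) else a (i, \<alpha>))"

lemma fval_mix: "i < m \<Longrightarrow> fval k d (mix m M a) i x = (\<Sum>l<m. M i l * fval k d a l x)"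
  unfolding fval_def mix_def
  by (simp add: sum_distrib_left sum_distrib_right mult.assoc) (rule sum.swap)

lemma common_zero_mix: "common_zero m d a \<Longrightarrow> common_zero m d (mix m M a)"
  unfolding common_zero_def by (auto simp: fval_mix)

lemma mix_mult: "mix m M (mix m M' a) = mix m (\<lambda>i j. \<Sum>k<m. M i k * M' k j) a"
proof -
  have "(\<Sum>l<m. M i l * (\<Sum>k<m. M' l k * a (k, \<alpha>))) = (\<Sum>l<m. (\<Sum>k<m. M i k * M' k l) * a (l, \<alpha>))" for i \<alpha>
    by (simp add: sum_distrib_left sum_distrib_right mult.assoc) (rule sum.swap)
  then show ?thesis by (auto simp: mix_def fun_eq_iff)
qed

lemma mix_cong: "(\<And>i j. i < m \<Longrightarrow> j < m \<Longrightarrow> M i j = M' i j) \<Longrightarrow> mix m M a = mix m M' a"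
  by (auto simp: mix_def fun_eq_iff)

lemma mix_diag:
  assumes "\<And>i j. i < m \<Longrightarrow> j < m \<Longrightarrow> M i j = (if i = j then D i else 0)"
  shows "mix m M a = (\<lambda>(i, \<alpha>). if i < m then D i * a (i, \<alpha>) else a (i, \<alpha>))"
proof -
  have "(\<Sum>l<m. M i l * a (l, \<alpha>)) = D i * a (i, \<alpha>)" if "i < m" for i \<alpha>
  proof -
    have "(\<Sum>l<m. M i l * a (l, \<alpha>)) = (\<Sum>l<m. if l = i then D i * a (i, \<alpha>) else 0)"
      by (rule sum.cong) (use assms that in auto)
    then show ?thesis using that by simp
  qed
  then show ?thesis by (auto simp: mix_def fun_eq_iff)
qed

lemma wdeg_1_lin: "wdeg (\<lambda>_. 1) (mconst c * mvar v :: ('v, 'a::comm_ring_1) mpoly) \<le> 1"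
proof -
  have "wdeg (\<lambda>_. 1) (mconst c * mvar v :: ('v, 'a) mpoly) \<le> wdeg (\<lambda>_. 1) (mconst c :: ('v, 'a) mpoly) + wdeg (\<lambda>_. 1) (mvar v :: ('v, 'a) mpoly)"
    by (rule wdeg_mult_le)
  also have "\<dots> \<le> 0 + 1"
    using wdeg_le_iff[of "\<lambda>_. 1" "mconst c :: ('v, 'a) mpoly" 0]
    by (intro add_mono order.trans[OF wdeg_mvar]) (auto simp: mconst_def wt_def)
  finally show ?thesis by simp
qed

context lower_resultant
begin

text \<open>The character \<chi>, read off at the power system, where \<open>gen\<close> is
  nonzero.\<close>

definition mix_factor :: "(nat \<Rightarrow> nat \<Rightarrow> complex) \<Rightarrow> complex" where
  "mix_factor M = mpoly_eval (mix (Suc n) M (power_system d)) gen / mpoly_eval (power_system d) gen"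

lemma gen_mix: "mpoly_eval (mix (Suc n) M a) gen = mix_factor M * mpoly_eval a gen"
proof -
  define y :: "nat \<times> (nat \<Rightarrow>\<^sub>0 nat) \<Rightarrow> cpoly" where
    "y = (\<lambda>(i, \<alpha>). if i < Suc n then \<Sum>l<Suc n. mconst (M i l) * mvar (l, \<alpha>) else mvar (i, \<alpha>))"
  have y: "(\<lambda>v. mpoly_eval a (y v)) = mix (Suc n) M a" for a
    by (auto simp: y_def mix_def fun_eq_iff ev.hom_sum ev.hom_mult ev.hom_add)
  have "\<exists>c. \<forall>a. mpoly_eval (\<lambda>v. mpoly_eval a (y v)) gen = c * mpoly_eval a gen"
  proof (rule gen_substitution)
    have "wdeg (\<lambda>_. 1) (\<Sum>l<Suc n. mconst (M i l) * mvar (l, \<alpha>) :: cpoly) \<le> 1" for i \<alpha>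
      by (rule wdeg_sum_le) (rule wdeg_1_lin)
    moreover have "wdeg (\<lambda>_. 1) (mvar v :: cpoly) \<le> 1" for v by (rule wdeg_mvar)
    ultimately show "wdeg (\<lambda>_. 1) (y v) \<le> 1" for v
      by (cases v) (auto simp: y_def simp del: sum.lessThan_Suc One_nat_def)
    show "common_zero (Suc n) d (\<lambda>v. mpoly_eval a (y v))" if "common_zero (Suc n) d a" for a
      unfolding y by (rule common_zero_mix[OF that])
  qed
  then obtain c where c: "\<And>a. mpoly_eval (mix (Suc n) M a) gen = c * mpoly_eval a gen"
    unfolding y by blast
  then have "mix_factor M = c" by (simp add: mix_factor_def gen_power_system)
  then show ?thesis using c by simp
qed

lemma mix_factor_mult: "mix_factor (\<lambda>i j. \<Sum>k<Suc n. M i k * M' k j) = mix_factor M * mix_factor M'"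
  unfolding mix_factor_def[of "\<lambda>i j. \<Sum>k<Suc n. M i k * M' k j"] mix_mult[symmetric] gen_mix
  by (simp add: gen_power_system)

lemma mix_factor_cong: "(\<And>i j. i \<le> n \<Longrightarrow> j \<le> n \<Longrightarrow> M i j = M' i j) \<Longrightarrow> mix_factor M = mix_factor M'"
  unfolding mix_factor_def using mix_cong[of "Suc n" M M'] by (simp add: less_Suc_eq_le)

text \<open>Exchanging form \<open>i\<close> with the last form multiplies \<open>gen\<close> by a
  constant, which is nonzero because the exchange is an involution. Comparing the effect of scaling
  either block by 2 shows that the two degrees agree.\<close>

lemma wdeg_block_gen_eq:
  assumes i: "i \<le> n"
  shows "wdeg (block i) gen = d ^ n"
proof -
  have last: "wdeg (block n) gen = d ^ n"
    using gen(4) vdeg_gen vdeg_le_wdeg[of "block n" top_var gen] by (simp add: block_def)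
  define \<tau> where "\<tau> = (\<lambda>k. if k = i then n else if k = n then i else k)"
  have \<tau>: "\<tau> (\<tau> k) = k" "\<tau> k < Suc n \<longleftrightarrow> k < Suc n" "\<tau> k = n \<longleftrightarrow> k = i" for k
    using i by (auto simp: \<tau>_def)
  have "\<exists>c. \<forall>a. mpoly_eval (\<lambda>v. mpoly_eval a (mvar (\<tau> (fst v), snd v))) gen = c * mpoly_eval a gen"
  proof (rule gen_substitution)
    show "wdeg (\<lambda>_. 1) (mvar (\<tau> (fst v), snd v)) \<le> 1" for v :: "nat \<times> (nat \<Rightarrow>\<^sub>0 nat)" by (rule wdeg_mvar)
    fix a assume "common_zero (Suc n) d a"
    moreover have "fval (Suc n) d (\<lambda>v. a (\<tau> (fst v), snd v)) j x = fval (Suc n) d a (\<tau> j) x" for j x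
      by (simp add: fval_def)
    ultimately show "common_zero (Suc n) d (\<lambda>v. mpoly_eval a (mvar (\<tau> (fst v), snd v)))"
      using \<tau>(2) unfolding common_zero_def by (auto simp del: less_Suc_eq)
  qed
  then obtain c where c: "\<And>a. mpoly_eval (\<lambda>v. a (\<tau> (fst v), snd v)) gen = c * mpoly_eval a gen" by auto
  let ?p = "power_system d"
  have "mpoly_eval ?p gen = c * (c * mpoly_eval ?p gen)"
    using c[of "\<lambda>v. ?p (\<tau> (fst v), snd v)"] c[of ?p] by (simp add: \<tau>(1))
  then have c0: "c \<noteq> 0" using gen_power_system by auto
  have "(\<lambda>v. 2 ^ block n (\<tau> (fst v), snd v) * ?p (\<tau> (fst v), snd v)) = (\<lambda>v. 2 ^ block i v * ?p (\<tau> (fst v), snd v))"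
    by (auto simp: block_def \<tau>(3))
  moreover have "mpoly_eval (\<lambda>v. 2 ^ block n (\<tau> (fst v), snd v) * ?p (\<tau> (fst v), snd v)) gen = c * (2 ^ wdeg (block n) gen * mpoly_eval ?p gen)"
    using c[of "\<lambda>v. 2 ^ block n v * ?p v"] by (simp add: gen_block_homogeneous)
  moreover have "mpoly_eval (\<lambda>v. 2 ^ block i v * ?p (\<tau> (fst v), snd v)) gen = 2 ^ wdeg (block i) gen * (c * mpoly_eval ?p gen)"
    by (simp add: gen_block_homogeneous[of 2 i "\<lambda>v. ?p (\<tau> (fst v), snd v)"] c)
  ultimately have "(2::complex) ^ wdeg (block n) gen = 2 ^ wdeg (block i) gen"
    using c0 gen_power_system by simp
  then have "(2::real) ^ wdeg (block n) gen = 2 ^ wdeg (block i) gen"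
    by (metis norm_numeral norm_power)
  then show ?thesis using last by simp
qed

lemma gen_scale_blocks:
  "mpoly_eval (\<lambda>(i, \<alpha>). if i < Suc n then D i * a (i, \<alpha>) else a (i, \<alpha>)) gen = (\<Prod>i<Suc n. D i) ^ (d ^ n) * mpoly_eval a gen"
proof -
  have "mpoly_eval (\<lambda>(i, \<alpha>). if i < m then D i * a (i, \<alpha>) else a (i, \<alpha>)) gen = (\<Prod>i<m. D i) ^ (d ^ n) * mpoly_eval a gen"
    if "m \<le> Suc n" for m
    using that
  proof (induction m)
    case 0
    then show ?case by (simp add: case_prod_unfold)
  next
    case (Suc m)
    let ?b = "\<lambda>(i, \<alpha>). if i < m then D i * a (i, \<alpha>) else a (i, \<alpha>)"
    have "(\<lambda>(i, \<alpha>). if i < Suc m then D i * a (i, \<alpha>) else a (i, \<alpha>)) = (\<lambda>v. D m ^ block m v * ?b v)"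
      by (auto simp: block_def less_Suc_eq)
    then show ?case
      using Suc by (simp add: gen_block_homogeneous wdeg_block_gen_eq power_mult_distrib del: prod.lessThan_Suc)
        (simp add: power_mult_distrib)
  qed
  then show ?thesis by blast
qed

lemma mix_factor_diag:
  assumes "\<And>i j. i \<le> n \<Longrightarrow> j \<le> n \<Longrightarrow> M i j = (if i = j then D i else 0)"
  shows "mix_factor M = (\<Prod>i<Suc n. D i) ^ (d ^ n)"
proof -
  have "mix (Suc n) M a = (\<lambda>(i, \<alpha>). if i < Suc n then D i * a (i, \<alpha>) else a (i, \<alpha>))" for a
    by (rule mix_diag) (use assms in auto)
  then show ?thesis by (simp only: mix_factor_def gen_scale_blocks) (simp add: gen_power_system)
qed

text \<open>Conjugation by \<open>diag (1, t, t\<^sup>2, \<dots>)\<close> and the limit \<open>t \<rightarrow> 0\<close> remove the entries above the diagonal.\<close>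

lemma mix_factor_triangular:
  assumes "\<And>i j. j < i \<Longrightarrow> i \<le> n \<Longrightarrow> M i j = 0"
  shows "mix_factor M = (\<Prod>i<Suc n. M i i) ^ (d ^ n)"
proof -
  \<comment> \<open>Conjugation of \<open>M\<close> by \<open>D t\<close>, written without negative
    powers of \<open>t\<close>, so that it also makes sense at \<open>t = 0\<close>, where only the
    diagonal remains.\<close>
  define B where "B t i j = (if i \<le> j then t ^ (j - i) * M i j else 0)" for t i j
  define D where "D t i j = (if i = j then t ^ i else 0 :: complex)" for t and i j :: nat
  define q where "q = msubst (\<lambda>c. [:c:]) (\<lambda>(i, \<alpha>). if i < Suc n then
      \<Sum>l<Suc n. (if i \<le> l then monom (M i l) (l - i) else 0) * [:power_system d (l, \<alpha>):] else [:power_system d (i, \<alpha>):]) gen"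
  have q: "poly q t = mpoly_eval (mix (Suc n) (B t) (power_system d)) gen" for t
    unfolding q_def poly_msubst
    by (rule arg_cong[of _ _ "\<lambda>x. mpoly_eval x gen"])
      (auto simp: mix_def B_def fun_eq_iff poly_sum poly_monom mult_ac simp del: sum.lessThan_Suc intro!: sum.cong)
  have const: "mix_factor (B t) = mix_factor M" if t: "t \<noteq> 0" for t
  proof -
    have "(\<Sum>k<Suc n. D t i k * B t k j) = (\<Sum>k<Suc n. M i k * D t k j)" if "i \<le> n" "j \<le> n" for i j
    proof -
      have "(\<Sum>k<Suc n. D t i k * B t k j) = (\<Sum>k<Suc n. if k = i then t ^ i * B t i j else 0)"
        by (rule sum.cong) (auto simp: D_def)
      also have "\<dots> = t ^ i * B t i j" using that by simp
      also have "\<dots> = M i j * t ^ j"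
        using assms[of j i] that by (auto simp: B_def power_add[symmetric] mult.assoc[symmetric] not_le)
      also have "\<dots> = (\<Sum>k<Suc n. if k = j then M i j * t ^ j else 0)" using that by simp
      also have "\<dots> = (\<Sum>k<Suc n. M i k * D t k j)" by (rule sum.cong) (auto simp: D_def)
      finally show ?thesis .
    qed
    then have "mix_factor (\<lambda>i j. \<Sum>k<Suc n. D t i k * B t k j) = mix_factor (\<lambda>i j. \<Sum>k<Suc n. M i k * D t k j)"
      by (rule mix_factor_cong)
    then have "mix_factor (D t) * mix_factor (B t) = mix_factor M * mix_factor (D t)" unfolding mix_factor_mult .
    moreover have "mix_factor (D t) = (\<Prod>i<Suc n. t ^ i) ^ (d ^ n)" by (rule mix_factor_diag) (simp add: D_def)
    then have "mix_factor (D t) \<noteq> 0" using t by simp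
    ultimately show ?thesis by simp
  qed
  define r where "r = q - [:mix_factor M * mpoly_eval (power_system d) gen:]"
  have "poly r t = 0" if "t \<noteq> 0" for t
    using const[OF that] by (simp add: r_def q gen_mix)
  then have "r = 0"
    by (intro poly_eq_0_of_roots[where S = "of_nat ` {1..Suc (degree r)}"]) (auto simp: card_image inj_on_def)
  then have "poly r 0 = 0" by simp
  then have "mix_factor M = mix_factor (B 0)" using gen_power_system by (simp add: r_def q gen_mix)
  also have "\<dots> = (\<Prod>i<Suc n. M i i) ^ (d ^ n)"
    by (rule mix_factor_diag) (auto simp: B_def power_0_left)
  finally show ?thesis .
qed

theorem mix_factor_eq_det:
  assumes G: "G \<in> carrier_mat (Suc n) (Suc n)"
  shows "mix_factor (\<lambda>i j. G $$ (i, j)) = det G ^ (d ^ n)"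
proof -
  obtain as where "char_poly G = (\<Prod>a\<leftarrow>as. [:- a, 1:])" using char_poly_factorized[OF G] by blast
  then obtain B where B: "B \<in> carrier_mat (Suc n) (Suc n)" "upper_triangular B" "similar_mat G B"
    using schur_decomposition_exists[OF G] by blast
  then obtain P Q where wit: "similar_mat_wit G B P Q" unfolding similar_mat_def by blast
  note PQ = similar_mat_witD2[OF G wit]
  have entries: "(X * Y) $$ (i, j) = (\<Sum>k<Suc n. X $$ (i, k) * Y $$ (k, j))"
    if "X \<in> carrier_mat (Suc n) (Suc n)" "Y \<in> carrier_mat (Suc n) (Suc n)" "i \<le> n" "j \<le> n" for X Y :: "complex mat" and i j
    using that by (auto simp: scalar_prod_def atLeast0LessThan simp del: sum.lessThan_Suc)
  have mult: "mix_factor (\<lambda>i j. (X * Y) $$ (i, j)) = mix_factor (\<lambda>i j. X $$ (i, j)) * mix_factor (\<lambda>i j. Y $$ (i, j))"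
    if "X \<in> carrier_mat (Suc n) (Suc n)" "Y \<in> carrier_mat (Suc n) (Suc n)" for X Y :: "complex mat"
    unfolding mix_factor_mult[symmetric] by (rule mix_factor_cong) (use entries[OF that] in auto)
  have "mix_factor (\<lambda>i j. (P * Q) $$ (i, j)) = (\<Prod>i<Suc n. 1) ^ (d ^ n)"
    unfolding PQ(1) by (rule mix_factor_diag) auto
  then have "mix_factor (\<lambda>i j. P $$ (i, j)) * mix_factor (\<lambda>i j. Q $$ (i, j)) = 1"
    using mult[of P Q] PQ(6,7) by simp
  then have "mix_factor (\<lambda>i j. G $$ (i, j)) = mix_factor (\<lambda>i j. B $$ (i, j))"
    using PQ mult[of "P * B" Q] mult[of P B] by simp
  also have "\<dots> = (\<Prod>i<Suc n. B $$ (i, i)) ^ (d ^ n)"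
    by (rule mix_factor_triangular) (use B in auto)
  also have "(\<Prod>i<Suc n. B $$ (i, i)) = det B"
    using det_upper_triangular[OF B(2,1)] B(1) by (simp add: prod_list_diag_prod atLeast0LessThan del: prod.lessThan_Suc)
  also have "det B = det G" by (rule det_similar[OF B(3), symmetric])
  finally show ?thesis .
qed

text \<open>Supplies \<open>R_scale\<close> for one variable more. Dividing \<open>x_n\<close> by
  \<open>t\<close> carries the zeros over, so \<open>gen\<close> changes by a constant factor. At
  the power system only the last form changes, by the factor \<open>t^d\<close>, and
  \<open>gen\<close> has degree \<open>d ^ n\<close> in that block.\<close>

lemma gen_scale_last:
  assumes t: "t \<noteq> 0"
  shows "mpoly_eval (\<lambda>(i, \<beta>). t ^ expo \<beta> n * a (i, \<beta>)) gen = t ^ (d ^ Suc n) * mpoly_eval a gen"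
proof -
  define y :: "nat \<times> (nat \<Rightarrow>\<^sub>0 nat) \<Rightarrow> cpoly" where
    "y v = mconst (t ^ expo (snd v) n) * mvar v" for v
  have y: "(\<lambda>v. mpoly_eval a (y v)) = (\<lambda>(i, \<beta>). t ^ expo \<beta> n * a (i, \<beta>))" for a
    by (auto simp: y_def ev.hom_mult)
  have "\<exists>c. \<forall>a. mpoly_eval (\<lambda>v. mpoly_eval a (y v)) gen = c * mpoly_eval a gen"
  proof (rule gen_substitution)
    show "wdeg (\<lambda>_. 1) (y v) \<le> 1" for v unfolding y_def by (rule wdeg_1_lin)
    fix a assume "common_zero (Suc n) d a"
    then obtain x where x: "\<exists>j<Suc n. x j \<noteq> 0" "\<And>i. i < Suc n \<Longrightarrow> fval (Suc n) d a i x = 0"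
      unfolding common_zero_def by blast
    define x' where "x' = x(n := x n / t)"
    have "t ^ expo \<beta> n * mon_eval x' \<beta> = mon_eval x \<beta>" if "\<beta> \<in> monomials (Suc n) d" for \<beta>
      using t by (simp add: mon_eval_monomial[OF that] x'_def power_divide)
    then have "fval (Suc n) d (\<lambda>v. mpoly_eval a (y v)) i x' = fval (Suc n) d a i x" for i
      unfolding y fval_def by (intro sum.cong refl) (simp add: mult_ac)
    moreover have "\<exists>j<Suc n. x' j \<noteq> 0" using x(1) t by (auto simp: x'_def)
    ultimately show "common_zero (Suc n) d (\<lambda>v. mpoly_eval a (y v))"
      unfolding common_zero_def using x(2) by auto
  qed
  then obtain c where c: "\<And>a. mpoly_eval (\<lambda>(i, \<beta>). t ^ expo \<beta> n * a (i, \<beta>)) gen = c * mpoly_eval a gen"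
    unfolding y by blast
  have "(\<lambda>(i, \<beta>). t ^ expo \<beta> n * power_system d (i, \<beta>)) = (\<lambda>v. (t ^ d) ^ block n v * power_system d v)"
    by (auto simp: power_system_def block_def lookup_single when_def)
  then have "mpoly_eval (\<lambda>(i, \<beta>). t ^ expo \<beta> n * power_system d (i, \<beta>)) gen =
      (t ^ d) ^ (d ^ n) * mpoly_eval (power_system d) gen"
    by (simp only: gen_block_homogeneous wdeg_block_gen_eq[OF le_refl])
  then have "c * mpoly_eval (power_system d) gen = (t ^ d) ^ (d ^ n) * mpoly_eval (power_system d) gen"
    unfolding c .
  then have "c = (t ^ d) ^ (d ^ n)" using gen_power_system by simp
  then have "c = t ^ (d ^ Suc n)" by (simp add: power_mult)
  then show ?thesis using c by simp
qed

lemma lower_resultant_Suc: "lower_resultant (Suc n) d gen"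
proof
  show "Suc n > 0" "d > 0" using d by auto
  show "invars (coef_vars (Suc n) d) gen" by (rule gen(3))
  show "mpoly_eval a gen = 0 \<longleftrightarrow> common_zero (Suc n) d a" for a by (rule gen_zero_iff)
  show "mpoly_eval (\<lambda>(i, \<beta>). t ^ expo \<beta> (Suc n - 1) * a (i, \<beta>)) gen = t ^ (d ^ Suc n) * mpoly_eval a gen"
    if "t \<noteq> 0" for t a using gen_scale_last[OF that] by simp
qed

end

section \<open>Induction on the number of variables\<close>

lemma monomials_1: "monomials 1 d = {Poly_Mapping.single 0 d}"
proof (intro equalityI subsetI)
  fix \<alpha> :: "nat \<Rightarrow>\<^sub>0 nat" assume "\<alpha> \<in> monomials 1 d"
  then have "Poly_Mapping.keys \<alpha> \<subseteq> {..<1}" "expo \<alpha> 0 = d" by (auto simp: mem_monomials_iff)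
  then have "\<alpha> = Poly_Mapping.single 0 d"
    using lookup_outside[of \<alpha> 1] by (intro poly_mapping_eqI) (auto simp: lookup_single when_def)
  then show "\<alpha> \<in> {Poly_Mapping.single 0 d}" by simp
next
  fix \<alpha> :: "nat \<Rightarrow>\<^sub>0 nat" assume "\<alpha> \<in> {Poly_Mapping.single 0 d}"
  then show "\<alpha> \<in> monomials 1 d" using single_in_monomials[of 0 1 d] by simp
qed

text \<open>A form in one variable is \<open>c x_0^d\<close>, and it has a nontrivial zero exactly
  when \<open>c = 0\<close>.\<close>

lemma lower_resultant_1:
  assumes "d > 0"
  shows "lower_resultant 1 d (mvar (0, Poly_Mapping.single 0 d))"
proof
  show "(0::nat) < 1" "d > 0" using assms by auto
  show "invars (coef_vars 1 d) (mvar (0, Poly_Mapping.single 0 d) :: cpoly)"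
    by (rule invars_mvar) (simp add: coef_vars_def monomials_1 del: One_nat_def)
  fix a :: coefs
  have fval: "fval 1 d a i x = a (i, Poly_Mapping.single 0 d) * x 0 ^ d" for i x
    by (simp add: fval_def monomials_1 del: One_nat_def)
  show "mpoly_eval a (mvar (0, Poly_Mapping.single 0 d)) = 0 \<longleftrightarrow> common_zero 1 d a"
  proof
    assume "mpoly_eval a (mvar (0, Poly_Mapping.single 0 d)) = 0"
    then show "common_zero 1 d a" unfolding common_zero_def by (intro exI[of _ "\<lambda>_. 1"]) (simp add: fval del: One_nat_def)
  next
    assume "common_zero 1 d a"
    then show "mpoly_eval a (mvar (0, Poly_Mapping.single 0 d)) = 0"
      by (auto simp: common_zero_def fval simp del: One_nat_def)
  qed
  show "mpoly_eval (\<lambda>(i, \<beta>). t ^ expo \<beta> (1 - 1) * a (i, \<beta>)) (mvar (0, Poly_Mapping.single 0 d)) =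
      t ^ (d ^ 1) * mpoly_eval a (mvar (0, Poly_Mapping.single 0 d))" for t by simp
qed

lemma lower_resultant_exists:
  assumes "d > 0" "n > 0"
  shows "\<exists>R. lower_resultant n d R"
  using assms(2)
proof (induction n rule: nat_induct_non_zero)
  case 1
  then show ?case using lower_resultant_1[OF assms(1)] by blast
next
  case (Suc n)
  then obtain R where "lower_resultant n d R" by blast
  then show ?case using lower_resultant.lower_resultant_Suc by blast
qed


section \<open>The resultant and the E-determinant\<close>

lemma fval_coeffs_of:
  assumes "F i \<in> forms n d"
  shows "fval n d (coeffs_of F) i x = mpoly_eval x (F i)"
  using assms mpoly_eval_superset[of "monomials n d" "F i" x]
  by (simp add: fval_def coeffs_of_def forms_def)

lemma has_common_zero_iff:
  assumes "\<And>i. i < n \<Longrightarrow> F i \<in> forms n d"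
  shows "has_common_zero n F \<longleftrightarrow> common_zero n d (coeffs_of F)"
proof
  assume "has_common_zero n F"
  then obtain x where x: "x \<in> carrier_vec n" "x \<noteq> 0\<^sub>v n" "\<And>i. i < n \<Longrightarrow> mpoly_eval (\<lambda>j. x $ j) (F i) = 0"
    unfolding has_common_zero_def by blast
  have "\<exists>j<n. x $ j \<noteq> 0"
  proof (rule ccontr)
    assume "\<not> ?thesis"
    then have "x = 0\<^sub>v n" using x(1) by (intro eq_vecI) auto
    with x(2) show False by simp
  qed
  then show "common_zero n d (coeffs_of F)"
    unfolding common_zero_def using x(3) assms by (intro exI[of _ "\<lambda>j. x $ j"]) (auto simp: fval_coeffs_of)
next
  assume "common_zero n d (coeffs_of F)"
  then obtain x j where x: "j < n" "x j \<noteq> 0" "\<And>i. i < n \<Longrightarrow> fval n d (coeffs_of F) i x = 0"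
    unfolding common_zero_def by blast
  have "mpoly_eval (\<lambda>j. vec n x $ j) (F i) = 0" if i: "i < n" for i
  proof -
    have "mpoly_eval (\<lambda>j. vec n x $ j) (F i) = fval n d (coeffs_of F) i (\<lambda>j. vec n x $ j)"
      using assms[OF i] by (simp add: fval_coeffs_of)
    also have "\<dots> = fval n d (coeffs_of F) i x" by (rule fval_cong) simp
    finally show ?thesis using x(3)[OF i] by simp
  qed
  moreover have "vec n x \<noteq> 0\<^sub>v n"
  proof
    assume "vec n x = 0\<^sub>v n"
    then have "vec n x $ j = 0" using x(1) by simp
    then show False using x(1,2) by simp
  qed
  ultimately show "has_common_zero n F"
    unfolding has_common_zero_def by (intro bexI[of _ "vec n x"]) auto
qed

lemma coeffs_of_power_forms:
  "coeffs_of (\<lambda>i. Poly_Mapping.single (Poly_Mapping.single i d) 1) = power_system d"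
  by (auto simp: coeffs_of_def power_system_def lookup_single when_def fun_eq_iff)

lemma mpoly_eval_coeffs_cong:
  assumes "invars (coef_vars n d) p" "\<And>i \<alpha>. i < n \<Longrightarrow> \<alpha> \<in> monomials n d \<Longrightarrow> a (i, \<alpha>) = b (i, \<alpha>)"
  shows "mpoly_eval a p = mpoly_eval b (p :: cpoly)"
proof (rule mpoly_eval_cong)
  fix \<mu> v assume "\<mu> \<in> Poly_Mapping.keys p" "v \<in> Poly_Mapping.keys \<mu>"
  then have "v \<in> {..<n} \<times> monomials n d" using assms(1) unfolding invars_def coef_vars_def by blast
  then show "a v = b v" using assms(2) by auto
qed

text \<open>The defining property speaks of forms, the ideal of arbitrary assignments; cutting an
  assignment down to the monomials of degree \<open>d\<close> changes neither side.\<close>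

lemma is_resultant_zero_ideal:
  assumes "is_resultant n d R"
  shows "R \<in> zero_ideal n d"
  unfolding zero_ideal_def
proof (intro CollectI allI impI)
  fix a assume a: "common_zero n d a"
  define F where "F i = (\<Sum>\<alpha>\<in>monomials n d. Poly_Mapping.single \<alpha> (a (i, \<alpha>)))" for i
  have F: "mcoeff (F i) \<alpha> = (if \<alpha> \<in> monomials n d then a (i, \<alpha>) else 0)" for i \<alpha>
    by (simp add: F_def lookup_sum lookup_single when_def)
  have forms: "F i \<in> forms n d" for i by (auto simp: forms_def in_keys_iff F split: if_splits)
  have "fval n d (coeffs_of F) i x = fval n d a i x" for i x
    by (simp add: fval_def coeffs_of_def F)
  then have "common_zero n d (coeffs_of F)" using a by (simp add: common_zero_def)
  then have "mpoly_eval (coeffs_of F) R = 0"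
    using assms forms has_common_zero_iff[of n F d] unfolding is_resultant_def by blast
  moreover have "mpoly_eval (coeffs_of F) R = mpoly_eval a R"
    by (rule mpoly_eval_coeffs_cong)
      (use assms in \<open>auto simp: is_resultant_def invars_def coef_vars_def coeffs_of_def F\<close>)
  ultimately show "mpoly_eval a R = 0" by simp
qed

lemma irreducible_unit_mult:
  fixes p u :: "'a::comm_semiring_1"
  assumes "irreducible p" "u * u' = 1"
  shows "irreducible (u * p)"
  unfolding irreducible_def
proof (intro conjI allI impI)
  have u': "p = u' * (u * p)"
    using assms(2) by (metis mult.assoc mult.commute mult_1)
  show "u * p \<noteq> 0" using u' assms(1) by (metis irreducible_def mult_zero_right)
  show "\<not> u * p dvd 1" using assms(1) by (meson dvd_mult_right irreducible_def)
  fix a b assume "u * p = a * b"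
  then have "p = (u' * a) * b" using u' by (simp add: mult.assoc)
  then have "u' * a dvd 1 \<or> b dvd 1" using assms(1) unfolding irreducible_def by blast
  then show "a dvd 1 \<or> b dvd 1" using dvd_mult_right by blast
qed

section \<open>Existence and uniqueness of the resultant\<close>

context lower_resultant
begin

definition normalized_gen :: cpoly where
  "normalized_gen = mconst (inverse (mpoly_eval (power_system d) gen)) * gen"

lemma eval_normalized_gen: "mpoly_eval a normalized_gen = inverse (mpoly_eval (power_system d) gen) * mpoly_eval a gen"
  by (simp add: normalized_gen_def ev.hom_mult)

lemma is_resultant_normalized_gen: "is_resultant (Suc n) d normalized_gen"
  unfolding is_resultant_def
proof (intro conjI allI impI)
  let ?c = "mpoly_eval (power_system d) gen"
  have "invars (coef_vars (Suc n) d) normalized_gen"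
    unfolding normalized_gen_def by (intro invars_mult invars_mconst gen(3))
  then show "\<forall>\<mu>\<in>Poly_Mapping.keys normalized_gen. Poly_Mapping.keys \<mu> \<subseteq> {..<Suc n} \<times> monomials (Suc n) d"
    by (simp add: invars_def coef_vars_def)
  have "mconst (inverse ?c) * mconst ?c = (1 :: cpoly)"
    using gen_power_system by (simp add: mconst_def mult_single)
  then show "irreducible normalized_gen"
    unfolding normalized_gen_def by (rule irreducible_unit_mult[OF gen(1)])
  show "mpoly_eval (coeffs_of F) normalized_gen = 0 \<longleftrightarrow> has_common_zero (Suc n) F"
    if "\<forall>i<Suc n. F i \<in> forms (Suc n) d" for F
    using that has_common_zero_iff[of "Suc n" F d] gen_power_system by (simp add: eval_normalized_gen gen_zero_iff)
  show "mpoly_eval (coeffs_of (\<lambda>i. Poly_Mapping.single (Poly_Mapping.single i d) 1)) normalized_gen = 1"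
    using gen_power_system by (simp add: coeffs_of_power_forms eval_normalized_gen)
qed

text \<open>Any resultant is a multiple of \<open>gen\<close>; irreducibility makes the cofactor a
  constant, and the normalization determines it.\<close>

lemma is_resultant_unique:
  assumes "is_resultant (Suc n) d R'"
  shows "R' = normalized_gen"
proof -
  obtain h where h: "R' = gen * h"
    using gen_dvd[OF is_resultant_zero_ideal[OF assms]] by (auto simp: dvd_def)
  have "irreducible R'" using assms by (simp add: is_resultant_def)
  then have "h dvd 1" using h gen(1) unfolding irreducible_def by blast
  then have "wdeg (\<lambda>_. 1) h = 0" using is_unit_iff_wdeg_1[of h] by blast
  then have h': "h = mconst (mcoeff h 0)" by (rule wdeg_1_eq_0)
  have "mpoly_eval (power_system d) R' = 1"
    using assms by (simp add: is_resultant_def coeffs_of_power_forms)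
  then have "mpoly_eval (power_system d) gen * mpoly_eval (power_system d) h = 1" by (simp add: h ev.hom_mult)
  moreover have "mpoly_eval (power_system d) h = mcoeff h 0" by (subst h') (rule mpoly_eval_mconst)
  ultimately have inv: "mcoeff h 0 = inverse (mpoly_eval (power_system d) gen)"
    using inverse_unique[of "mpoly_eval (power_system d) gen"] by simp
  have "h = mconst (inverse (mpoly_eval (power_system d) gen))" using h' by (simp only: inv)
  then show ?thesis unfolding h normalized_gen_def by (simp add: mult.commute)
qed

lemma resultant_poly_eq: "resultant_poly (Suc n) d = normalized_gen"
  unfolding resultant_poly_def by (rule the_equality) (rule is_resultant_normalized_gen, rule is_resultant_unique)

theorem resultant_poly_mix:
  assumes "G \<in> carrier_mat (Suc n) (Suc n)"
  shows "mpoly_eval (mix (Suc n) (\<lambda>i j. G $$ (i, j)) a) (resultant_poly (Suc n) d) =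
    det G ^ (d ^ n) * mpoly_eval a (resultant_poly (Suc n) d)"
  by (simp add: resultant_poly_eq eval_normalized_gen gen_mix mix_factor_eq_det[OF assms])

end

lemma lookup_tensor_form:
  "mcoeff (tensor_form n m T i) \<alpha> =
     (\<Sum>js \<in> index_lists n (m - 1). if (\<Sum>j\<leftarrow>js. Poly_Mapping.single j 1) = \<alpha> then T (i # js) else 0)"
  by (simp add: tensor_form_def lookup_sum lookup_single when_def)

text \<open>The resultant is evaluated at coefficients, so the composition has to be followed on
  coefficients and not on values of the forms.\<close>

lemma lookup_tensor_form_comp:
  assumes "i < n" "q \<ge> 1"
  shows "mcoeff (tensor_form n q (tensor_comp n q G V) i) \<alpha> = (\<Sum>l<n. G $$ (i, l) * mcoeff (tensor_form n q V l) \<alpha>)"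
proof -
  have "i # js \<in> index_lists n q" if "js \<in> index_lists n (q - 1)" for js
    using that assms by (auto simp: index_lists_def)
  then have "mcoeff (tensor_form n q (tensor_comp n q G V) i) \<alpha> =
      (\<Sum>js \<in> index_lists n (q - 1). \<Sum>l<n. G $$ (i, l) * (if (\<Sum>j\<leftarrow>js. Poly_Mapping.single j 1) = \<alpha> then V (l # js) else 0))"
    unfolding lookup_tensor_form by (intro sum.cong refl) (simp add: tensor_comp_def)
  also have "\<dots> = (\<Sum>l<n. \<Sum>js \<in> index_lists n (q - 1). G $$ (i, l) * (if (\<Sum>j\<leftarrow>js. Poly_Mapping.single j 1) = \<alpha> then V (l # js) else 0))"
    by (rule sum.swap)
  finally show ?thesis by (simp only: lookup_tensor_form sum_distrib_left)
qed

theorem proposition4p3: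
  fixes n q :: nat and G :: "complex mat" and V :: tensor
  assumes "n \<ge> 2" and "q \<ge> 2"
    and "G \<in> carrier_mat n n"
    and "V \<in> tensors n q"
  shows "Edet n q (tensor_comp n q G V) = det G ^ ((q - 1) ^ (n - 1)) * Edet n q V"
proof -
  define m d where "m = n - 1" and "d = q - 1"
  have nm: "n = Suc m" and "m > 0" "d > 0" using assms by (auto simp: m_def d_def)
  \<comment> \<open>At \<open>m = n - 1\<close> the locale describes \<open>n\<close> forms in
    \<open>n\<close> variables, whence the exponent \<open>d ^ m\<close>.\<close>
  then obtain R where "lower_resultant m d R" using lower_resultant_exists by blast
  then interpret lower_resultant m d R .
  let ?W = "tensor_form n q (tensor_comp n q G V)" and ?V = "tensor_form n q V"
  have "invars (coef_vars (Suc m) d) normalized_gen"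
    using is_resultant_normalized_gen by (simp add: is_resultant_def invars_def coef_vars_def)
  then have "invars (coef_vars n d) (resultant_poly n d)" by (simp only: nm resultant_poly_eq)
  then have "mpoly_eval (coeffs_of ?W) (resultant_poly n d) =
      mpoly_eval (mix n (\<lambda>i j. G $$ (i, j)) (coeffs_of ?V)) (resultant_poly n d)"
  proof (rule mpoly_eval_coeffs_cong)
    fix i \<alpha> assume "i < n"
    then show "coeffs_of ?W (i, \<alpha>) = mix n (\<lambda>i j. G $$ (i, j)) (coeffs_of ?V) (i, \<alpha>)"
      using lookup_tensor_form_comp[of i n q G V \<alpha>] assms(2) by (simp add: coeffs_of_def mix_def)
  qed
  also have "\<dots> = det G ^ (d ^ m) * mpoly_eval (coeffs_of ?V) (resultant_poly n d)"
    unfolding nm by (rule resultant_poly_mix) (use assms(3) nm in simp)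
  finally show ?thesis by (simp add: Edet_def resultant_def Defs.resultant_def m_def d_def)
qed

end
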